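(* Let $d\ge2$ and let $F=(F_1,\dots,F_d)$ be an infinitely differentiable vector field on $\mathbb{R}^d$ whose components all belong to the Schwartz class $\mathcal{S}(\mathbb{R}^d)$. For each $\omega\in\mathbb{S}^{d-1}$ let $(\omega,\omega_1,\dots,\omega_{d-1})$, with $\omega_k=\omega_k(\omega)$, be an arbitrarily chosen orthonormal basis of $\mathbb{R}^d$ extending $\omega$. Let $\Phi=\operatorname{div}F$, let $F^{\mathrm s}$ be the solenoidal part of $F$, and let $\Psi=(\Psi_1,\dots,\Psi_d)$, $\Psi_j=\Delta F^{\mathrm s}_j$, be the componentwise Laplacian of $F^{\mathrm s}$. Let $e_1,\dots,e_d$ be the canonical basis of $\mathbb{R}^d$. Then: (1) $\Psi$ and its componentwise Radon transform can be reconstructed from the longitudinal transforms $\mathcal{D}_j^{\parallel}F$, $j=1,\dots,d-1$, by $$[\mathfrak{R}\Psi](\omega,p)=\frac{\partial^2}{\partial p^2}\sum_{j=1}^{d-1}\omega_j\,[\mathcal{D}_j^{\parallel}F](\omega,p),\qquad(\omega,p)\in\mathbb{S}^{d-1}\times\mathbb{R},$$ $$\Psi_j(x)=\left[\mathcal{R}^{-1}\left(e_j\cdot\mathfrak{R}\Psi\right)\right](x),\qquad x\in\mathbb{R}^d,\quad j=1,\dots,d;$$ (2) $\Phi$ can be reconstructed from the linearly weighted longitudinal transform $\mathcal{W}_1^{\parallel}F$ and $\Psi$ by $$\Phi(x)=\left[\mathcal{R}^{-1}\left\{\mathcal{R}\big((x\cdot\omega_1)\,\omega_1\cdot\Psi(x)\big)-\frac{\partial^2}{\partial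 p^2}\mathcal{W}_1^{\parallel}F\right\}\right](x),\qquad x\in\mathbb{R}^d;$$ (3) the field $F$ is reconstructed from $\Phi$ and $\Psi$ by $$F(x)=(\Phi\ast\nabla G)(x)+\sum_{j=1}^{d}e_j\,(\Psi_j\ast G)(x),\qquad x\in\mathbb{R}^d,$$ where $G$ is the fundamental solution of the Laplace equation in $\mathbb{R}^d$. Here $\mathcal{R}^{-1}$ denotes the filtration/backprojection operator (with any fixed real $\alpha<d$) $\mathcal{R}^{-1}g=\frac12(2\pi)^{1-d}I^{-\alpha}\mathcal{R}^{\#}I^{\alpha-d+1}g$.
   Context: For $(\omega,p)\in\mathbb{S}^{d-1}\times\mathbb{R}$ let $\Pi(\omega,p)=\{x\in\mathbb{R}^d:\omega\cdot x=p\}$, with standard area element $dA_\Pi$. The Radon transform of a continuous function $f$ that decays fast enough is $[\mathcal{R}f](\omega,p)=\int_{\Pi(\omega,p)}f(x)\,dA_\Pi(x)$; when the integrand depends on $\omega_1=\omega_1(\omega)$, as in $\mathcal{R}((x\cdot\omega_1)\,\omega_1\cdot\Psi(x))$, the value at $(\omega,p)$ is computed with $\omega_1=\omega_1(\omega)$ for that same $\omega$. For a vector field $F$: - componentwise Radon transform: $[\mathfrak{R}F](\omega,p)=([\mathcal{R}F_1](\omega,p),\dots,[\mathcal{R}F_d](\omega,p))$; - longitudinal Radon transforms: $[\mathcal{D}_k^{\parallel}F](\omega,p)=\int_{\Pi(\omega,p)}\omega_k\cdot F(x)\,dA_\Pi(x)$, $k=1,\dots,d-1$; - weighted longitudinal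 transforms: $[\mathcal{W}_k^{\parallel}F](\omega,p)=\int_{\Pi(\omega,p)}(\omega_k\cdot x)\,(F(x)\cdot\omega_k)\,dA_\Pi(x)$, $k=1,\dots,d-1$. Helmholtz decomposition: $\varphi=\Phi\ast G$ with $\Phi=\operatorname{div}F$, potential part $F^{\mathrm p}=\nabla\varphi$, solenoidal part $F^{\mathrm s}=F-F^{\mathrm p}$. The fundamental solution of the Laplace equation ($\Delta G=\delta$) is $G(x)=\frac1{2\pi}\ln|x|$ for $d=2$ and $G(x)=-\frac{\Gamma(d/2-1)}{4\pi^{d/2}}|x|^{2-d}$ for $d\ge3$; $(f\ast G)(x)=\int_{\mathbb{R}^d}f(y)G(x-y)\,dy$. Inversion operator: the dual Radon transform is $[\mathcal{R}^{\#}g](x)=\int_{\mathbb{S}^{d-1}}g(\omega,\omega\cdot x)\,d\omega$. The Riesz potential is $I^{\beta}f=\mathcal{F}^{-1}(|\xi|^{-\beta}\mathcal{F}f)$, where $\mathcal{F}$ is the Fourier transform with kernel $e^{-ix\cdot\xi}$; in $\mathcal{R}^{-1}g=\frac12(2\pi)^{1-d}I^{-\alpha}\mathcal{R}^{\#}I^{\alpha-d+1}g$ the inner $I^{\alpha-d+1}$ acts on the one-dimensional variable $p$ of $g(\omega,p)$ and the outer $I^{-\alpha}$ acts on functions on $\mathbb{R}^d$. It is a classical fact that $\mathcal{R}^{-1}\mathcal{R}f=f$ for $f\in\mathcal{S}(\mathbb{R}^d)$. *)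

theory Defs
  imports "HOL-Analysis.Analysis"
begin

section \<open>Partial derivatives, smoothness and the Schwartz class\<close>

definition partial_deriv :: "'a::real_vector \<Rightarrow> ('a \<Rightarrow> 'b::real_normed_vector) \<Rightarrow> 'a \<Rightarrow> 'b" where
  "partial_deriv v f x = vector_derivative (\<lambda>t. f (x + t *\<^sub>R v)) (at 0)"

text \<open>A multi-index is given as a list of basis vectors, so that
  \<^term>\<open>foldr partial_deriv vs f\<close> is an iterated partial derivative of \<^term>\<open>f\<close>.\<close>

definition smooth :: "('a::euclidean_space \<Rightarrow> 'b::real_normed_vector) \<Rightarrow> bool" where
  "smooth f \<longleftrightarrow> (\<forall>vs \<in> lists Basis. foldr partial_deriv vs f differentiable_on UNIV)"

definition schwartz :: "('a::euclidean_space \<Rightarrow> 'b::real_normed_vector) \<Rightarrow> bool" where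
  "schwartz f \<longleftrightarrow> smooth f \<and>
     (\<forall>vs \<in> lists Basis. \<forall>k::nat. bounded (range (\<lambda>x. norm x ^ k *\<^sub>R foldr partial_deriv vs f x)))"

definition gradient :: "(real ^ 'n \<Rightarrow> real) \<Rightarrow> real ^ 'n \<Rightarrow> real ^ 'n" where
  "gradient f x = (\<chi> j. partial_deriv (axis j 1) f x)"

definition divergence :: "(real ^ 'n \<Rightarrow> real ^ 'n) \<Rightarrow> real ^ 'n \<Rightarrow> real" where
  "divergence F x = (\<Sum>j\<in>UNIV. partial_deriv (axis j 1) (\<lambda>y. F y $ j) x)"

definition laplacian :: "(real ^ 'n \<Rightarrow> real) \<Rightarrow> real ^ 'n \<Rightarrow> real" where
  "laplacian f x = (\<Sum>j\<in>UNIV. partial_deriv (axis j 1) (partial_deriv (axis j 1) f) x)"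

definition vector_laplacian :: "(real ^ 'n \<Rightarrow> real ^ 'n) \<Rightarrow> real ^ 'n \<Rightarrow> real ^ 'n" where
  "vector_laplacian F x = (\<chi> j. laplacian (\<lambda>y. F y $ j) x)"

definition twice_differentiable :: "(real \<Rightarrow> 'b::real_normed_vector) \<Rightarrow> bool" where
  "twice_differentiable f \<longleftrightarrow> (\<forall>p. f differentiable (at p)) \<and>
     (\<forall>p. (\<lambda>q. vector_derivative f (at q)) differentiable (at p))"

definition second_deriv :: "(real \<Rightarrow> 'b::real_normed_vector) \<Rightarrow> real \<Rightarrow> 'b" where
  "second_deriv f p = vector_derivative (\<lambda>q. vector_derivative f (at q)) (at p)"


section \<open>Fundamental solution and Helmholtz decomposition\<close>

definition fundamental_solution :: "real ^ 'n \<Rightarrow> real" where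
  "fundamental_solution x =
     (if CARD('n) = 2 then ln (norm x) / (2 * pi)
      else - (Gamma (real CARD('n) / 2 - 1) / (4 * pi powr (real CARD('n) / 2)))
             * norm x powr (2 - real CARD('n)))"

definition convolve :: "(real ^ 'n \<Rightarrow> real) \<Rightarrow> (real ^ 'n \<Rightarrow> 'b::{banach, second_countable_topology}) \<Rightarrow> real ^ 'n \<Rightarrow> 'b" where
  "convolve f g x = (\<integral>y. f y *\<^sub>R g (x - y) \<partial>lborel)"

definition potential_part :: "(real ^ 'n \<Rightarrow> real ^ 'n) \<Rightarrow> real ^ 'n \<Rightarrow> real ^ 'n" where
  "potential_part F = gradient (convolve (divergence F) fundamental_solution)"

definition solenoidal_part :: "(real ^ 'n \<Rightarrow> real ^ 'n) \<Rightarrow> real ^ 'n \<Rightarrow> real ^ 'n" where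
  "solenoidal_part F x = F x - potential_part F x"


section \<open>Radon transforms\<close>

definition orthonormal_basis_extending :: "real ^ 'n \<Rightarrow> (nat \<Rightarrow> real ^ 'n) \<Rightarrow> bool" where
  "orthonormal_basis_extending \<omega> u \<longleftrightarrow> u 0 = \<omega> \<and>
     (\<forall>i<CARD('n). \<forall>j<CARD('n). u i \<bullet> u j = (if i = j then 1 else 0)) \<and>
     span (u ` {..<CARD('n)}) = UNIV"

definition hyperplane :: "real ^ 'n \<Rightarrow> real \<Rightarrow> (real ^ 'n) set" where
  "hyperplane \<omega> p = {x. \<omega> \<bullet> x = p}"

text \<open>The area element of a hyperplane (for unit vectors \<^term>\<open>\<omega>\<close>) is the image of the
  \<open>(d - 1)\<close>-dimensional Lebesgue measure under Cartesian coordinates on the hyperplane; by rotation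
  invariance of Lebesgue measure it does not depend on the orthonormal basis that is chosen.\<close>

definition hyperplane_measure :: "real ^ 'n \<Rightarrow> real \<Rightarrow> (real ^ 'n) measure" where
  "hyperplane_measure \<omega> p =
     (let u = (SOME u. orthonormal_basis_extending \<omega> u) in
      distr (\<Pi>\<^sub>M k\<in>{1..CARD('n) - 1}. lborel) (restrict_space borel (hyperplane \<omega> p))
        (\<lambda>t. p *\<^sub>R \<omega> + (\<Sum>k=1..CARD('n) - 1. t k *\<^sub>R u k)))"

definition radon :: "(real ^ 'n \<Rightarrow> real) \<Rightarrow> real ^ 'n \<Rightarrow> real \<Rightarrow> real" where
  "radon f \<omega> p = (\<integral>x. f x \<partial>hyperplane_measure \<omega> p)"

definition componentwise_radon :: "(real ^ 'n \<Rightarrow> real ^ 'n) \<Rightarrow> real ^ 'n \<Rightarrow> real \<Rightarrow> real ^ 'n" where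
  "componentwise_radon F \<omega> p = (\<chi> j. radon (\<lambda>x. F x $ j) \<omega> p)"

text \<open>In the next two definitions \<^term>\<open>b \<omega> k\<close> is the \<open>k\<close>-th vector of the basis chosen for \<^term>\<open>\<omega>\<close>.\<close>

definition longitudinal_radon ::
  "(real ^ 'n \<Rightarrow> nat \<Rightarrow> real ^ 'n) \<Rightarrow> nat \<Rightarrow> (real ^ 'n \<Rightarrow> real ^ 'n) \<Rightarrow> real ^ 'n \<Rightarrow> real \<Rightarrow> real" where
  "longitudinal_radon b k F \<omega> p = radon (\<lambda>x. b \<omega> k \<bullet> F x) \<omega> p"

definition weighted_longitudinal_radon ::
  "(real ^ 'n \<Rightarrow> nat \<Rightarrow> real ^ 'n) \<Rightarrow> nat \<Rightarrow> (real ^ 'n \<Rightarrow> real ^ 'n) \<Rightarrow> real ^ 'n \<Rightarrow> real \<Rightarrow> real" where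
  "weighted_longitudinal_radon b k F \<omega> p = radon (\<lambda>x. (b \<omega> k \<bullet> x) * (F x \<bullet> b \<omega> k)) \<omega> p"


section \<open>Filtration/backprojection\<close>

text \<open>Surface measure of the unit sphere, as the cone measure: the area of a subset \<open>A\<close> of the sphere
  is \<open>d\<close> times the volume of the cone \<open>{r x | 0 < r \<le> 1, x \<in> A}\<close>.\<close>

definition sphere_measure :: "(real ^ 'n) measure" where
  "sphere_measure = scale_measure (of_nat CARD('n))
     (distr (restrict_space lborel (cball 0 1 - {0})) (restrict_space borel (sphere 0 1))
        (\<lambda>x. x /\<^sub>R norm x))"

definition dual_radon :: "(real ^ 'n \<Rightarrow> real \<Rightarrow> complex) \<Rightarrow> real ^ 'n \<Rightarrow> complex" where
  "dual_radon g x = (\<integral>\<omega>. g \<omega> (\<omega> \<bullet> x) \<partial>sphere_measure)"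

definition fourier_integral :: "('a::euclidean_space \<Rightarrow> complex) \<Rightarrow> 'a \<Rightarrow> complex" where
  "fourier_integral f \<xi> = (\<integral>x. exp (- \<i> * complex_of_real (x \<bullet> \<xi>)) * f x \<partial>lborel)"

text \<open>The functions that a Riesz potential is applied to need not be integrable (they may decay as
  slowly as a negative power of the norm), so the Fourier transform is taken in the sense of tempered
  distributions, by duality with Schwartz test functions. The transforms needed are functions, and a
  function is determined almost everywhere by the duality; for integrable functions it agrees almost
  everywhere with \<^const>\<open>fourier_integral\<close>. The choice of representative does not affect
  the inverse Fourier integral below.\<close>

definition is_fourier_transform ::
  "('a::euclidean_space \<Rightarrow> complex) \<Rightarrow> ('a \<Rightarrow> complex) \<Rightarrow> bool" where
  "is_fourier_transform f h \<longleftrightarrow> (\<forall>\<phi>. schwartz \<phi> \<longrightarrow>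
     integrable lborel (\<lambda>x. f x * fourier_integral \<phi> x) \<and>
     integrable lborel (\<lambda>\<xi>. h \<xi> * \<phi> \<xi>) \<and>
     (\<integral>x. f x * fourier_integral \<phi> x \<partial>lborel) = (\<integral>\<xi>. h \<xi> * \<phi> \<xi> \<partial>lborel))"

definition fourier_transform :: "('a::euclidean_space \<Rightarrow> complex) \<Rightarrow> 'a \<Rightarrow> complex" where
  "fourier_transform f = (SOME h. is_fourier_transform f h)"

definition inverse_fourier :: "('a::euclidean_space \<Rightarrow> complex) \<Rightarrow> 'a \<Rightarrow> complex" where
  "inverse_fourier h x = complex_of_real ((2 * pi) powr (- real DIM('a))) *
     (\<integral>\<xi>. exp (\<i> * complex_of_real (x \<bullet> \<xi>)) * h \<xi> \<partial>lborel)"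

definition riesz_potential :: "real \<Rightarrow> ('a::euclidean_space \<Rightarrow> complex) \<Rightarrow> 'a \<Rightarrow> complex" where
  "riesz_potential \<beta> f =
     inverse_fourier (\<lambda>\<xi>. complex_of_real (norm \<xi> powr (- \<beta>)) * fourier_transform f \<xi>)"

definition radon_inverse :: "real \<Rightarrow> (real ^ 'n \<Rightarrow> real \<Rightarrow> real) \<Rightarrow> real ^ 'n \<Rightarrow> complex" where
  "radon_inverse \<alpha> g x = complex_of_real (1 / 2 * (2 * pi) powr (1 - real CARD('n))) *
     riesz_potential (- \<alpha>)
       (dual_radon (\<lambda>\<omega>. riesz_potential (\<alpha> - real CARD('n) + 1) (\<lambda>p. complex_of_real (g \<omega> p)))) x"

end

theory Submission
  imports Defs "HOL-Probability.Characteristic_Functions" "HOL-Probability.Sinc_Integral"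
    "HOL-Real_Asymp.Real_Asymp"
begin

text \<open>The Newtonian kernel \<open>G\<close> satisfies \<open>(\<Delta>f) * G = f\<close> for Schwartz functions \<open>f\<close>. Hence the
  potential part of \<open>F\<close> is \<open>\<nabla>(\<Phi> * G)\<close> with Laplacian \<open>\<nabla>\<Phi>\<close>, so that \<open>\<Psi>\<^sub>j = \<Delta>F\<^sub>j - \<partial>\<^sub>j\<Phi>\<close> is again a Schwartz function;
  convolving with \<open>G\<close> gives (3). The Radon transform turns a derivative \<open>\<partial>\<^sub>v\<close> into \<open>(\<omega> \<bullet> v) \<partial>\<^sub>p\<close>.
  Therefore \<open>R\<Psi> = \<partial>\<^sub>p\<^sup>2 (RF - \<omega> (\<omega> \<bullet> RF))\<close>, which is (1), and
  \<open>\<Delta>((x \<bullet> \<omega>\<^sub>1) h) = (x \<bullet> \<omega>\<^sub>1) \<Delta>h + 2 \<partial>\<^sub>w h\<close> with \<open>w = \<omega>\<^sub>1\<close> and \<open>h = \<omega>\<^sub>1 \<bullet> F\<close> shows that the argument of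
  \<open>R\<^sup>-\<^sup>1\<close> in (2) is \<open>R\<Phi>\<close>. Finally \<open>R\<^sup>-\<^sup>1 R f = f\<close> follows from the Fourier slice theorem, polar coordinates and
  Fourier inversion, once distributional Fourier transforms are known to be unique almost everywhere.\<close>

section \<open>Partial derivatives and Schwartz functions\<close>

text \<open>Two functions in the argument are not Schwartz in general. The potential
  \<open>convolve (divergence F) fundamental_solution\<close> need not decay rapidly, so its
  derivatives are always moved onto the Schwartz factor. The backprojected function need not be
  integrable, so its Fourier transform exists only by duality; it is accessible because
  backprojection yields the Fourier integral of an integrable function, the transform of
  \<open>f\<close> times \<open>norm \<xi> powr (- \<alpha>)\<close>, and this is where \<alpha> < d
  enters. The area element of a hyperplane is built from a basis chosen by \<open>SOME\<close>,
  unrelated to \<open>b \<omega>\<close>. The two bases are never compared: linearity, the behaviour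
  under translations and Fubini over parallel hyperplanes are statements about \<omega> alone. One
  device replaces integration by parts for the Fourier transform, the Radon transform and
  convolutions alike: an integral is rewritten by translation invariance, and the translation
  parameter is differentiated at 0 in both forms.\<close>

lemma partial_deriv_eq:
  assumes "(f has_derivative D) (at x)"
  shows "partial_deriv v f x = D v"
proof -
  have "((\<lambda>t. f (x + t *\<^sub>R v)) has_derivative (\<lambda>t. D (t *\<^sub>R v))) (at 0)"
    by (rule has_derivative_compose[where g=f and g'=D, of "\<lambda>t. x + t *\<^sub>R v" "\<lambda>t. t *\<^sub>R v"])
       (use assms in \<open>auto intro!: derivative_eq_intros\<close>)
  moreover have "D (t *\<^sub>R v) = t *\<^sub>R D v" for t
    using assms by (simp add: has_derivative_def bounded_linear.linear linear_cmul)
  ultimately show ?thesis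
    unfolding partial_deriv_def by (intro vector_derivative_at) (simp add: has_vector_derivative_def)
qed

lemma partial_derivI:
  "((\<lambda>t. f (x + t *\<^sub>R v)) has_vector_derivative d) (at 0) \<Longrightarrow> partial_deriv v f x = d"
  unfolding partial_deriv_def by (rule vector_derivative_at)

lemma has_vector_derivative_along:
  assumes "f differentiable_on UNIV"
  shows "((\<lambda>s. f (x + s *\<^sub>R v)) has_vector_derivative partial_deriv v f (x + t *\<^sub>R v)) (at t)"
proof -
  obtain D where D: "(f has_derivative D) (at (x + t *\<^sub>R v))"
    using assms by (auto simp: differentiable_on_def differentiable_def)
  have "((\<lambda>s. f (x + s *\<^sub>R v)) has_derivative (\<lambda>s. D (s *\<^sub>R v))) (at t)"
    by (rule has_derivative_compose[where g=f and g'=D, of "\<lambda>t. x + t *\<^sub>R v" "\<lambda>t. t *\<^sub>R v"])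
       (use D in \<open>auto intro!: derivative_eq_intros\<close>)
  moreover have "D (s *\<^sub>R v) = s *\<^sub>R D v" for s
    using D by (simp add: has_derivative_def bounded_linear.linear linear_cmul)
  ultimately show ?thesis
    by (simp add: has_vector_derivative_def partial_deriv_eq[OF D])
qed

lemma differentiable_onD:
  assumes "f differentiable_on UNIV"
  obtains D where "(f has_derivative D) (at x)"
  using assms by (auto simp: differentiable_on_def differentiable_def)

lemma partial_deriv_add:
  assumes "f differentiable_on UNIV" "g differentiable_on UNIV"
  shows "partial_deriv v (\<lambda>x. f x + g x) = (\<lambda>x. partial_deriv v f x + partial_deriv v g x)"
proof
  fix x
  obtain D E where "(f has_derivative D) (at x)" "(g has_derivative E) (at x)"
    using assms differentiable_onD by metis
  then show "partial_deriv v (\<lambda>x. f x + g x) x = partial_deriv v f x + partial_deriv v g x"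
    by (simp add: partial_deriv_eq partial_deriv_eq[OF has_derivative_add])
qed

lemma partial_deriv_linear:
  assumes "bounded_linear L" "f differentiable_on UNIV"
  shows "partial_deriv v (\<lambda>x. L (f x)) = (\<lambda>x. L (partial_deriv v f x))"
proof
  fix x
  obtain D where D: "(f has_derivative D) (at x)"
    using assms differentiable_onD by metis
  show "partial_deriv v (\<lambda>x. L (f x)) x = L (partial_deriv v f x)"
    by (simp add: partial_deriv_eq[OF D]
        partial_deriv_eq[OF bounded_linear.has_derivative[OF assms(1) D]])
qed

lemma partial_deriv_sum:
  assumes "finite I" "\<And>i. i \<in> I \<Longrightarrow> f i differentiable_on UNIV"
  shows "partial_deriv v (\<lambda>x. \<Sum>i\<in>I. f i x) = (\<lambda>x. \<Sum>i\<in>I. partial_deriv v (f i) x)"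
proof
  fix x
  have "\<exists>D. (f i has_derivative D) (at x)" if "i \<in> I" for i
    using assms(2)[OF that] differentiable_onD by metis
  then obtain D where D: "\<And>i. i \<in> I \<Longrightarrow> (f i has_derivative D i) (at x)"
    by metis
  show "partial_deriv v (\<lambda>x. \<Sum>i\<in>I. f i x) x = (\<Sum>i\<in>I. partial_deriv v (f i) x)"
    using partial_deriv_eq[OF has_derivative_sum[OF D]] partial_deriv_eq[OF D] by simp
qed

lemma partial_deriv_coord_mult:
  assumes "f differentiable_on UNIV"
  shows "partial_deriv v (\<lambda>x. (x \<bullet> w) *\<^sub>R f x)
    = (\<lambda>x. (x \<bullet> w) *\<^sub>R partial_deriv v f x + (v \<bullet> w) *\<^sub>R f x)"
proof
  fix x
  obtain D where D: "(f has_derivative D) (at x)"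
    using assms differentiable_onD by metis
  have "((\<lambda>x. (x \<bullet> w) *\<^sub>R f x) has_derivative (\<lambda>h. (x \<bullet> w) *\<^sub>R D h + (h \<bullet> w) *\<^sub>R f x)) (at x)"
    using D by (auto intro!: derivative_eq_intros)
  then show "partial_deriv v (\<lambda>x. (x \<bullet> w) *\<^sub>R f x) x
      = (x \<bullet> w) *\<^sub>R partial_deriv v f x + (v \<bullet> w) *\<^sub>R f x"
    by (simp add: partial_deriv_eq[OF D] partial_deriv_eq)
qed

lemma partial_deriv_euclidean:
  fixes f :: "'a::euclidean_space \<Rightarrow> 'b::real_normed_vector"
  assumes "f differentiable_on UNIV"
  shows "partial_deriv v f = (\<lambda>x. \<Sum>b\<in>Basis. (v \<bullet> b) *\<^sub>R partial_deriv b f x)"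
proof
  fix x
  obtain D where D: "(f has_derivative D) (at x)"
    using assms differentiable_onD by metis
  interpret bounded_linear D using D by (rule has_derivative_bounded_linear)
  have "D v = D (\<Sum>b\<in>Basis. (v \<bullet> b) *\<^sub>R b)" by (simp add: euclidean_representation)
  also have "\<dots> = (\<Sum>b\<in>Basis. (v \<bullet> b) *\<^sub>R D b)" by (simp add: sum scaleR)
  finally show "partial_deriv v f x = (\<Sum>b\<in>Basis. (v \<bullet> b) *\<^sub>R partial_deriv b f x)"
    by (simp add: partial_deriv_eq[OF D])
qed

text \<open>A multi-index applies its head last, so it suffices that some class \<open>P\<close>
  containing \<open>f\<close> is stable under a single basis derivative and consists of
  differentiable, rapidly decreasing functions. Closure properties then need no formula for iterated
  derivatives, only a well chosen \<open>P\<close>.\<close>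

lemma schwartz_coinduct:
  fixes f :: "'a::euclidean_space \<Rightarrow> 'b::real_normed_vector"
  assumes "P f"
    and diff: "\<And>f. P f \<Longrightarrow> f differentiable_on UNIV"
    and closed: "\<And>f b. P f \<Longrightarrow> b \<in> Basis \<Longrightarrow> P (partial_deriv b f)"
    and decay: "\<And>f k. P f \<Longrightarrow> \<exists>C. \<forall>x. norm x ^ k * norm (f x) \<le> C"
  shows "schwartz f"
proof -
  have "P (foldr partial_deriv vs f)" if "vs \<in> lists Basis" for vs
    using that
  proof (induction vs)
    case Nil then show ?case using assms(1) by simp
  next
    case (Cons v vs)
    then show ?case using closed by (auto simp: lists_def)
  qed
  then show ?thesis
    unfolding schwartz_def smooth_def bounded_iff using diff decay by fastforce
qed

lemma schwartz_differentiable: "schwartz f \<Longrightarrow> f differentiable_on UNIV"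
  unfolding schwartz_def smooth_def by (elim conjE) (drule bspec[where x="[]"], simp_all)

lemma schwartz_partial_deriv_Basis:
  assumes "schwartz f" "b \<in> Basis"
  shows "schwartz (partial_deriv b f)"
proof -
  have *: "foldr partial_deriv vs (partial_deriv b f) = foldr partial_deriv (vs @ [b]) f" for vs
    by simp
  have "vs @ [b] \<in> lists Basis" if "vs \<in> lists Basis" for vs
    using that assms(2) by (auto simp: lists_def)
  then show ?thesis
    using assms(1) unfolding schwartz_def smooth_def * by blast
qed

lemma schwartz_decay:
  assumes "schwartz f"
  shows "\<exists>C. \<forall>x. norm x ^ k * norm (f x) \<le> C"
proof -
  have "bounded (range (\<lambda>x. norm x ^ k *\<^sub>R foldr partial_deriv [] f x))"
    using assms unfolding schwartz_def by blast
  then show ?thesis by (auto simp: bounded_iff)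
qed

lemma schwartz_bound:
  assumes "schwartz f"
  obtains C where "C > 0" "\<And>x. norm (f x) * (1 + (norm x)\<^sup>2) ^ N \<le> C"
proof -
  obtain A B where A: "\<And>x. norm x ^ 0 * norm (f x) \<le> A" and B: "\<And>x. norm x ^ (2*N) * norm (f x) \<le> B"
    using schwartz_decay[OF assms] by metis
  \<comment> \<open>The factor \<open>2 ^ N\<close> comes from
    \<open>1 + r \<le> 2 * max 1 r\<close>; the final 1 keeps the constant strictly positive even
    for \<open>f = 0\<close>.\<close>
  have "norm (f x) * (1 + (norm x)\<^sup>2) ^ N \<le> 2 ^ N * (A + B) + 1" for x
  proof -
    define r where "r = (norm x)\<^sup>2"
    have r: "r \<ge> 0" by (simp add: r_def)
    have "(1 + r) ^ N \<le> (2 * max 1 r) ^ N"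
      using r by (intro power_mono) auto
    also have "\<dots> \<le> 2 ^ N * (1 + r ^ N)"
      using r by (auto simp: power_mult_distrib max_def)
    finally have "norm (f x) * (1 + r) ^ N \<le> norm (f x) * (2 ^ N * (1 + r ^ N))"
      by (intro mult_left_mono) auto
    also have "\<dots> = 2 ^ N * (norm (f x) + norm x ^ (2*N) * norm (f x))"
      by (simp add: r_def power_mult power2_eq_square power_mult_distrib algebra_simps)
    also have "\<dots> \<le> 2 ^ N * (A + B)"
      using A[of x] B[of x] by (intro mult_left_mono add_mono) auto
    finally show ?thesis by (simp add: r_def)
  qed
  moreover have "2 ^ N * (A + B) + 1 > 0"
  proof -
    have "0 \<le> norm (0::'a) ^ (2*N) * norm (f 0)" by simp
    also have "\<dots> \<le> B" by (rule B)
    finally have "B \<ge> 0" .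
    moreover have "A \<ge> 0" using order_trans[OF norm_ge_zero, of "f 0" A] A[of 0] by simp
    ultimately show ?thesis by (intro add_nonneg_pos mult_nonneg_nonneg) auto
  qed
  ultimately show ?thesis using that by blast
qed

lemma schwartz_bounded_linear:
  assumes L: "bounded_linear L" and f: "schwartz f"
  shows "schwartz (\<lambda>x. L (f x))"
proof (rule schwartz_coinduct[where P="\<lambda>h. \<exists>f. schwartz f \<and> h = (\<lambda>x. L (f x))"])
  fix h b k assume "\<exists>f. schwartz f \<and> h = (\<lambda>x. L (f x))"
  then obtain f where f: "schwartz f" and h: "h = (\<lambda>x. L (f x))" by auto
  note d = schwartz_differentiable[OF f]
  show "h differentiable_on UNIV"
    using d bounded_linear.has_derivative[OF L] unfolding h differentiable_on_def differentiable_def by blast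
  show "\<exists>f. schwartz f \<and> partial_deriv b h = (\<lambda>x. L (f x))" if "b \<in> Basis"
    using schwartz_partial_deriv_Basis[OF f that] partial_deriv_linear[OF L d] h by auto
  obtain C where C: "\<And>x. norm x ^ k * norm (f x) \<le> C" using schwartz_decay[OF f] by metis
  obtain K where K: "\<And>x. norm (L x) \<le> norm x * K" "K > 0" using bounded_linear.pos_bounded[OF L] by auto
  have "norm x ^ k * norm (L (f x)) \<le> C * K" for x
  proof -
    have "norm x ^ k * norm (L (f x)) \<le> norm x ^ k * (norm (f x) * K)"
      by (intro mult_left_mono K) auto
    also have "\<dots> \<le> C * K" using C[of x] K(2) by (simp add: mult.assoc[symmetric])
    finally show ?thesis .
  qed
  then show "\<exists>C. \<forall>x. norm x ^ k * norm (h x) \<le> C" unfolding h by blast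
qed (use f in blast)

lemma schwartz_add:
  assumes "schwartz f" "schwartz g"
  shows "schwartz (\<lambda>x. f x + g x)"
proof (rule schwartz_coinduct[where P="\<lambda>h. \<exists>f g. schwartz f \<and> schwartz g \<and> h = (\<lambda>x. f x + g x)"])
  fix h b k assume "\<exists>f g. schwartz f \<and> schwartz g \<and> h = (\<lambda>x. f x + g x)"
  then obtain f g where f: "schwartz f" and g: "schwartz g" and h: "h = (\<lambda>x. f x + g x)" by auto
  note d = schwartz_differentiable[OF f] schwartz_differentiable[OF g]
  show "h differentiable_on UNIV" unfolding h by (intro derivative_intros d)
  show "\<exists>f g. schwartz f \<and> schwartz g \<and> partial_deriv b h = (\<lambda>x. f x + g x)" if "b \<in> Basis"
    using schwartz_partial_deriv_Basis[OF f that] schwartz_partial_deriv_Basis[OF g that]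
      partial_deriv_add[OF d] h by blast
  obtain C D where C: "\<And>x. norm x ^ k * norm (f x) \<le> C" "\<And>x. norm x ^ k * norm (g x) \<le> D"
    using schwartz_decay[OF f] schwartz_decay[OF g] by metis
  have "norm x ^ k * norm (f x + g x) \<le> C + D" for x
    using mult_left_mono[OF norm_triangle_ineq[of "f x" "g x"], of "norm x ^ k"] C[of x]
    by (simp add: algebra_simps)
  then show "\<exists>C. \<forall>x. norm x ^ k * norm (h x) \<le> C" unfolding h by blast
qed (use assms in blast)

lemma schwartz_scaleR: "schwartz f \<Longrightarrow> schwartz (\<lambda>x. c *\<^sub>R f x)"
  by (rule schwartz_bounded_linear[OF bounded_linear_scaleR_right])

lemma schwartz_diff: "schwartz f \<Longrightarrow> schwartz g \<Longrightarrow> schwartz (\<lambda>x. f x - g x)"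
  using schwartz_add[of f "\<lambda>x. (-1) *\<^sub>R g x"] schwartz_scaleR[of g "-1"] by simp

lemma schwartz_sum:
  fixes f :: "'i \<Rightarrow> 'a::euclidean_space \<Rightarrow> 'b::real_normed_vector"
  shows "finite I \<Longrightarrow> (\<And>i. i \<in> I \<Longrightarrow> schwartz (f i)) \<Longrightarrow> schwartz (\<lambda>x. \<Sum>i\<in>I. f i x)"
proof (induction I rule: finite_induct)
  case empty
  have [simp]: "partial_deriv b (\<lambda>x::'a. 0::'b) = (\<lambda>x. 0)" for b
    unfolding partial_deriv_def by simp
  show ?case
    by (rule schwartz_coinduct[where P="\<lambda>h. h = (\<lambda>x. 0)"]) (auto intro: exI[of _ 0])
next
  case (insert i I)
  then show ?case using schwartz_add[of "f i" "\<lambda>x. \<Sum>i\<in>I. f i x"] by simp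
qed

lemma schwartz_partial_deriv:
  fixes f :: "'a::euclidean_space \<Rightarrow> 'b::real_normed_vector"
  assumes "schwartz f"
  shows "schwartz (partial_deriv v f)"
  by (subst partial_deriv_euclidean[OF schwartz_differentiable[OF assms]])
     (intro schwartz_sum schwartz_scaleR schwartz_partial_deriv_Basis assms finite_Basis)

lemma schwartz_coord_mult:
  fixes f :: "'a::euclidean_space \<Rightarrow> 'b::real_normed_vector"
  assumes "schwartz f"
  shows "schwartz (\<lambda>x. (x \<bullet> w) *\<^sub>R f x)"
\<comment> \<open>The products \<open>(x \<bullet> w) *\<^sub>R f x\<close> alone are not stable
  under derivatives: the product rule leaves a multiple of \<open>f\<close>, which the summand
  \<open>g\<close> absorbs.\<close>
proof (rule schwartz_coinduct[where P="\<lambda>h. \<exists>f g. schwartz f \<and> schwartz g \<and> h = (\<lambda>x. (x \<bullet> w) *\<^sub>R f x + g x)"])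
  show "\<exists>f' g. schwartz f' \<and> schwartz g \<and> (\<lambda>x. (x \<bullet> w) *\<^sub>R f x) = (\<lambda>x. (x \<bullet> w) *\<^sub>R f' x + g x)"
    using assms schwartz_scaleR[OF assms, of 0] by (intro exI[of _ f] exI[of _ "\<lambda>x. 0"]) auto
  fix h b k assume "\<exists>f g. schwartz f \<and> schwartz g \<and> h = (\<lambda>x. (x \<bullet> w) *\<^sub>R f x + g x)"
  then obtain f g where f: "schwartz f" and g: "schwartz g" and h: "h = (\<lambda>x. (x \<bullet> w) *\<^sub>R f x + g x)" by auto
  note d = schwartz_differentiable[OF f] schwartz_differentiable[OF g]
  have "(\<lambda>x. x \<bullet> w) differentiable_on UNIV"
    by (simp add: bounded_linear_imp_differentiable_on bounded_linear_inner_left)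
  then have d': "(\<lambda>x. (x \<bullet> w) *\<^sub>R f x) differentiable_on UNIV"
    using d(1) unfolding differentiable_on_def by (auto intro: differentiable_scaleR)
  show "h differentiable_on UNIV" unfolding h by (intro derivative_intros d d')
  show "\<exists>f g. schwartz f \<and> schwartz g \<and> partial_deriv b h = (\<lambda>x. (x \<bullet> w) *\<^sub>R f x + g x)"
    unfolding h partial_deriv_add[OF d' d(2)] partial_deriv_coord_mult[OF d(1)] add.assoc
    using schwartz_partial_deriv[OF f, of b]
      schwartz_add[OF schwartz_scaleR[OF f, of "b \<bullet> w"] schwartz_partial_deriv[OF g, of b]] by blast
  obtain C D where C: "\<And>x. norm x ^ Suc k * norm (f x) \<le> C" "\<And>x. norm x ^ k * norm (g x) \<le> D"
    using schwartz_decay[OF f] schwartz_decay[OF g] by metis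
  have "norm x ^ k * norm ((x \<bullet> w) *\<^sub>R f x + g x) \<le> norm w * C + D" for x
  proof -
    have "norm x ^ k * norm ((x \<bullet> w) *\<^sub>R f x + g x) \<le> norm x ^ k * (norm x * norm w * norm (f x) + norm (g x))"
      by (intro mult_left_mono order_trans[OF norm_triangle_ineq] add_mono)
         (auto intro!: mult_right_mono Cauchy_Schwarz_ineq2)
    also have "\<dots> = norm w * (norm x ^ Suc k * norm (f x)) + norm x ^ k * norm (g x)"
      by (simp add: algebra_simps)
    also have "\<dots> \<le> norm w * C + D"
      by (intro add_mono mult_left_mono C) auto
    finally show ?thesis .
  qed
  then show "\<exists>C. \<forall>x. norm x ^ k * norm (h x) \<le> C" unfolding h by blast
qed

lemma schwartz_continuous_on: "schwartz f \<Longrightarrow> continuous_on S f"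
  using differentiable_imp_continuous_on[OF schwartz_differentiable] continuous_on_subset by blast

lemma schwartz_measurable: "schwartz f \<Longrightarrow> f \<in> borel_measurable borel"
  by (intro borel_measurable_continuous_onI schwartz_continuous_on)

section \<open>Differentiation under the integral sign\<close>

lemma has_vector_derivative_at_0_iff:
  "(f has_vector_derivative d) (at 0) \<longleftrightarrow> ((\<lambda>t. (1 / t) *\<^sub>R (f t - f 0)) \<longlongrightarrow> d) (at 0)"
proof -
  have "norm ((f t - f 0 - t *\<^sub>R d) /\<^sub>R \<bar>t\<bar>) = norm ((1 / t) *\<^sub>R (f t - f 0) - d)" if "t \<noteq> 0" for t
  proof -
    have "(1 / t) *\<^sub>R (f t - f 0) - d = (1 / t) *\<^sub>R (f t - f 0 - t *\<^sub>R d)"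
      using that by (simp add: scaleR_diff_right)
    then show ?thesis by (simp add: divide_inverse)
  qed
  then have "((\<lambda>t. norm ((f t - f 0 - t *\<^sub>R d) /\<^sub>R \<bar>t\<bar>)) \<longlongrightarrow> 0) (at 0)
      \<longleftrightarrow> ((\<lambda>t. norm ((1 / t) *\<^sub>R (f t - f 0) - d)) \<longlongrightarrow> 0) (at 0)"
    by (intro filterlim_cong refl) (auto simp: eventually_at_filter)
  then show ?thesis
    by (simp only: tendsto_norm_zero_iff Lim_null[symmetric])
       (simp add: has_vector_derivative_def has_derivative_within bounded_linear_scaleR_left
          tendsto_norm_zero_iff divide_inverse diff_diff_eq)
qed

text \<open>The mean value inequality bounds the difference quotients by \<open>K\<close>, so
  dominated convergence applies along every sequence tending to 0. Differentiating at 0 only is no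
  loss, as the base point can be put into \<open>h\<close>.\<close>

lemma has_vector_derivative_integral:
  fixes h h' :: "real \<Rightarrow> 'a \<Rightarrow> 'b::{banach, second_countable_topology}"
  assumes int: "\<And>t. integrable M (h t)"
    and deriv: "\<And>t y. \<bar>t\<bar> \<le> 1 \<Longrightarrow> ((\<lambda>t. h t y) has_vector_derivative h' t y) (at t)"
    and bound: "\<And>t y. \<bar>t\<bar> \<le> 1 \<Longrightarrow> norm (h' t y) \<le> K y"
    and K: "integrable M K"
    and meas: "h' 0 \<in> borel_measurable M"
  shows "((\<lambda>t. \<integral>y. h t y \<partial>M) has_vector_derivative (\<integral>y. h' 0 y \<partial>M)) (at 0)"
    and "integrable M (h' 0)"
proof -
  show "integrable M (h' 0)"
    using bound[of 0] meas by (intro Bochner_Integration.integrable_bound[OF K]) (auto intro: order_trans[OF _ abs_ge_self])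
  have lip: "norm (h t y - h 0 y) \<le> K y * \<bar>t\<bar>" if "\<bar>t\<bar> \<le> 1" for t y
  proof -
    have "norm (h t y - h 0 y) \<le> K y * norm (t - 0)"
    proof (rule differentiable_bound[where S="{-1..1}" and f'="\<lambda>t s. s *\<^sub>R h' t y"])
      fix s :: real assume s: "s \<in> {-1..1}"
      then show "((\<lambda>t. h t y) has_derivative (\<lambda>r. r *\<^sub>R h' s y)) (at s within {-1..1})"
        using deriv[of s y] by (auto simp: has_vector_derivative_def intro: has_derivative_at_withinI)
      show "onorm (\<lambda>r. r *\<^sub>R h' s y) \<le> K y"
        using bound[of s y] s by (intro onorm_le) (auto simp: mult.commute intro: mult_left_mono)
    qed (use that in auto)
    then show ?thesis by simp
  qed
  have "((\<lambda>t. (1 / t) *\<^sub>R ((\<integral>y. h t y \<partial>M) - (\<integral>y. h 0 y \<partial>M))) \<longlongrightarrow> (\<integral>y. h' 0 y \<partial>M)) (at 0)"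
    unfolding tendsto_at_iff_sequentially comp_def
  proof (intro allI impI)
    fix X :: "nat \<Rightarrow> real" assume X: "\<forall>i. X i \<in> UNIV - {0}" "X \<longlonglongrightarrow> 0"
    \<comment> \<open>The bounds on \<open>h'\<close> hold for |t| \<le> 1; shifting the sequence by
      \<open>N\<close> brings all its terms into that range.\<close>
    then obtain N where N: "\<And>n. n \<ge> N \<Longrightarrow> \<bar>X n\<bar> \<le> 1"
      by (metis LIMSEQ_iff abs_minus_commute diff_0_right less_eq_real_def real_norm_def zero_less_one)
    have "(\<lambda>n. \<integral>y. (1 / X (n+N)) *\<^sub>R (h (X (n+N)) y - h 0 y) \<partial>M) \<longlonglongrightarrow> (\<integral>y. h' 0 y \<partial>M)"
    proof (rule integral_dominated_convergence[where w=K])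
      show "(\<lambda>y. (1 / X (n+N)) *\<^sub>R (h (X (n+N)) y - h 0 y)) \<in> borel_measurable M" for n
        using int by measurable
      show "AE y in M. norm ((1 / X (n+N)) *\<^sub>R (h (X (n+N)) y - h 0 y)) \<le> K y" for n
        using lip[OF N[of "n+N"]] X(1) by (auto simp: divide_simps)
      have "(\<lambda>n. (1 / X (n+N)) *\<^sub>R (h (X (n+N)) y - h 0 y)) \<longlonglongrightarrow> h' 0 y" for y
      proof -
        have "((\<lambda>t. (1 / t) *\<^sub>R (h t y - h 0 y)) \<longlongrightarrow> h' 0 y) (at 0)"
          using deriv[of 0 y] by (simp add: has_vector_derivative_at_0_iff)
        then show ?thesis
          unfolding tendsto_at_iff_sequentially comp_def using X LIMSEQ_ignore_initial_segment[OF X(2), of N] by auto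
      qed
      then show "AE y in M. (\<lambda>n. (1 / X (n+N)) *\<^sub>R (h (X (n+N)) y - h 0 y)) \<longlonglongrightarrow> h' 0 y" by simp
    qed (use K meas in auto)
    then have "(\<lambda>n. (1 / X (n+N)) *\<^sub>R ((\<integral>y. h (X (n+N)) y \<partial>M) - (\<integral>y. h 0 y \<partial>M))) \<longlonglongrightarrow> (\<integral>y. h' 0 y \<partial>M)"
      using int by simp
    then show "(\<lambda>n. (1 / X n) *\<^sub>R ((\<integral>y. h (X n) y \<partial>M) - (\<integral>y. h 0 y \<partial>M))) \<longlonglongrightarrow> (\<integral>y. h' 0 y \<partial>M)"
      by (rule LIMSEQ_offset)
  qed
  then show "((\<lambda>t. \<integral>y. h t y \<partial>M) has_vector_derivative (\<integral>y. h' 0 y \<partial>M)) (at 0)"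
    by (simp add: has_vector_derivative_at_0_iff)
qed

text \<open>Peetre's inequality: translation by \<open>a\<close> changes the weight by a factor
  depending on \<open>a\<close> alone, so one polynomial weight controls all shifts of bounded
  size.\<close>

lemma one_plus_norm_shift:
  fixes x a :: "'a::real_normed_vector"
  shows "1 + (norm x)\<^sup>2 \<le> 2 * (1 + (norm a)\<^sup>2) * (1 + (norm (x + a))\<^sup>2)"
proof -
  have "norm x \<le> norm (x + a) + norm a"
    using norm_triangle_ineq4[of "x + a" a] by simp
  then have "(norm x)\<^sup>2 \<le> (norm (x + a) + norm a)\<^sup>2"
    by (intro power_mono) auto
  also have "\<dots> \<le> 2 * (norm (x + a))\<^sup>2 + 2 * (norm a)\<^sup>2"
    using sum_squares_bound[of "norm (x + a)" "norm a"] by (simp add: power2_sum)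
  finally have "(norm x)\<^sup>2 \<le> 2 * (norm (x + a))\<^sup>2 + 2 * (norm a)\<^sup>2" .
  moreover have "0 \<le> 2 * (norm a)\<^sup>2 * (norm (x + a))\<^sup>2" by simp
  ultimately have "(norm x)\<^sup>2 \<le> 1 + (2 * (norm a)\<^sup>2 + (2 * (norm (x + a))\<^sup>2 + 2 * (norm a)\<^sup>2 * (norm (x + a))\<^sup>2))"
    by linarith
  then show ?thesis by (simp add: distrib_left distrib_right)
qed

lemma one_plus_norm_pos [simp]: "1 + (norm x)\<^sup>2 > 0" "1 + (norm x)\<^sup>2 \<noteq> 0"
  using zero_le_power2[of "norm x"] by (linarith+)

lemma schwartz_shift_bound:
  assumes "schwartz f"
  obtains C where "C > 0" "\<And>x a. norm a \<le> R \<Longrightarrow> norm (f (x + a)) \<le> C / (1 + (norm x)\<^sup>2) ^ N"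
proof -
  obtain C where C: "C > 0" "\<And>x. norm (f x) * (1 + (norm x)\<^sup>2) ^ N \<le> C"
    using schwartz_bound[OF assms] by metis
  have "norm (f (x + a)) \<le> C * (2 * (1 + R\<^sup>2)) ^ N / (1 + (norm x)\<^sup>2) ^ N" if a: "norm a \<le> R" for x a
  proof -
    have "1 + (norm x)\<^sup>2 \<le> 2 * (1 + R\<^sup>2) * (1 + (norm (x + a))\<^sup>2)"
      using power_mono[OF a norm_ge_zero, of 2]
      by (intro order_trans[OF one_plus_norm_shift[of x a]] mult_right_mono mult_left_mono) auto
    then have "(1 + (norm x)\<^sup>2) ^ N \<le> (2 * (1 + R\<^sup>2)) ^ N * (1 + (norm (x + a))\<^sup>2) ^ N"
      unfolding power_mult_distrib[symmetric] by (intro power_mono) (auto simp: less_imp_le)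
    then have "norm (f (x + a)) * (1 + (norm x)\<^sup>2) ^ N
        \<le> norm (f (x + a)) * ((2 * (1 + R\<^sup>2)) ^ N * (1 + (norm (x + a))\<^sup>2) ^ N)"
      by (intro mult_left_mono) auto
    also have "\<dots> = (norm (f (x + a)) * (1 + (norm (x + a))\<^sup>2) ^ N) * (2 * (1 + R\<^sup>2)) ^ N"
      by (simp add: ac_simps)
    also have "\<dots> \<le> C * (2 * (1 + R\<^sup>2)) ^ N"
      by (intro mult_right_mono C) auto
    finally show ?thesis by (simp add: pos_le_divide_eq)
  qed
  moreover have "C * (2 * (1 + R\<^sup>2)) ^ N > 0"
    using C(1) by (auto intro!: mult_pos_pos zero_less_power add_pos_nonneg)
  ultimately show ?thesis using that by blast
qed

text \<open>Common source of three derivative rules. For the Fourier transform \<open>X\<close> is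
  the identity and \<open>m\<close> an oscillating exponential; for the Radon transform
  \<open>X\<close> is the coordinate map of a hyperplane and \<open>m\<close> is 1; for convolutions
  \<open>X y\<close> is \<open>x - y\<close> and \<open>m\<close> is the kernel. The derivative
  falls on \<open>f\<close>, so \<open>m\<close> may be singular as long as it is integrable against
  a polynomial weight.\<close>

lemma schwartz_integral_shift:
  fixes f :: "'a::euclidean_space \<Rightarrow> 'b::{real_normed_field, banach, second_countable_topology}"
  assumes f: "schwartz f"
    and X [measurable]: "X \<in> borel_measurable M" and m [measurable]: "m \<in> borel_measurable M"
    and int: "integrable M (\<lambda>y. norm (m y) / (1 + (norm (X y))\<^sup>2) ^ N)"
  shows schwartz_integrable_shift: "integrable M (\<lambda>y. m y * f (X y))"
    and schwartz_derivative_shift: "((\<lambda>t. \<integral>y. m y * f (X y + t *\<^sub>R v) \<partial>M) has_vector_derivative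
      (\<integral>y. m y * partial_deriv v f (X y) \<partial>M)) (at 0)"
proof -
  have meas [measurable]: "(\<lambda>y. g (X y + a)) \<in> borel_measurable M" if "schwartz g" for g :: "'a \<Rightarrow> 'b" and a
    using schwartz_measurable[OF that] by measurable
  have 1: "integrable M (\<lambda>y. m y * g (X y + a))" if g: "schwartz g" for g :: "'a \<Rightarrow> 'b" and a
  proof -
    obtain C where C: "C > 0" "\<And>x. norm (g (x + a)) \<le> C / (1 + (norm x)\<^sup>2) ^ N"
      using schwartz_shift_bound[OF g, of "norm a"] by (metis order_refl)
    show ?thesis
    proof (rule Bochner_Integration.integrable_bound[OF integrable_mult_right[OF int, of C]])
      show "AE y in M. norm (m y * g (X y + a)) \<le> norm (C * (norm (m y) / (1 + (norm (X y))\<^sup>2) ^ N))"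
        using C mult_left_mono[OF C(2) norm_ge_zero] by (auto simp: norm_mult mult.commute)
    qed (use meas[OF g] in measurable)
  qed
  show "integrable M (\<lambda>y. m y * f (X y))"
    using 1[OF f, of 0] by simp
  note f' = schwartz_partial_deriv[OF f, of v]
  obtain C where C: "C > 0" "\<And>x a. norm a \<le> norm v \<Longrightarrow> norm (partial_deriv v f (x + a)) \<le> C / (1 + (norm x)\<^sup>2) ^ N"
    using schwartz_shift_bound[OF f', of "norm v"] by metis
  have "((\<lambda>t. \<integral>y. m y * f (X y + t *\<^sub>R v) \<partial>M) has_vector_derivative
      (\<integral>y. m y * partial_deriv v f (X y + 0 *\<^sub>R v) \<partial>M)) (at 0)"
  proof (rule has_vector_derivative_integral(1)[where K="\<lambda>y. C * (norm (m y) / (1 + (norm (X y))\<^sup>2) ^ N)"])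
    show "integrable M (\<lambda>y. m y * f (X y + t *\<^sub>R v))" for t by (rule 1[OF f])
    show "((\<lambda>t. m y * f (X y + t *\<^sub>R v)) has_vector_derivative m y * partial_deriv v f (X y + t *\<^sub>R v)) (at t)" for t y
      by (intro has_vector_derivative_mult_right has_vector_derivative_along schwartz_differentiable f)
    show "norm (m y * partial_deriv v f (X y + t *\<^sub>R v)) \<le> C * (norm (m y) / (1 + (norm (X y))\<^sup>2) ^ N)"
      if "\<bar>t\<bar> \<le> 1" for t y
      using mult_left_mono[OF C(2)[of "t *\<^sub>R v" "X y"], of "norm (m y)"] that
      by (simp add: norm_mult mult.commute mult_left_le_one_le)
  qed (use integrable_mult_right[OF int, of C] meas[OF f', of 0] in auto)
  then show "((\<lambda>t. \<integral>y. m y * f (X y + t *\<^sub>R v) \<partial>M) has_vector_derivative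
      (\<integral>y. m y * partial_deriv v f (X y) \<partial>M)) (at 0)" by simp
qed

section \<open>Lebesgue measure\<close>

lemma nn_integral_lborel_affine:
  fixes f :: "'a::euclidean_space \<Rightarrow> ennreal"
  assumes [measurable]: "f \<in> borel_measurable borel" and "c \<noteq> 0"
  shows "(\<integral>\<^sup>+x. f x \<partial>lborel) = ennreal (\<bar>c\<bar> ^ DIM('a)) * (\<integral>\<^sup>+x. f (t + c *\<^sub>R x) \<partial>lborel)"
  by (subst lborel_affine[OF assms(2), of t])
     (simp add: nn_integral_density nn_integral_distr nn_integral_cmult)

lemma lborel_integral_affine:
  fixes f :: "'a::euclidean_space \<Rightarrow> 'b::{banach, second_countable_topology}"
  assumes [measurable]: "f \<in> borel_measurable borel" and "c \<noteq> 0"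
  shows "(\<integral>x. f x \<partial>lborel) = \<bar>c\<bar> ^ DIM('a) *\<^sub>R (\<integral>x. f (t + c *\<^sub>R x) \<partial>lborel)"
  by (subst lborel_affine[OF assms(2), of t])
     (simp add: integral_density integral_distr)

lemma lborel_integrable_affine:
  fixes f :: "'a::euclidean_space \<Rightarrow> 'b::{banach, second_countable_topology}"
  assumes "integrable lborel f" and "c \<noteq> 0"
  shows "integrable lborel (\<lambda>x. f (t + c *\<^sub>R x))"
proof -
  have [measurable]: "f \<in> borel_measurable borel" using assms(1) by auto
  have "integrable (density (distr lborel borel (\<lambda>x. t + c *\<^sub>R x)) (\<lambda>_. \<bar>c\<bar> ^ DIM('a))) f"
    using assms by (subst lborel_affine[OF assms(2), of t, symmetric])
  then have "integrable lborel (\<lambda>x. \<bar>c\<bar> ^ DIM('a) *\<^sub>R f (t + c *\<^sub>R x))"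
    by (simp add: integrable_density integrable_distr_eq)
  then have "integrable lborel (\<lambda>x. (1 / \<bar>c\<bar> ^ DIM('a)) *\<^sub>R (\<bar>c\<bar> ^ DIM('a) *\<^sub>R f (t + c *\<^sub>R x)))"
    by (rule integrable_scaleR_right)
  then show ?thesis using assms(2) by simp
qed

section \<open>Integrability of polynomial weights\<close>

lemma nn_integral_inverse_1_plus_square:
  "(\<integral>\<^sup>+x. ennreal (1 / (1 + x\<^sup>2)) \<partial>lborel) < \<infinity>"
proof -
  have "integrable lborel (\<lambda>x::real. inverse (1 + x\<^sup>2))"
    using integrable_inverse_1_plus_square by (simp add: set_integrable_def einterval_def)
  from integrableD(2)[OF this] show ?thesis
    by (simp add: inverse_eq_divide abs_of_nonneg less_top)
qed

lemma prod_one_plus_le: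
  fixes a :: "'i \<Rightarrow> real"
  assumes "finite I" "\<And>i. i \<in> I \<Longrightarrow> a i \<ge> 0"
  shows "(\<Prod>i\<in>I. 1 + a i) \<le> (1 + (\<Sum>i\<in>I. a i)) ^ card I"
proof -
  have "(\<Prod>i\<in>I. 1 + a i) \<le> (\<Prod>i\<in>I. 1 + (\<Sum>i\<in>I. a i))"
    using assms by (intro prod_mono) (auto intro!: member_le_sum add_nonneg_nonneg)
  then show ?thesis by simp
qed

text \<open>The radial weight is dominated by the product of the weights
  \<open>1 / (1 + (t i)\<^sup>2)\<close>, whose integral factors. The index set is kept general
  because it stands both for all coordinates of the space and for those of a hyperplane.\<close>

lemma nn_integral_PiM_weight:
  assumes "finite I"
  shows "(\<integral>\<^sup>+t. ennreal (1 / (1 + (\<Sum>i\<in>I. (t i)\<^sup>2)) ^ card I) \<partial>(\<Pi>\<^sub>M i\<in>I. lborel)) < \<infinity>"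
proof -
  interpret product_sigma_finite "\<lambda>_. lborel :: real measure" by standard
  have "(\<integral>\<^sup>+t. ennreal (1 / (1 + (\<Sum>i\<in>I. (t i)\<^sup>2)) ^ card I) \<partial>(\<Pi>\<^sub>M i\<in>I. lborel))
      \<le> (\<integral>\<^sup>+t. (\<Prod>i\<in>I. ennreal (1 / (1 + (t i)\<^sup>2))) \<partial>(\<Pi>\<^sub>M i\<in>I. lborel))"
  proof (rule nn_integral_mono)
    fix t :: "'a \<Rightarrow> real"
    have pos: "(\<Prod>i\<in>I. 1 + (t i)\<^sup>2) > 0" by (intro prod_pos) (auto intro: add_pos_nonneg)
    have "1 / (1 + (\<Sum>i\<in>I. (t i)\<^sup>2)) ^ card I \<le> 1 / (\<Prod>i\<in>I. 1 + (t i)\<^sup>2)"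
      using prod_one_plus_le[OF assms, of "\<lambda>i. (t i)\<^sup>2"] pos by (intro divide_left_mono mult_pos_pos) auto
    also have "\<dots> = (\<Prod>i\<in>I. 1 / (1 + (t i)\<^sup>2))" by (simp add: prod_dividef)
    finally show "ennreal (1 / (1 + (\<Sum>i\<in>I. (t i)\<^sup>2)) ^ card I) \<le> (\<Prod>i\<in>I. ennreal (1 / (1 + (t i)\<^sup>2)))"
      by (subst prod_ennreal) (auto intro!: ennreal_leI)
  qed
  also have "\<dots> = (\<Prod>i\<in>I. \<integral>\<^sup>+x. ennreal (1 / (1 + x\<^sup>2)) \<partial>lborel)"
    by (intro product_nn_integral_prod assms) auto
  also have "\<dots> < \<infinity>"
    using nn_integral_inverse_1_plus_square by (simp add: power_less_top_ennreal)
  finally show ?thesis .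
qed

lemma norm_sum_orthonormal:
  fixes u :: "'i \<Rightarrow> 'a::real_inner"
  assumes "finite I" "\<And>i j. i \<in> I \<Longrightarrow> j \<in> I \<Longrightarrow> u i \<bullet> u j = (if i = j then 1 else 0)"
  shows "(norm (\<Sum>i\<in>I. t i *\<^sub>R u i))\<^sup>2 = (\<Sum>i\<in>I. (t i)\<^sup>2)"
proof -
  have "(norm (\<Sum>i\<in>I. t i *\<^sub>R u i))\<^sup>2 = (\<Sum>i\<in>I. \<Sum>j\<in>I. t i * (t j * (u i \<bullet> u j)))"
    by (simp add: power2_norm_eq_inner inner_sum_left inner_sum_right sum_distrib_left inner_commute ac_simps)
  also have "\<dots> = (\<Sum>i\<in>I. \<Sum>j\<in>I. if i = j then (t i)\<^sup>2 else 0)"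
    using assms(2) by (intro sum.cong refl) (auto simp: power2_eq_square)
  also have "\<dots> = (\<Sum>i\<in>I. (t i)\<^sup>2)"
    using assms(1) by simp
  finally show ?thesis .
qed

lemma integrable_weight:
  assumes "N \<ge> DIM('a::euclidean_space)"
  shows "integrable lborel (\<lambda>x::'a. 1 / (1 + (norm x)\<^sup>2) ^ N)"
proof -
  have *: "integrable lborel (\<lambda>x::'a. 1 / (1 + (norm x)\<^sup>2) ^ DIM('a))"
  proof (rule integrableI_nonneg)
    have "integral\<^sup>N lborel (\<lambda>x::'a. ennreal (1 / (1 + (norm x)\<^sup>2) ^ DIM('a)))
        = (\<integral>\<^sup>+t. ennreal (1 / (1 + (norm (\<Sum>b\<in>Basis. t b *\<^sub>R (b::'a)))\<^sup>2) ^ DIM('a)) \<partial>(\<Pi>\<^sub>M i\<in>Basis. lborel))"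
      by (subst lborel_eq) (simp add: nn_integral_distr)
    also have "\<dots> < \<infinity>"
      using nn_integral_PiM_weight[of "Basis :: 'a set"]
      by (simp add: norm_sum_orthonormal[where u="\<lambda>b. b"] inner_Basis)
    finally show "integral\<^sup>N lborel (\<lambda>x::'a. ennreal (1 / (1 + (norm x)\<^sup>2) ^ DIM('a))) < \<infinity>" .
  qed (auto intro!: AE_I2 divide_nonneg_nonneg)
  show ?thesis
  proof (rule Bochner_Integration.integrable_bound[OF *])
    have "1 / (1 + (norm x)\<^sup>2) ^ N \<le> 1 / (1 + (norm x)\<^sup>2) ^ DIM('a)" for x :: 'a
      using assms by (intro divide_left_mono power_increasing mult_pos_pos zero_less_power) auto
    then show "AE x::'a in lborel. norm (1 / (1 + (norm x)\<^sup>2) ^ N) \<le> norm (1 / (1 + (norm x)\<^sup>2) ^ DIM('a))"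
      by (auto simp: abs_of_nonneg)
  qed auto
qed

text \<open>Both \<open>N\<close> and Lebesgue measure are translation invariant, so Fubini applied to
  \<open>indicator A (x + y) * indicator (ball 0 1) y\<close> shows that they are proportional.\<close>

lemma lborel_eq_translation_invariant:
  fixes N :: "'a::euclidean_space measure"
  assumes sets [simp, measurable_cong]: "sets N = sets borel"
    and fin: "\<And>r. emeasure N (ball 0 r) < \<infinity>"
    and inv: "\<And>a. distr N borel (\<lambda>x. x + a) = N"
    and ball: "emeasure N (ball 0 1) = emeasure lborel (ball (0::'a) 1)"
  shows "N = lborel"
proof (rule measure_eqI)
  have space [simp]: "space N = UNIV"
    using sets_eq_imp_space_eq[OF sets] by simp
  interpret N: sigma_finite_measure N
  proof
    show "\<exists>A. countable A \<and> A \<subseteq> sets N \<and> \<Union>A = space N \<and> (\<forall>a\<in>A. emeasure N a \<noteq> \<infinity>)"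
    proof (intro exI[of _ "range (\<lambda>n::nat. ball 0 (real n))"] conjI)
      show "\<Union>(range (\<lambda>n. ball (0::'a) (real n))) = space N"
        using reals_Archimedean2 by auto
    qed (use fin in \<open>auto simp: less_top\<close>)
  qed
  interpret P: pair_sigma_finite N lborel ..
  fix A assume "A \<in> sets N"
  then have [measurable]: "A \<in> sets borel" by simp
  define i where "i A x = (indicator A x :: ennreal)" for A and x :: 'a
  have [measurable]: "i B \<in> borel_measurable borel" if "B \<in> sets borel" for B
    using that unfolding i_def by measurable
  note [measurable] = measurable_compose[OF _ this]
  have i_int: "integral\<^sup>N M (i A) = emeasure M A" if "A \<in> sets M" for M A
    using that nn_integral_indicator[of A M] by (simp add: i_def[abs_def])
  let ?B = "ball 0 1 :: 'a set"
  have "emeasure lborel A * emeasure N ?B = (\<integral>\<^sup>+y. (\<integral>\<^sup>+x. i A x \<partial>lborel) * i ?B y \<partial>N)"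
    by (subst nn_integral_cmult) (auto simp: i_int)
  also have "\<dots> = (\<integral>\<^sup>+y. (\<integral>\<^sup>+x. i A (x + y) \<partial>lborel) * i ?B y \<partial>N)"
    using nn_integral_lborel_affine[of "i A" 1] by (simp add: add.commute)
  also have "\<dots> = (\<integral>\<^sup>+y. (\<integral>\<^sup>+x. i A (x + y) * i ?B y \<partial>lborel) \<partial>N)"
    by (subst nn_integral_multc) auto
  also have "\<dots> = (\<integral>\<^sup>+x. (\<integral>\<^sup>+y. i A (x + y) * i ?B y \<partial>N) \<partial>lborel)"
    by (rule P.Fubini'[symmetric]) auto
  also have "\<dots> = (\<integral>\<^sup>+x. (\<integral>\<^sup>+y. i A y * i ?B (y - x) \<partial>N) \<partial>lborel)"
  proof (rule nn_integral_cong)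
    fix x
    have "(\<integral>\<^sup>+y. i A y * i ?B (y - x) \<partial>N) = (\<integral>\<^sup>+y. i A y * i ?B (y - x) \<partial>distr N borel (\<lambda>y. y + x))"
      by (simp add: inv)
    also have "\<dots> = (\<integral>\<^sup>+y. i A (x + y) * i ?B y \<partial>N)"
      by (subst nn_integral_distr) (auto simp: add.commute)
    finally show "(\<integral>\<^sup>+y. i A (x + y) * i ?B y \<partial>N) = (\<integral>\<^sup>+y. i A y * i ?B (y - x) \<partial>N)" by simp
  qed
  also have "\<dots> = (\<integral>\<^sup>+y. (\<integral>\<^sup>+x. i A y * i ?B (y - x) \<partial>lborel) \<partial>N)"
    by (rule P.Fubini') auto
  also have "\<dots> = (\<integral>\<^sup>+y. i A y * (\<integral>\<^sup>+x. i ?B (y - x) \<partial>lborel) \<partial>N)"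
    by (subst nn_integral_cmult) auto
  also have "\<dots> = (\<integral>\<^sup>+y. i A y * emeasure lborel ?B \<partial>N)"
  proof -
    have "(\<integral>\<^sup>+x. i ?B (y - x) \<partial>lborel) = emeasure lborel ?B" for y
      using nn_integral_lborel_affine[of "i ?B" "-1" y] by (simp add: i_def)
    then show ?thesis by simp
  qed
  also have "\<dots> = emeasure N A * emeasure lborel ?B"
    by (subst nn_integral_multc) (auto simp: i_int)
  finally have "emeasure lborel A * emeasure lborel ?B = emeasure N A * emeasure lborel ?B"
    by (simp add: ball)
  moreover have "emeasure lborel ?B \<noteq> 0" "emeasure lborel ?B \<noteq> \<infinity>"
    by (auto simp: emeasure_ball) (metis less_irrefl of_nat_0_le_iff unit_ball_vol_pos)
  ultimately show "emeasure N A = emeasure lborel A"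
    by (simp add: mult.commute[of _ "emeasure lborel ?B"] ennreal_mult_cancel_left)
qed auto

section \<open>Lebesgue measure in orthonormal coordinates\<close>

lemma PiM_lborel_translation:
  fixes c :: "'i \<Rightarrow> real"
  assumes [simp]: "finite I"
  shows "distr (\<Pi>\<^sub>M i\<in>I. lborel) (\<Pi>\<^sub>M i\<in>I. lborel) (\<lambda>t. \<lambda>i\<in>I. t i + c i) = (\<Pi>\<^sub>M i\<in>I. lborel)"
proof -
  interpret product_sigma_finite "\<lambda>_. lborel :: real measure" by standard
  show ?thesis
  proof (rule PiM_eqI)
    fix A :: "'i \<Rightarrow> real set" assume A: "\<And>i. i \<in> I \<Longrightarrow> A i \<in> sets lborel"
    then have [measurable]: "(\<lambda>x. x + c i) -` A i \<in> sets borel" if "i \<in> I" for i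
      using that measurable_sets[of "\<lambda>x. x + c i" borel borel "A i"] by simp
    have "emeasure (distr (\<Pi>\<^sub>M i\<in>I. lborel) (\<Pi>\<^sub>M i\<in>I. lborel) (\<lambda>t. \<lambda>i\<in>I. t i + c i)) (Pi\<^sub>E I A)
        = emeasure (\<Pi>\<^sub>M i\<in>I. lborel) (Pi\<^sub>E I (\<lambda>i. (\<lambda>x. x + c i) -` A i))"
      using A by (subst emeasure_distr)
        (auto intro!: sets_PiM_I_finite arg_cong2[where f=emeasure] measurable_restrict simp: space_PiM PiE_iff)
    also have "\<dots> = (\<Prod>i\<in>I. emeasure lborel ((\<lambda>x. x + c i) -` A i))"
      by (subst emeasure_PiM) auto
    also have "\<dots> = (\<Prod>i\<in>I. emeasure lborel (A i))"
    proof (rule prod.cong[OF refl])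
      fix i assume i: "i \<in> I"
      have "emeasure lborel (A i) = emeasure (distr lborel borel ((+) (c i))) (A i)"
        by (subst lborel_distr_plus) simp
      also have "\<dots> = emeasure lborel ((\<lambda>x. x + c i) -` A i)"
        using A[OF i] by (subst emeasure_distr) (auto simp: vimage_def add.commute)
      finally show "emeasure lborel ((\<lambda>x. x + c i) -` A i) = emeasure lborel (A i)" by simp
    qed
    finally show "emeasure (distr (\<Pi>\<^sub>M i\<in>I. lborel) (\<Pi>\<^sub>M i\<in>I. lborel) (\<lambda>t. \<lambda>i\<in>I. t i + c i)) (Pi\<^sub>E I A)
        = (\<Prod>i\<in>I. emeasure lborel (A i))" .
  qed auto
qed

text \<open>Rotation invariance of Lebesgue measure. The image measure inherits translation
  invariance from the coordinates, because \<open>a\<close> shifts the coordinate \<open>i\<close>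
  by \<open>a \<bullet> u i\<close>. By Pythagoras the preimage of a closed ball is a ball in
  coordinates, whose volume depends on its radius and on \<open>card I\<close> only.\<close>

lemma lborel_eq_orthonormal:
  fixes u :: "'i \<Rightarrow> 'a::euclidean_space"
  assumes fin [simp]: "finite I"
    and orth: "\<And>i j. i \<in> I \<Longrightarrow> j \<in> I \<Longrightarrow> u i \<bullet> u j = (if i = j then 1 else 0)"
    and card: "card I = DIM('a)"
    and rep: "\<And>x. x = (\<Sum>i\<in>I. (x \<bullet> u i) *\<^sub>R u i)"
  shows "distr (\<Pi>\<^sub>M i\<in>I. lborel) borel (\<lambda>t. \<Sum>i\<in>I. t i *\<^sub>R u i) = lborel"
proof (rule lborel_eq_translation_invariant)
  let ?P = "\<Pi>\<^sub>M i\<in>I. (lborel :: real measure)"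
  let ?S = "\<lambda>t. \<Sum>i\<in>I. t i *\<^sub>R u i"
  have norm: "(norm (?S t))\<^sup>2 = (\<Sum>i\<in>I. (t i)\<^sup>2)" for t
    by (rule norm_sum_orthonormal[OF fin orth])
  have [measurable]: "?S \<in> borel_measurable ?P" by measurable
  have cball: "emeasure (distr ?P borel ?S) (cball 0 r) = emeasure lborel (cball (0::'a) r)" if "r > 0" for r
  proof -
    have "emeasure (distr ?P borel ?S) (cball 0 r) = emeasure ?P ({t. sqrt (\<Sum>i\<in>I. (t i)\<^sup>2) \<le> r} \<inter> space ?P)"
      by (subst emeasure_distr)
         (auto simp: norm[symmetric] intro!: arg_cong2[where f=emeasure])
    also have "\<dots> = emeasure lborel (cball (0::'a) r)"
      using that by (subst emeasure_cball_aux) (auto simp: emeasure_cball card)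
    finally show ?thesis .
  qed
  show "emeasure (distr ?P borel ?S) (ball 0 r) < \<infinity>" for r
  proof -
    have "emeasure (distr ?P borel ?S) (ball 0 r) \<le> emeasure (distr ?P borel ?S) (cball 0 (max 1 r))"
      by (intro emeasure_mono) auto
    also have "\<dots> < \<infinity>" by (simp add: cball emeasure_cball)
    finally show ?thesis .
  qed
  show "distr (distr ?P borel ?S) borel (\<lambda>x. x + a) = distr ?P borel ?S" for a
  proof -
    have "distr ?P borel ?S = distr (distr ?P ?P (\<lambda>t. \<lambda>i\<in>I. t i + a \<bullet> u i)) borel ?S"
      by (simp add: PiM_lborel_translation)
    also have "\<dots> = distr ?P borel (\<lambda>t. ?S (\<lambda>i\<in>I. t i + a \<bullet> u i))"
      by (subst distr_distr) (auto simp: comp_def)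
    also have "\<dots> = distr ?P borel (\<lambda>t. ?S t + a)"
      using rep[of a] by (intro distr_cong) (auto simp: scaleR_add_left sum.distrib)
    also have "\<dots> = distr (distr ?P borel ?S) borel (\<lambda>x. x + a)"
      by (subst distr_distr) (auto simp: comp_def)
    finally show ?thesis by simp
  qed
  \<comment> \<open>Volumes have been compared for closed balls, while the criterion is normalised
    on the open unit ball; hence the exhaustion from inside. The offset \<open>n + 2\<close> keeps
    the first radius positive, as \<open>cball\<close> requires.\<close>
  have eq: "emeasure M (ball 0 1) = (SUP n. emeasure M (cball (0::'a) (1 - 1 / real (n + 2))))"
    if "sets M = sets borel" for M :: "'a measure"
  proof -
    define B where "B n = cball (0::'a) (1 - 1 / real (n + 2))" for n
    have U: "(\<Union>n. B n) = ball 0 1"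
    proof (intro equalityI subsetI)
      fix x :: 'a assume "x \<in> ball 0 1"
      then obtain n where "inverse (real (Suc n)) < 1 - norm x"
        using reals_Archimedean[of "1 - norm x"] by auto
      moreover have "1 / real (n + 2) \<le> inverse (real (Suc n))" by (simp add: field_simps)
      ultimately have "norm x \<le> 1 - 1 / real (n + 2)" by linarith
      then show "x \<in> (\<Union>n. B n)" unfolding B_def by auto
    qed (auto simp: B_def intro: le_less_trans)
    have inc: "incseq B"
      unfolding B_def by (intro incseq_SucI subset_cball) (simp add: field_simps)
    have "B n \<in> sets borel" for n unfolding B_def by (rule borel_closed[OF closed_cball])
    then have "range B \<subseteq> sets M" unfolding that by blast
    from SUP_emeasure_incseq[OF this inc] show ?thesis unfolding U unfolding B_def by simp
  qed
  show "emeasure (distr ?P borel ?S) (ball 0 1) = emeasure lborel (ball (0::'a) 1)"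
  proof -
    have "emeasure (distr ?P borel ?S) (cball 0 (1 - 1 / real (n + 2))) = emeasure lborel (cball (0::'a) (1 - 1 / real (n + 2)))" for n
      by (rule cball) simp
    then show ?thesis by (simp only: eq[of "distr ?P borel ?S", OF sets_distr] eq[of lborel, OF sets_lborel])
  qed
qed auto

section \<open>Polar coordinates\<close>

lemma nn_integral_powr_outside:
  assumes "a > 0" "n > 0"
  shows "(\<integral>\<^sup>+r. ennreal (1 / \<bar>r\<bar> ^ Suc n) * indicator {r. a \<le> \<bar>r\<bar>} r \<partial>lborel) = ennreal (2 / (real n * a ^ n))"
proof -
  have 1: "(\<integral>\<^sup>+r. ennreal (1 / r ^ Suc n) * indicator {a..} r \<partial>lborel) = ennreal (0 - (- 1 / (real n * a ^ n)))"
  proof (rule nn_integral_FTC_atLeast[where F="\<lambda>r. - 1 / (real n * r ^ n)"])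
    fix r assume "a \<le> r"
    then show "((\<lambda>r. - 1 / (real n * r ^ n)) has_real_derivative 1 / r ^ Suc n) (at r)"
      using assms by (auto intro!: derivative_eq_intros simp: field_simps power_Suc[symmetric] simp del: power_Suc)
         (cases n, auto simp: field_simps)
    show "0 \<le> 1 / r ^ Suc n" using \<open>a \<le> r\<close> assms by simp
  next
    have "((\<lambda>r. - (1 / real n) * inverse (r ^ n)) \<longlongrightarrow> - (1 / real n) * 0) at_top"
      using assms(2) by (intro tendsto_intros tendsto_inverse_0_at_top filterlim_pow_at_top filterlim_ident)
    then show "((\<lambda>r. - 1 / (real n * r ^ n)) \<longlongrightarrow> 0) at_top"
      by (simp add: field_simps)
  qed auto
  have 2: "(\<integral>\<^sup>+r. ennreal (1 / \<bar>r\<bar> ^ Suc n) * indicator {a..} r \<partial>lborel) = (\<integral>\<^sup>+r. ennreal (1 / r ^ Suc n) * indicator {a..} r \<partial>lborel)"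
    using assms by (intro nn_integral_cong) (auto simp: indicator_def)
  have 3: "(\<integral>\<^sup>+r. ennreal (1 / \<bar>r\<bar> ^ Suc n) * indicator {..-a} r \<partial>lborel) = (\<integral>\<^sup>+r. ennreal (1 / \<bar>r\<bar> ^ Suc n) * indicator {a..} r \<partial>lborel)"
    by (subst nn_integral_real_affine[of _ "-1" 0]) (auto intro!: nn_integral_cong simp: indicator_def)
  have "(\<integral>\<^sup>+r. ennreal (1 / \<bar>r\<bar> ^ Suc n) * indicator {r. a \<le> \<bar>r\<bar>} r \<partial>lborel)
      = (\<integral>\<^sup>+r. ennreal (1 / \<bar>r\<bar> ^ Suc n) * indicator {a..} r + ennreal (1 / \<bar>r\<bar> ^ Suc n) * indicator {..-a} r \<partial>lborel)"
    using assms by (intro nn_integral_cong) (auto simp: indicator_def)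
  also have "\<dots> = (\<integral>\<^sup>+r. ennreal (1 / \<bar>r\<bar> ^ Suc n) * indicator {a..} r \<partial>lborel) + (\<integral>\<^sup>+r. ennreal (1 / \<bar>r\<bar> ^ Suc n) * indicator {..-a} r \<partial>lborel)"
    by (intro nn_integral_add) auto
  also have "\<dots> = ennreal (1 / (real n * a ^ n)) + ennreal (1 / (real n * a ^ n))"
    unfolding 3 2 1 by simp
  also have "\<dots> = ennreal (2 / (real n * a ^ n))"
    using assms by (subst ennreal_plus[symmetric]) (auto simp del: ennreal_plus)
  finally show ?thesis .
qed

lemma sets_sphere_measure [simp, measurable_cong]: "sets sphere_measure = sets (restrict_space borel (sphere 0 1))"
  by (simp add: sphere_measure_def)

lemma space_sphere_measure [simp]: "space sphere_measure = sphere 0 1"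
  using sets_eq_imp_space_eq[OF sets_sphere_measure] by (simp add: space_restrict_space)

lemma nn_integral_sphere_measure:
  fixes f :: "real ^ 'n \<Rightarrow> ennreal"
  assumes [measurable]: "f \<in> borel_measurable (restrict_space borel (sphere 0 1))"
  shows "(\<integral>\<^sup>+\<omega>. f \<omega> \<partial>sphere_measure)
    = of_nat CARD('n) * (\<integral>\<^sup>+x. f (x /\<^sub>R norm x) * indicator (cball 0 1 - {0}) x \<partial>lborel)"
proof -
  have [measurable]: "(\<lambda>x. x /\<^sub>R norm x) \<in> restrict_space lborel (cball 0 1 - {0 :: real ^ 'n}) \<rightarrow>\<^sub>M restrict_space borel (sphere 0 1)"
    by (intro measurable_restrict_space3) (auto intro: measurable_restrict_space1)
  show ?thesis
    unfolding sphere_measure_def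
    by (simp add: nn_integral_scale_measure nn_integral_distr nn_integral_restrict_space)
qed

lemma sigma_finite_sphere_measure: "sigma_finite_measure (sphere_measure :: (real ^ 'n) measure)"
proof -
  have "finite_measure (sphere_measure :: (real ^ 'n) measure)"
  proof
    have "emeasure (sphere_measure :: (real ^ 'n) measure) (space sphere_measure) = integral\<^sup>N sphere_measure (\<lambda>\<omega>::real^'n. 1)" by simp
    also have "\<dots> = of_nat CARD('n) * integral\<^sup>N lborel (\<lambda>x::real^'n. 1 * indicator (cball 0 1 - {0}) x)"
      by (rule nn_integral_sphere_measure) simp
    also have "\<dots> \<le> of_nat CARD('n) * integral\<^sup>N lborel (indicator (cball (0::real^'n) 1))"
      by (intro mult_left_mono nn_integral_mono) (auto simp: indicator_def)
    also have "\<dots> < \<infinity>" by (simp add: emeasure_cball ennreal_mult_less_top ennreal_of_nat_eq_real_of_nat)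
    finally show "emeasure (sphere_measure :: (real ^ 'n) measure) (space sphere_measure) \<noteq> \<infinity>" by simp
  qed
  then interpret finite_measure "sphere_measure :: (real ^ 'n) measure" .
  show ?thesis ..
qed

text \<open>The substitutions \<open>s = r * norm x\<close> and \<open>y = r *\<^sub>R x\<close>, with \<open>x\<close> in the unit ball, reduce the
  formula to \<open>\<integral> dr / \<bar>r\<bar> ^ (d + 1) = 2 / (d * norm y ^ d)\<close> over \<open>\<bar>r\<bar> \<ge> norm y\<close>.\<close>

lemma nn_integral_polar:
  fixes G :: "real ^ 'n \<Rightarrow> ennreal"
  assumes [measurable]: "G \<in> borel_measurable borel"
  shows "(\<integral>\<^sup>+\<omega>. (\<integral>\<^sup>+s. ennreal (\<bar>s\<bar> ^ (CARD('n) - 1)) * G (s *\<^sub>R \<omega>) \<partial>lborel) \<partial>sphere_measure)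
    = 2 * (\<integral>\<^sup>+y. G y \<partial>lborel)"
proof -
  obtain m where m: "CARD('n) = Suc m" by (metis Suc_pred' zero_less_card_finite)
  let ?I = "indicator (cball 0 1 - {0}) :: real ^ 'n \<Rightarrow> ennreal"
  let ?h = "\<lambda>x r. ennreal (norm x ^ Suc m * \<bar>r\<bar> ^ m) * G (r *\<^sub>R x) * ?I x"
  let ?k = "\<lambda>y r. ennreal (norm y ^ Suc m) * G y * (ennreal (1 / \<bar>r\<bar> ^ Suc (Suc m)) * indicator {s. 0 < norm y \<and> norm y \<le> \<bar>s\<bar>} r)"
  have [measurable]: "cball 0 1 - {0} \<in> sets (borel :: (real ^ 'n) measure)"
    by (intro sets.Diff) auto
  have "(\<integral>\<^sup>+\<omega>. (\<integral>\<^sup>+s. ennreal (\<bar>s\<bar> ^ m) * G (s *\<^sub>R \<omega>) \<partial>lborel) \<partial>sphere_measure)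
      = of_nat (Suc m) * (\<integral>\<^sup>+x. (\<integral>\<^sup>+s. ennreal (\<bar>s\<bar> ^ m) * G (s *\<^sub>R (x /\<^sub>R norm x)) \<partial>lborel) * ?I x \<partial>lborel)"
    by (subst nn_integral_sphere_measure) (auto simp: m intro!: measurable_restrict_space1)
  also have "\<dots> = of_nat (Suc m) * (\<integral>\<^sup>+x. (\<integral>\<^sup>+r. ?h x r \<partial>lborel) \<partial>lborel)"
  proof (intro arg_cong2[where f="(*)"] refl nn_integral_cong)
    fix x :: "real ^ 'n"
    show "(\<integral>\<^sup>+s. ennreal (\<bar>s\<bar> ^ m) * G (s *\<^sub>R (x /\<^sub>R norm x)) \<partial>lborel) * ?I x
        = (\<integral>\<^sup>+r. ?h x r \<partial>lborel)"
    proof (cases "x = 0")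
      case False
      then have "(\<integral>\<^sup>+s. ennreal (\<bar>s\<bar> ^ m) * G (s *\<^sub>R (x /\<^sub>R norm x)) \<partial>lborel)
          = ennreal (norm x) * (\<integral>\<^sup>+r. ennreal (\<bar>0 + norm x * r\<bar> ^ m) * G ((0 + norm x * r) *\<^sub>R (x /\<^sub>R norm x)) \<partial>lborel)"
        by (subst nn_integral_real_affine[of _ "norm x" 0]) auto
      also have "\<dots> = (\<integral>\<^sup>+r. ennreal (norm x) * (ennreal (\<bar>0 + norm x * r\<bar> ^ m) * G ((0 + norm x * r) *\<^sub>R (x /\<^sub>R norm x))) \<partial>lborel)"
        by (subst nn_integral_cmult) auto
      also have "\<dots> = (\<integral>\<^sup>+r. ennreal (norm x ^ Suc m * \<bar>r\<bar> ^ m) * G (r *\<^sub>R x) \<partial>lborel)"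
        using False by (intro nn_integral_cong)
          (simp add: abs_mult power_mult_distrib ennreal_mult'[symmetric] mult.assoc[symmetric] mult.commute[of _ "inverse (norm x)"])
      finally show ?thesis by (simp add: nn_integral_multc)
    qed simp
  qed
  also have "\<dots> = of_nat (Suc m) * (\<integral>\<^sup>+r. (\<integral>\<^sup>+x. ?h x r \<partial>lborel) \<partial>lborel)"
    by (subst lborel_pair.Fubini') auto
  also have "\<dots> = of_nat (Suc m) * (\<integral>\<^sup>+r. (\<integral>\<^sup>+y. ?k y r \<partial>lborel) \<partial>lborel)"
  proof (rule arg_cong2[where f="(*)", OF refl], rule nn_integral_cong_AE, rule eventually_mono[OF AE_lborel_singleton[of 0]])
    fix r :: real assume r: "r \<noteq> 0"
    have "(\<integral>\<^sup>+y. ?k y r \<partial>lborel)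
       = ennreal (\<bar>r\<bar> ^ DIM(real^'n)) * (\<integral>\<^sup>+x. ?k (0 + r *\<^sub>R x) r \<partial>lborel)"
      by (rule nn_integral_lborel_affine) (use r in auto)
    also have "\<dots> = (\<integral>\<^sup>+x. ennreal (\<bar>r\<bar> ^ Suc m) * (?k (r *\<^sub>R x) r) \<partial>lborel)"
      by (subst nn_integral_cmult) (auto simp: m)
    also have "\<dots> = (\<integral>\<^sup>+x. ?h x r \<partial>lborel)"
    proof (rule nn_integral_cong)
      fix x :: "real ^ 'n"
      have "indicator {s. 0 < norm (r *\<^sub>R x) \<and> norm (r *\<^sub>R x) \<le> \<bar>s\<bar>} r = ?I x"
        using r by (auto simp: indicator_def)
      moreover have "ennreal (\<bar>r\<bar> ^ Suc m) * ennreal (norm (r *\<^sub>R x) ^ Suc m) * ennreal (1 / \<bar>r\<bar> ^ Suc (Suc m)) = ennreal (norm x ^ Suc m * \<bar>r\<bar> ^ m)"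
        using r by (simp add: ennreal_mult'[symmetric] power_mult_distrib)
      moreover have "a * (b * g * (c * i)) = a * b * c * g * i" for a b c g i :: ennreal
        by (simp only: ac_simps)
      ultimately show "ennreal (\<bar>r\<bar> ^ Suc m) * (?k (r *\<^sub>R x) r)
          = ?h x r"
        by (simp only:)
    qed
    finally show "(\<integral>\<^sup>+x. ?h x r \<partial>lborel)
      = (\<integral>\<^sup>+y. ?k y r \<partial>lborel)" ..
  qed
  also have "\<dots> = of_nat (Suc m) * (\<integral>\<^sup>+y. (\<integral>\<^sup>+r. ?k y r \<partial>lborel) \<partial>lborel)"
    by (subst lborel_pair.Fubini') auto
  also have "\<dots> = (\<integral>\<^sup>+y. of_nat (Suc m) * (\<integral>\<^sup>+r. ?k y r \<partial>lborel) \<partial>lborel)"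
    by (subst nn_integral_cmult) auto
  also have "\<dots> = (\<integral>\<^sup>+y. 2 * G y \<partial>lborel)"
  proof (rule nn_integral_cong_AE, rule eventually_mono[OF AE_lborel_singleton[of 0]])
    fix y :: "real ^ 'n" assume y: "y \<noteq> 0"
    have "(\<integral>\<^sup>+r. ?k y r \<partial>lborel)
       = ennreal (norm y ^ Suc m) * G y * (\<integral>\<^sup>+r. ennreal (1 / \<bar>r\<bar> ^ Suc (Suc m)) * indicator {r. norm y \<le> \<bar>r\<bar>} r \<partial>lborel)"
      using y by (subst nn_integral_cmult) auto
    also have "\<dots> = ennreal (norm y ^ Suc m) * G y * ennreal (2 / (real (Suc m) * norm y ^ Suc m))"
      using y by (subst nn_integral_powr_outside) auto
    finally have "of_nat (Suc m) * (\<integral>\<^sup>+r. ?k y r \<partial>lborel)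
       = (ennreal (real (Suc m)) * ennreal (norm y ^ Suc m) * ennreal (2 / (real (Suc m) * norm y ^ Suc m))) * G y"
      by (simp only: ennreal_of_nat_eq_real_of_nat ac_simps)
    also have "ennreal (real (Suc m)) * ennreal (norm y ^ Suc m) * ennreal (2 / (real (Suc m) * norm y ^ Suc m)) = ennreal 2"
      using y by (simp only: ennreal_mult'[symmetric] of_nat_0_le_iff zero_le_power norm_ge_zero mult_nonneg_nonneg)
         (intro arg_cong[where f=ennreal], simp del: power_Suc of_nat_Suc)
    finally show "of_nat (Suc m) * (\<integral>\<^sup>+r. ?k y r \<partial>lborel) = 2 * G y"
      by simp
  qed
  also have "\<dots> = 2 * (\<integral>\<^sup>+y. G y \<partial>lborel)"
    by (subst nn_integral_cmult) auto
  finally show ?thesis by (simp add: m)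
qed

text \<open>The constant is the area of the unit sphere, \<open>d\<close> times the volume of the
  unit ball. The 2 on the left belongs to \<open>s\<close> running over both half-lines.\<close>

lemma nn_integral_radial:
  fixes h :: "real \<Rightarrow> ennreal"
  assumes [measurable]: "h \<in> borel_measurable borel"
  shows "2 * integral\<^sup>N lborel (\<lambda>y::real ^ 'n. h (norm y))
    = ennreal (real CARD('n) * unit_ball_vol (real CARD('n))) * (\<integral>\<^sup>+s. ennreal (\<bar>s\<bar> ^ (CARD('n) - 1)) * h \<bar>s\<bar> \<partial>lborel)"
proof -
  have area: "emeasure sphere_measure (sphere (0::real^'n) 1) = ennreal (real CARD('n) * unit_ball_vol (real CARD('n)))"
  proof -
    have "emeasure (sphere_measure :: (real ^ 'n) measure) (space sphere_measure) = integral\<^sup>N sphere_measure (\<lambda>\<omega>::real^'n. 1)" by simp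
    also have "\<dots> = of_nat CARD('n) * integral\<^sup>N lborel (\<lambda>x::real^'n. 1 * indicator (cball 0 1 - {0}) x)"
      by (rule nn_integral_sphere_measure) simp
    also have "integral\<^sup>N lborel (\<lambda>x::real^'n. 1 * indicator (cball 0 1 - {0}) x) = integral\<^sup>N lborel (indicator (cball (0::real^'n) 1))"
      by (rule nn_integral_cong_AE, rule eventually_mono[OF AE_lborel_singleton[of 0]]) (auto simp: indicator_def)
    finally show ?thesis
      by (simp add: emeasure_cball ennreal_of_nat_eq_real_of_nat ennreal_mult')
  qed
  have "2 * integral\<^sup>N lborel (\<lambda>y::real ^ 'n. h (norm y))
      = (\<integral>\<^sup>+\<omega>. (\<integral>\<^sup>+s. ennreal (\<bar>s\<bar> ^ (CARD('n) - 1)) * h (norm (s *\<^sub>R (\<omega>::real^'n))) \<partial>lborel) \<partial>sphere_measure)"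
    by (rule nn_integral_polar[symmetric]) simp
  also have "\<dots> = integral\<^sup>N sphere_measure (\<lambda>\<omega>::real^'n. \<integral>\<^sup>+s. ennreal (\<bar>s\<bar> ^ (CARD('n) - 1)) * h \<bar>s\<bar> \<partial>lborel)"
    by (rule nn_integral_cong) simp
  finally show ?thesis by (simp add: area mult.commute)
qed

text \<open>Since \<open>s\<close> ranges over the whole line, every nonzero point is reached twice,
  from \<open>(\<omega>, s)\<close> and from \<open>(- \<omega>, - s)\<close>; hence the factor 2.
  The formula for nonnegative functions says that the polar map sends the weighted product measure
  to twice Lebesgue measure, and an equality of measures carries over to integrals of vector-valued
  functions.\<close>

lemma sphere_lborel_integral:
  fixes G :: "real ^ 'n \<Rightarrow> 'b::{banach, second_countable_topology}"
  assumes G: "integrable lborel G"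
  shows "(\<integral>\<omega>. (\<integral>s. \<bar>s\<bar> ^ (CARD('n) - 1) *\<^sub>R G (s *\<^sub>R \<omega>) \<partial>lborel) \<partial>sphere_measure) = 2 *\<^sub>R (\<integral>y. G y \<partial>lborel)"
proof -
  interpret S: sigma_finite_measure "sphere_measure :: (real^'n) measure"
    by (rule sigma_finite_sphere_measure)
  interpret P: pair_sigma_finite "sphere_measure :: (real^'n) measure" "lborel :: real measure" ..
  let ?M = "sphere_measure \<Otimes>\<^sub>M lborel :: ((real^'n) \<times> real) measure"
  let ?D = "density ?M (\<lambda>z. ennreal (\<bar>snd z\<bar> ^ (CARD('n) - 1)))"
  let ?T = "\<lambda>z. snd z *\<^sub>R (fst z :: real^'n)"
  have [measurable]: "(\<lambda>\<omega>. \<omega>) \<in> (sphere_measure :: (real^'n) measure) \<rightarrow>\<^sub>M borel"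
    by (subst measurable_cong_sets[OF sets_sphere_measure refl]) (auto intro: measurable_restrict_space1)
  have [measurable]: "fst \<in> borel_measurable ?M"
    using measurable_compose[OF measurable_fst \<open>(\<lambda>\<omega>. \<omega>) \<in> sphere_measure \<rightarrow>\<^sub>M borel\<close>, of "lborel :: real measure"] by simp
  have [measurable]: "?T \<in> borel_measurable ?M" by measurable
  have [measurable]: "G \<in> borel_measurable borel" using G by auto
  have eq: "distr ?D borel ?T = density lborel (\<lambda>_. 2)"
  proof (rule measure_eqI)
    fix A assume "A \<in> sets (distr ?D borel ?T)"
    then have [measurable]: "A \<in> sets borel" by simp
    have "emeasure (distr ?D borel ?T) A = (\<integral>\<^sup>+z. indicator A z \<partial>distr ?D borel ?T)" by simp
    also have "\<dots> = (\<integral>\<^sup>+z. ennreal (\<bar>snd z\<bar> ^ (CARD('n) - 1)) * indicator A (?T z) \<partial>?M)"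
      by (subst nn_integral_distr, simp, simp, subst nn_integral_density) auto
    also have "\<dots> = (\<integral>\<^sup>+\<omega>. (\<integral>\<^sup>+s. ennreal (\<bar>s\<bar> ^ (CARD('n) - 1)) * indicator A (s *\<^sub>R \<omega>) \<partial>lborel) \<partial>sphere_measure)"
      by (subst lborel.nn_integral_fst[symmetric]) auto
    also have "\<dots> = 2 * (\<integral>\<^sup>+y. indicator A y \<partial>lborel)"
      by (rule nn_integral_polar) auto
    also have "\<dots> = emeasure (density lborel (\<lambda>_. 2)) A"
      by (simp add: emeasure_density nn_integral_cmult)
    finally show "emeasure (distr ?D borel ?T) A = emeasure (density lborel (\<lambda>_. 2)) A" .
  qed auto
  have two: "density lborel (\<lambda>_. 2) = density lborel (\<lambda>_::real^'n. ennreal 2)" by simp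
  have int: "integrable ?M (\<lambda>z. \<bar>snd z\<bar> ^ (CARD('n) - 1) *\<^sub>R G (?T z))"
  proof -
    have "integrable (density lborel (\<lambda>_. 2)) G"
      unfolding two by (subst integrable_density) (use G in auto)
    then have "integrable ?D (\<lambda>z. G (?T z))"
      unfolding eq[symmetric] by (subst (asm) integrable_distr_eq) auto
    then show ?thesis by (subst (asm) integrable_density) auto
  qed
  have "(\<integral>\<omega>. (\<integral>s. \<bar>s\<bar> ^ (CARD('n) - 1) *\<^sub>R G (s *\<^sub>R \<omega>) \<partial>lborel) \<partial>sphere_measure)
      = (\<integral>z. \<bar>snd z\<bar> ^ (CARD('n) - 1) *\<^sub>R G (?T z) \<partial>?M)"
    using P.integral_fst'[OF int] by simp
  also have "\<dots> = (\<integral>z. G (?T z) \<partial>?D)"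
    by (subst integral_density) auto
  also have "\<dots> = (\<integral>y. G y \<partial>density lborel (\<lambda>_. 2))"
    unfolding eq[symmetric] by (subst integral_distr) auto
  also have "\<dots> = 2 *\<^sub>R (\<integral>y. G y \<partial>lborel)"
    unfolding two by (subst integral_density) auto
  finally show ?thesis .
qed

section \<open>Approximate identities and Gaussians\<close>

text \<open>In rescaled form the kernel stays fixed and the point of evaluation moves, so
  \<open>norm (K z) * B\<close> dominates. Neither the sign of \<open>e n\<close> nor the mass of
  \<open>K\<close> is prescribed: it is applied with negative scales and with unnormalised
  Gaussians.\<close>

lemma approximate_identity:
  fixes K g :: "'a::euclidean_space \<Rightarrow> 'b::{real_normed_field, banach, second_countable_topology}"
  assumes K: "integrable lborel K" and [measurable]: "g \<in> borel_measurable borel"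
    and bound: "\<And>y. norm (g y) \<le> B" and cont: "isCont g x" and e: "e \<longlonglongrightarrow> 0"
  shows "(\<lambda>n. \<integral>z. K z * g (x + e n *\<^sub>R z) \<partial>lborel) \<longlonglongrightarrow> (\<integral>z. K z \<partial>lborel) * g x"
proof -
  have [measurable]: "K \<in> borel_measurable borel" using K by auto
  have "(\<lambda>n. \<integral>z. K z * g (x + e n *\<^sub>R z) \<partial>lborel) \<longlonglongrightarrow> (\<integral>z. K z * g x \<partial>lborel)"
  proof (rule integral_dominated_convergence[where w="\<lambda>z. norm (K z) * B"])
    show "integrable lborel (\<lambda>z. norm (K z) * B)" using K by (intro integrable_mult_left integrable_norm)
    have "(\<lambda>n. K z * g (x + e n *\<^sub>R z)) \<longlonglongrightarrow> K z * g x" for z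
    proof -
      have "(\<lambda>n. x + e n *\<^sub>R z) \<longlonglongrightarrow> x + 0 *\<^sub>R z" by (intro tendsto_intros e)
      then show ?thesis using cont by (intro tendsto_intros isCont_tendsto_compose[OF cont]) simp
    qed
    then show "AE z in lborel. (\<lambda>n. K z * g (x + e n *\<^sub>R z)) \<longlonglongrightarrow> K z * g x" by simp
    show "AE z in lborel. norm (K z * g (x + e n *\<^sub>R z)) \<le> norm (K z) * B" for n
      by (simp add: norm_mult mult_left_mono bound)
  qed measurable
  then show ?thesis by simp
qed

text \<open>Up to the factor \<open>sqrt (2 * pi)\<close> this is the characteristic function of the
  standard normal distribution.\<close>

lemma gaussian_fourier_real:
  "integrable lborel (\<lambda>x::real. exp (- x\<^sup>2 / 2))"
  "(\<integral>x. exp (\<i> * complex_of_real (t * x)) * complex_of_real (exp (- x\<^sup>2 / 2)) \<partial>lborel)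
    = complex_of_real (sqrt (2 * pi) * exp (- t\<^sup>2 / 2))"
proof -
  have eq: "exp (- x\<^sup>2 / 2) = sqrt (2 * pi) * std_normal_density x" for x :: real
    by (simp add: normal_density_def)
  show "integrable lborel (\<lambda>x::real. exp (- x\<^sup>2 / 2))"
    unfolding eq by (intro integrable_mult_right integrable_normal_density) auto
  have "complex_of_real (exp (- t\<^sup>2 / 2)) = (\<integral>x. iexp (t * x) \<partial>std_normal_distribution)"
    using char_std_normal_distribution unfolding char_def by metis
  also have "\<dots> = (\<integral>x. std_normal_density x *\<^sub>R iexp (t * x) \<partial>lborel)"
    by (subst integral_density) (auto simp: normal_density_nonneg)
  finally have 1: "complex_of_real (exp (- t\<^sup>2 / 2)) = (\<integral>x. std_normal_density x *\<^sub>R iexp (t * x) \<partial>lborel)" .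
  have "(\<integral>x. exp (\<i> * complex_of_real (t * x)) * complex_of_real (exp (- x\<^sup>2 / 2)) \<partial>lborel)
     = (\<integral>x. complex_of_real (sqrt (2 * pi)) * (std_normal_density x *\<^sub>R iexp (t * x)) \<partial>lborel)"
    unfolding eq by (intro Bochner_Integration.integral_cong refl) (simp add: scaleR_conv_of_real ac_simps)
  also have "\<dots> = complex_of_real (sqrt (2 * pi)) * complex_of_real (exp (- t\<^sup>2 / 2))"
    by (simp only: 1 integral_mult_right_zero)
  finally show "(\<integral>x. exp (\<i> * complex_of_real (t * x)) * complex_of_real (exp (- x\<^sup>2 / 2)) \<partial>lborel)
    = complex_of_real (sqrt (2 * pi) * exp (- t\<^sup>2 / 2))" by simp
qed

lemma lborel_integral_prod_Basis:
  fixes g :: "'a::euclidean_space \<Rightarrow> real \<Rightarrow> 'b::{real_normed_field, banach, second_countable_topology}"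
  assumes "\<And>b. b \<in> Basis \<Longrightarrow> integrable lborel (g b)"
  shows "integrable lborel (\<lambda>x::'a. \<Prod>b\<in>Basis. g b (x \<bullet> b))"
    and "(\<integral>x. (\<Prod>b\<in>Basis. g b (x \<bullet> b)) \<partial>(lborel :: 'a measure)) = (\<Prod>b\<in>Basis. \<integral>t. g b t \<partial>lborel)"
proof -
  interpret product_sigma_finite "\<lambda>_. lborel :: real measure" by standard
  have [measurable]: "g b \<in> borel_measurable borel" if "b \<in> Basis" for b
    using assms[OF that] by auto
  have eq: "(\<Prod>b\<in>Basis. g b ((\<Sum>a\<in>Basis. t a *\<^sub>R a) \<bullet> b)) = (\<Prod>b\<in>Basis. g b (t b))" for t :: "'a \<Rightarrow> real"
    by (intro prod.cong refl) simp
  show "integrable lborel (\<lambda>x::'a. \<Prod>b\<in>Basis. g b (x \<bullet> b))"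
    by (subst lborel_eq, subst integrable_distr_eq)
       (auto simp: eq intro!: product_integrable_prod assms)
  show "(\<integral>x. (\<Prod>b\<in>Basis. g b (x \<bullet> b)) \<partial>(lborel :: 'a measure)) = (\<Prod>b\<in>Basis. \<integral>t. g b t \<partial>lborel)"
    by (subst lborel_eq, subst integral_distr)
       (auto simp: eq intro!: product_integral_prod assms)
qed

lemma gaussian_fourier:
  fixes \<xi> :: "'a::euclidean_space"
  shows integrable_gaussian: "integrable lborel (\<lambda>x::'a. exp (- (norm x)\<^sup>2 / 2))"
    and "(\<integral>x. exp (\<i> * complex_of_real (x \<bullet> \<xi>)) * complex_of_real (exp (- (norm x)\<^sup>2 / 2)) \<partial>lborel)
      = complex_of_real ((2 * pi) powr (real DIM('a) / 2) * exp (- (norm \<xi>)\<^sup>2 / 2))"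
proof -
  have norm: "(norm x)\<^sup>2 = (\<Sum>b\<in>Basis. (x \<bullet> b)\<^sup>2)" for x :: 'a
    unfolding power2_norm_eq_inner by (subst euclidean_inner) (simp add: power2_eq_square)
  have ex: "exp (- (norm x)\<^sup>2 / 2) = (\<Prod>b\<in>Basis. exp (- (x \<bullet> b)\<^sup>2 / 2))" for x :: 'a
    unfolding norm by (simp add: exp_sum[symmetric] sum_negf sum_divide_distrib)
  show "integrable lborel (\<lambda>x::'a. exp (- (norm x)\<^sup>2 / 2))"
    unfolding ex by (rule lborel_integral_prod_Basis(1)[of "\<lambda>_ t. exp (- t\<^sup>2 / 2)"]) (rule gaussian_fourier_real)
  define g where "g b t = exp (\<i> * complex_of_real ((\<xi> \<bullet> b) * t)) * complex_of_real (exp (- t\<^sup>2 / 2))" for b :: 'a and t :: real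
  have g: "integrable lborel (g b)" for b
  proof (rule Bochner_Integration.integrable_bound[OF gaussian_fourier_real(1)])
    show "g b \<in> borel_measurable lborel" unfolding g_def by measurable
  qed (simp add: g_def norm_mult)
  have "exp (\<i> * complex_of_real (x \<bullet> \<xi>)) = (\<Prod>b\<in>Basis. exp (\<i> * complex_of_real ((\<xi> \<bullet> b) * (x \<bullet> b))))" for x
    unfolding euclidean_inner[of x \<xi>] by (simp add: exp_sum[symmetric] sum_distrib_left mult.commute)
  then have "(\<integral>x. exp (\<i> * complex_of_real (x \<bullet> \<xi>)) * complex_of_real (exp (- (norm x)\<^sup>2 / 2)) \<partial>lborel)
      = (\<integral>x. (\<Prod>b\<in>Basis. g b (x \<bullet> b)) \<partial>lborel)"
    unfolding ex by (simp add: g_def prod.distrib)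
  also have "\<dots> = (\<Prod>b\<in>Basis. \<integral>t. g b t \<partial>lborel)"
    by (rule lborel_integral_prod_Basis) (rule g)
  also have "\<dots> = (\<Prod>b\<in>Basis. complex_of_real (sqrt (2 * pi) * exp (- (\<xi> \<bullet> b)\<^sup>2 / 2)))"
    unfolding g_def by (intro prod.cong refl gaussian_fourier_real)
  also have "\<dots> = complex_of_real ((2 * pi) powr (real DIM('a) / 2) * exp (- (norm \<xi>)\<^sup>2 / 2))"
    unfolding ex of_real_prod[symmetric] prod.distrib
    by (simp add: powr_half_sqrt[symmetric] powr_realpow[symmetric] powr_powr)
  finally show "(\<integral>x. exp (\<i> * complex_of_real (x \<bullet> \<xi>)) * complex_of_real (exp (- (norm x)\<^sup>2 / 2)) \<partial>lborel)
      = complex_of_real ((2 * pi) powr (real DIM('a) / 2) * exp (- (norm \<xi>)\<^sup>2 / 2))" .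
qed

section \<open>The Fourier transform\<close>

lemma schwartz_integrable:
  fixes f :: "'a::euclidean_space \<Rightarrow> 'b::{real_normed_field, banach, second_countable_topology}"
  assumes "schwartz f"
  shows "integrable lborel f"
  using schwartz_integrable_shift[OF assms, of "\<lambda>x. x" lborel "\<lambda>_. 1" "DIM('a)"]
    integrable_weight[of "DIM('a)", where 'a='a] by simp

text \<open>\<open>s = -1\<close> gives the Fourier integral and \<open>s = 1\<close>, up to a constant factor, its inverse.\<close>

definition osc :: "real \<Rightarrow> ('a::euclidean_space \<Rightarrow> complex) \<Rightarrow> 'a \<Rightarrow> complex" where
  "osc s f \<xi> = (\<integral>x. exp (\<i> * complex_of_real (s * (x \<bullet> \<xi>))) * f x \<partial>lborel)"

lemma fourier_integral_osc: "fourier_integral f = osc (-1) f"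
  unfolding fourier_integral_def osc_def by (intro ext) simp

lemma integrable_osc:
  fixes f :: "'a::euclidean_space \<Rightarrow> complex"
  assumes "integrable lborel f"
  shows "integrable lborel (\<lambda>x. exp (\<i> * complex_of_real (s * (x \<bullet> \<xi>))) * f x)"
proof (rule Bochner_Integration.integrable_bound[OF assms])
  have [measurable]: "f \<in> borel_measurable borel" using assms by auto
  show "(\<lambda>x. exp (\<i> * complex_of_real (s * (x \<bullet> \<xi>))) * f x) \<in> borel_measurable lborel" by measurable
qed (simp add: norm_mult)

lemma norm_osc_le: "norm (osc s f \<xi>) \<le> (\<integral>x. norm (f x) \<partial>lborel)"
proof -
  have "norm (osc s f \<xi>) \<le> (\<integral>x. norm (exp (\<i> * complex_of_real (s * (x \<bullet> \<xi>))) * f x) \<partial>lborel)"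
    unfolding osc_def by (rule integral_norm_bound)
  then show ?thesis by (simp add: norm_mult)
qed

lemma borel_measurable_osc [measurable]:
  fixes f :: "'a::euclidean_space \<Rightarrow> complex"
  assumes [measurable]: "f \<in> borel_measurable borel"
  shows "osc s f \<in> borel_measurable borel"
  unfolding osc_def[abs_def] by measurable

lemma integrable_mult_bounded:
  fixes f g :: "'a::euclidean_space \<Rightarrow> complex"
  assumes "integrable lborel f" "g \<in> borel_measurable borel" "\<And>x. norm (g x) \<le> B"
  shows "integrable lborel (\<lambda>x. f x * g x)" "integrable lborel (\<lambda>x. g x * f x)"
proof -
  have [measurable]: "f \<in> borel_measurable borel" using assms(1) by auto
  show "integrable lborel (\<lambda>x. f x * g x)"
  proof (rule Bochner_Integration.integrable_bound[OF integrable_mult_left[OF integrable_norm[OF assms(1)], of B]])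
    have "0 \<le> B" using assms(3) norm_ge_zero order_trans by blast
    then show "AE x in lborel. norm (f x * g x) \<le> norm (norm (f x) * B)"
      by (simp add: norm_mult mult_left_mono assms(3))
  qed (use assms(2) in measurable)
  then show "integrable lborel (\<lambda>x. g x * f x)" by (simp add: mult.commute)
qed

text \<open>The multiplication formula: the exponential is symmetric in \<open>x\<close> and \<xi>,
  so Fubini moves the transform from one factor to the other.\<close>

lemma osc_swap:
  fixes v w :: "'a::euclidean_space \<Rightarrow> complex"
  assumes v: "integrable lborel v" and w: "integrable lborel w"
  shows "(\<integral>x. osc s v x * w x \<partial>lborel) = (\<integral>\<xi>. v \<xi> * osc s w \<xi> \<partial>lborel)"
proof -
  let ?e = "\<lambda>x \<xi> :: 'a. exp (\<i> * complex_of_real (s * (x \<bullet> \<xi>)))"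
  have [measurable]: "v \<in> borel_measurable borel" "w \<in> borel_measurable borel" using v w by auto
  have "integrable (lborel \<Otimes>\<^sub>M lborel) (\<lambda>(x, \<xi>). ?e x \<xi> * v \<xi> * w x)"
  proof (rule lborel_pair.Fubini_integrable)
    show "integrable lborel (\<lambda>x. \<integral>\<xi>. norm (case (x, \<xi>) of (x, \<xi>) \<Rightarrow> ?e x \<xi> * v \<xi> * w x) \<partial>lborel)"
      using w by (simp add: norm_mult)
    show "AE x in lborel. integrable lborel (\<lambda>\<xi>. case (x, \<xi>) of (x, \<xi>) \<Rightarrow> ?e x \<xi> * v \<xi> * w x)"
      using integrable_osc[OF v] by (auto simp: inner_commute)
  qed measurable
  from lborel_pair.Fubini_integral[OF this]
  have "(\<integral>\<xi>. (\<integral>x. ?e x \<xi> * v \<xi> * w x \<partial>lborel) \<partial>lborel) = (\<integral>x. (\<integral>\<xi>. ?e x \<xi> * v \<xi> * w x \<partial>lborel) \<partial>lborel)" .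
  moreover have "(\<integral>x. ?e x \<xi> * v \<xi> * w x \<partial>lborel) = v \<xi> * osc s w \<xi>" for \<xi>
    unfolding osc_def by (subst integral_mult_right_zero[symmetric]) (simp add: ac_simps)
  moreover have "(\<integral>\<xi>. ?e x \<xi> * v \<xi> * w x \<partial>lborel) = osc s v x * w x" for x
    unfolding osc_def by (subst integral_mult_left_zero[symmetric]) (simp add: inner_commute)
  ultimately show ?thesis by (simp only:)
qed

text \<open>By translation invariance the transform of a translate of \<open>f\<close> is the
  transform of \<open>f\<close> times an exponential in \<open>t\<close>. Both forms are
  differentiated at \<open>t = 0\<close>, once under the integral sign and once explicitly.\<close>

lemma fourier_integral_partial_deriv:
  fixes f :: "'a::euclidean_space \<Rightarrow> complex"
  assumes f: "schwartz f"
  shows "fourier_integral (partial_deriv v f) \<xi> = \<i> * complex_of_real (v \<bullet> \<xi>) * fourier_integral f \<xi>"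
proof -
  let ?e = "\<lambda>x. exp (\<i> * complex_of_real ((-1) * (x \<bullet> \<xi>)))"
  have [measurable]: "f \<in> borel_measurable borel" using f by (rule schwartz_measurable)
  have 1: "((\<lambda>t. \<integral>y. ?e y * f (y + t *\<^sub>R v) \<partial>lborel) has_vector_derivative
      (\<integral>y. ?e y * partial_deriv v f y \<partial>lborel)) (at 0)"
    by (rule schwartz_derivative_shift[OF f, of "\<lambda>y. y" lborel ?e "DIM('a)"])
       (use integrable_weight[of "DIM('a)", where 'a='a] in auto)
  have "(\<integral>y. ?e y * f (y + t *\<^sub>R v) \<partial>lborel) = exp (t *\<^sub>R (\<i> * complex_of_real (v \<bullet> \<xi>))) * fourier_integral f \<xi>" for t
  proof -
    have "(\<integral>y. ?e (y - t *\<^sub>R v) * f y \<partial>lborel) = (\<integral>y. ?e y * f (y + t *\<^sub>R v) \<partial>lborel)"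
      by (subst lborel_integral_affine[of _ 1 "t *\<^sub>R v"]) (auto simp: add.commute)
    moreover have "?e (y - t *\<^sub>R v) = exp (t *\<^sub>R (\<i> * complex_of_real (v \<bullet> \<xi>))) * ?e y" for y
      by (simp add: exp_add[symmetric] inner_diff_left algebra_simps scaleR_conv_of_real)
    ultimately show ?thesis by (simp add: fourier_integral_osc osc_def mult.assoc)
  qed
  moreover have "((\<lambda>t. exp (t *\<^sub>R (\<i> * complex_of_real (v \<bullet> \<xi>))) * fourier_integral f \<xi>) has_vector_derivative
      (exp (0 *\<^sub>R (\<i> * complex_of_real (v \<bullet> \<xi>))) * (\<i> * complex_of_real (v \<bullet> \<xi>))) * fourier_integral f \<xi>) (at 0)"
    by (rule has_vector_derivative_mult_left, rule exp_scaleR_has_vector_derivative_right)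
  ultimately have "((\<lambda>t. \<integral>y. ?e y * f (y + t *\<^sub>R v) \<partial>lborel) has_vector_derivative
      \<i> * complex_of_real (v \<bullet> \<xi>) * fourier_integral f \<xi>) (at 0)" by simp
  from vector_derivative_unique_at[OF 1 this] show ?thesis
    by (simp add: fourier_integral_osc osc_def)
qed

text \<open>\<open>1 + (norm \<xi>)\<^sup>2\<close> is the symbol of the identity minus the
  Laplacian, which is applied once per induction step. With the trivial bound on transforms of
  integrable functions it yields decay of every polynomial order.\<close>

lemma fourier_integral_power:
  fixes f :: "'a::euclidean_space \<Rightarrow> complex"
  assumes "schwartz f"
  shows "\<exists>g. schwartz g \<and> (\<forall>\<xi>. fourier_integral g \<xi> = (1 + (norm \<xi>)\<^sup>2) ^ N * fourier_integral f \<xi>)"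
proof (induction N)
  case 0
  then show ?case using assms by auto
next
  case (Suc N)
  then obtain g where g: "schwartz g"
    and eq: "\<And>\<xi>. fourier_integral g \<xi> = (1 + (norm \<xi>)\<^sup>2) ^ N * fourier_integral f \<xi>" by auto
  let ?L = "\<lambda>x. \<Sum>b\<in>Basis. partial_deriv b (partial_deriv b g) x"
  have L: "schwartz ?L" by (intro schwartz_sum schwartz_partial_deriv g) auto
  have "fourier_integral (\<lambda>x. g x - ?L x) \<xi> = (1 + (norm \<xi>)\<^sup>2) ^ Suc N * fourier_integral f \<xi>" for \<xi>
  proof -
    let ?e = "\<lambda>x. exp (\<i> * complex_of_real ((-1) * (x \<bullet> \<xi>)))"
    have int: "integrable lborel (\<lambda>x. ?e x * h x)" if "schwartz h" for h
      using integrable_osc[OF schwartz_integrable[OF that]] .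
    have "fourier_integral (\<lambda>x. g x - ?L x) \<xi>
       = (\<integral>x. ?e x * g x - (\<Sum>b\<in>Basis. ?e x * partial_deriv b (partial_deriv b g) x) \<partial>lborel)"
      by (simp add: fourier_integral_osc osc_def right_diff_distrib sum_distrib_left)
    also have "\<dots> = fourier_integral g \<xi> - (\<Sum>b\<in>Basis. fourier_integral (partial_deriv b (partial_deriv b g)) \<xi>)"
      by (subst Bochner_Integration.integral_diff, rule int[OF g], rule Bochner_Integration.integrable_sum,
          intro int schwartz_partial_deriv g, subst Bochner_Integration.integral_sum,
          intro int schwartz_partial_deriv g)
         (simp add: fourier_integral_osc osc_def)
    also have "(\<Sum>b\<in>Basis. fourier_integral (partial_deriv b (partial_deriv b g)) \<xi>)
        = (\<Sum>b\<in>Basis. - complex_of_real ((\<xi> \<bullet> b) * (\<xi> \<bullet> b)) * fourier_integral g \<xi>)"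
      by (intro sum.cong refl)
         (simp add: fourier_integral_partial_deriv schwartz_partial_deriv g inner_commute algebra_simps)
    also have "\<dots> = - complex_of_real ((norm \<xi>)\<^sup>2) * fourier_integral g \<xi>"
      unfolding power2_norm_eq_inner
      by (subst (3) euclidean_inner) (simp add: sum_distrib_right sum_negf)
    finally show ?thesis by (simp add: eq algebra_simps)
  qed
  then show ?case using schwartz_diff[OF g L] by blast
qed

lemma fourier_integral_schwartz_bound:
  fixes f :: "'a::euclidean_space \<Rightarrow> complex"
  assumes "schwartz f"
  obtains C where "C > 0" "\<And>\<xi>. norm (fourier_integral f \<xi>) \<le> C / (1 + (norm \<xi>)\<^sup>2) ^ N"
proof -
  obtain g where g: "schwartz g" "\<And>\<xi>. fourier_integral g \<xi> = (1 + (norm \<xi>)\<^sup>2) ^ N * fourier_integral f \<xi>"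
    using fourier_integral_power[OF assms] by metis
  let ?C = "(\<integral>x. norm (g x) \<partial>lborel) + 1"
  have "norm (fourier_integral f \<xi>) \<le> ?C / (1 + (norm \<xi>)\<^sup>2) ^ N" for \<xi>
  proof -
    have "norm (complex_of_real ((1 + (norm \<xi>)\<^sup>2) ^ N) * fourier_integral f \<xi>) \<le> ?C"
      using norm_osc_le[of "-1" g \<xi>] g(2)[of \<xi>] by (simp add: fourier_integral_osc)
    then have "(1 + (norm \<xi>)\<^sup>2) ^ N * norm (fourier_integral f \<xi>) \<le> ?C"
      by (simp only: norm_mult norm_of_real) simp
    then show ?thesis by (simp add: pos_le_divide_eq mult.commute)
  qed
  moreover have "?C > 0" by (intro add_nonneg_pos Bochner_Integration.integral_nonneg) auto
  ultimately show ?thesis using that by blast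
qed

lemma integrable_fourier_integral_schwartz:
  fixes f :: "'a::euclidean_space \<Rightarrow> complex"
  assumes "schwartz f"
  shows "integrable lborel (fourier_integral f)"
proof -
  obtain C where C: "C > 0" "\<And>\<xi>. norm (fourier_integral f \<xi>) \<le> C / (1 + (norm \<xi>)\<^sup>2) ^ DIM('a)"
    using fourier_integral_schwartz_bound[OF assms] by metis
  have [measurable]: "f \<in> borel_measurable borel" using assms by (rule schwartz_measurable)
  show ?thesis
  proof (rule Bochner_Integration.integrable_bound[OF integrable_mult_right[OF integrable_weight[of "DIM('a)", where 'a='a], of C]])
    show "AE x in lborel. norm (fourier_integral f x) \<le> norm (C * (1 / (1 + (norm x)\<^sup>2) ^ DIM('a)))"
      using C by (auto intro: order_trans[OF _ abs_ge_self])
  qed (auto simp: fourier_integral_osc)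
qed

section \<open>Fourier inversion by Gaussian summation\<close>

lemma osc_gaussian:
  fixes y :: "'a::euclidean_space"
  assumes "e > 0"
  shows "osc s (\<lambda>\<xi>. complex_of_real (exp (- (norm (e *\<^sub>R \<xi>))\<^sup>2 / 2))) y
    = complex_of_real ((2 * pi) powr (real DIM('a) / 2) / e ^ DIM('a) * exp (- (norm ((s / e) *\<^sub>R y))\<^sup>2 / 2))"
proof -
  have "complex_of_real ((2 * pi) powr (real DIM('a) / 2) * exp (- (norm ((s / e) *\<^sub>R y))\<^sup>2 / 2))
    = (\<integral>\<eta>. exp (\<i> * complex_of_real (\<eta> \<bullet> ((s / e) *\<^sub>R y))) * complex_of_real (exp (- (norm \<eta>)\<^sup>2 / 2)) \<partial>lborel)"
    by (rule gaussian_fourier(2)[symmetric])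
  also have "\<dots> = e ^ DIM('a) *\<^sub>R osc s (\<lambda>\<xi>. complex_of_real (exp (- (norm (e *\<^sub>R \<xi>))\<^sup>2 / 2))) y"
    using assms by (subst lborel_integral_affine[of _ e 0]) (auto simp: osc_def)
  finally show ?thesis
    using assms by (simp add: scaleR_conv_of_real field_simps)
qed

lemma integral_gaussian:
  "(\<integral>x. exp (- (norm x)\<^sup>2 / 2) \<partial>(lborel :: 'a::euclidean_space measure)) = (2 * pi) powr (real DIM('a) / 2)"
proof -
  have "complex_of_real (\<integral>x. exp (- (norm x)\<^sup>2 / 2) \<partial>(lborel :: 'a measure)) = complex_of_real ((2 * pi) powr (real DIM('a) / 2))"
    using gaussian_fourier(2)[of "0::'a"] by simp
  then show ?thesis by (simp only: of_real_eq_iff)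
qed

text \<open>The iterated integral is not absolutely convergent as a double integral, so a Gaussian
  cutoff in \<xi> is inserted first. The multiplication formula moves the transform onto the cutoff,
  where it becomes an approximate identity centred at \<open>x\<close>. One factor
  \<open>(2 * pi) powr (d / 2)\<close> comes from the transform of the Gaussian, the other from its
  mass.\<close>

lemma fourier_inversion:
  fixes f :: "'a::euclidean_space \<Rightarrow> complex"
  assumes f: "schwartz f"
  shows "osc 1 (fourier_integral f) x = complex_of_real ((2 * pi) powr real DIM('a)) * f x"
proof -
  define e where "e n = 1 / real (Suc n)" for n
  have e: "e n > 0" for n by (simp add: e_def)
  have e0: "e \<longlonglongrightarrow> 0" unfolding e_def using LIMSEQ_inverse_real_of_nat by (simp add: inverse_eq_divide)
  let ?g = "\<lambda>x::'a. complex_of_real (exp (- (norm x)\<^sup>2 / 2))"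
  let ?h = "\<lambda>\<xi>. exp (\<i> * complex_of_real (1 * (\<xi> \<bullet> x)))"
  have g: "integrable lborel ?g" by (intro integrable_of_real integrable_gaussian)
  have [measurable]: "f \<in> borel_measurable borel" using f by (rule schwartz_measurable)
  have [measurable]: "fourier_integral f \<in> borel_measurable borel" by (simp add: fourier_integral_osc)
  have fi: "integrable lborel f" using f by (rule schwartz_integrable)
  note hi = integrable_fourier_integral_schwartz[OF f]
  have "(\<lambda>n. \<integral>\<xi>. ?h \<xi> * fourier_integral f \<xi> * ?g (e n *\<^sub>R \<xi>) \<partial>lborel) \<longlonglongrightarrow> (\<integral>\<xi>. ?h \<xi> * fourier_integral f \<xi> \<partial>lborel)"
  proof (rule integral_dominated_convergence[where w="\<lambda>\<xi>. norm (fourier_integral f \<xi>)"])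
    have "(\<lambda>n. ?h \<xi> * fourier_integral f \<xi> * ?g (e n *\<^sub>R \<xi>)) \<longlonglongrightarrow> ?h \<xi> * fourier_integral f \<xi> * ?g (0 *\<^sub>R \<xi>)" for \<xi>
      by (intro tendsto_intros e0) simp_all
    then show "AE \<xi> in lborel. (\<lambda>n. ?h \<xi> * fourier_integral f \<xi> * ?g (e n *\<^sub>R \<xi>)) \<longlonglongrightarrow> ?h \<xi> * fourier_integral f \<xi>" by simp
    show "AE \<xi> in lborel. norm (?h \<xi> * fourier_integral f \<xi> * ?g (e n *\<^sub>R \<xi>)) \<le> norm (fourier_integral f \<xi>)" for n
      by (auto simp: norm_mult intro!: mult_left_le)
  qed (use hi in auto)
  moreover have "(\<integral>\<xi>. ?h \<xi> * fourier_integral f \<xi> * ?g (e n *\<^sub>R \<xi>) \<partial>lborel)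
      = complex_of_real ((2 * pi) powr (real DIM('a) / 2)) * (\<integral>z. ?g z * f (x + e n *\<^sub>R z) \<partial>lborel)" for n
  proof -
    let ?w = "\<lambda>\<xi>. ?h \<xi> * ?g (e n *\<^sub>R \<xi>)"
    have ge: "integrable lborel (\<lambda>\<xi>. ?g (e n *\<^sub>R \<xi>))"
      using lborel_integrable_affine[OF g, of "e n" 0] e[of n] by simp
    have w: "integrable lborel ?w"
      using integrable_osc[OF ge] .
    have "(\<integral>\<xi>. ?h \<xi> * fourier_integral f \<xi> * ?g (e n *\<^sub>R \<xi>) \<partial>lborel) = (\<integral>\<xi>. osc (-1) f \<xi> * ?w \<xi> \<partial>lborel)"
      by (simp add: fourier_integral_osc ac_simps)
    also have "\<dots> = (\<integral>y. f y * osc (-1) ?w y \<partial>lborel)"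
      by (rule osc_swap[OF fi w])
    also have "\<dots> = (\<integral>y. f y * osc 1 (\<lambda>\<xi>. ?g (e n *\<^sub>R \<xi>)) (x - y) \<partial>lborel)"
    proof -
      have "osc (-1) ?w y = osc 1 (\<lambda>\<xi>. ?g (e n *\<^sub>R \<xi>)) (x - y)" for y
        unfolding osc_def
        by (intro Bochner_Integration.integral_cong refl)
           (simp add: mult.assoc[symmetric] exp_add[symmetric] inner_diff_right inner_diff_left algebra_simps)
      then show ?thesis by simp
    qed
    also have "\<dots> = (\<integral>y. f y * complex_of_real ((2 * pi) powr (real DIM('a) / 2) / e n ^ DIM('a) * exp (- (norm ((1 / e n) *\<^sub>R (x - y)))\<^sup>2 / 2)) \<partial>lborel)"
      by (simp only: osc_gaussian[OF e])
    also have "\<dots> = e n ^ DIM('a) *\<^sub>R (\<integral>z. f (x + e n *\<^sub>R z) * complex_of_real ((2 * pi) powr (real DIM('a) / 2) / e n ^ DIM('a) * exp (- (norm ((1 / e n) *\<^sub>R (x - (x + e n *\<^sub>R z))))\<^sup>2 / 2)) \<partial>lborel)"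
      using e[of n] by (subst lborel_integral_affine[of _ "e n" x]) auto
    also have "\<dots> = (\<integral>z. complex_of_real ((2 * pi) powr (real DIM('a) / 2)) * (?g z * f (x + e n *\<^sub>R z)) \<partial>lborel)"
      using e[of n] by (subst integral_scaleR_right[symmetric])
        (intro Bochner_Integration.integral_cong refl, simp add: scaleR_conv_of_real field_simps)
    finally show ?thesis by simp
  qed
  ultimately have 1: "(\<lambda>n. complex_of_real ((2 * pi) powr (real DIM('a) / 2)) * (\<integral>z. ?g z * f (x + e n *\<^sub>R z) \<partial>lborel))
      \<longlonglongrightarrow> (\<integral>\<xi>. ?h \<xi> * fourier_integral f \<xi> \<partial>lborel)" by simp
  obtain B where B: "\<And>y. norm (f y) * (1 + (norm y)\<^sup>2) ^ 0 \<le> B" using schwartz_bound[OF f] by metis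
  have "(\<lambda>n. \<integral>z. ?g z * f (x + e n *\<^sub>R z) \<partial>lborel) \<longlonglongrightarrow> (\<integral>z. ?g z \<partial>lborel) * f x"
  proof (rule approximate_identity[OF g])
    show "isCont f x" using schwartz_continuous_on[OF f, of UNIV] by (simp add: continuous_on_eq_continuous_at)
    show "norm (f y) \<le> B" for y using B[of y] by simp
  qed (auto simp: e0)
  then have "(\<lambda>n. complex_of_real ((2 * pi) powr (real DIM('a) / 2)) * (\<integral>z. ?g z * f (x + e n *\<^sub>R z) \<partial>lborel))
      \<longlonglongrightarrow> complex_of_real ((2 * pi) powr (real DIM('a) / 2)) * ((\<integral>z. ?g z \<partial>lborel) * f x)"
    by (rule tendsto_mult_left)
  from LIMSEQ_unique[OF 1 this]
  have "osc 1 (fourier_integral f) x = complex_of_real ((2 * pi) powr (real DIM('a) / 2)) * ((\<integral>z. ?g z \<partial>lborel) * f x)"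
    unfolding osc_def .
  also have "(\<integral>z. ?g z \<partial>lborel) = complex_of_real ((2 * pi) powr (real DIM('a) / 2))"
    unfolding integral_complex_of_real integral_gaussian ..
  finally show ?thesis
    by (simp add: mult.assoc[symmetric] powr_add[symmetric] flip: of_real_mult)
qed

lemma is_fourier_transform_integrable:
  assumes f: "integrable lborel f"
  shows "is_fourier_transform f (fourier_integral f)"
  unfolding is_fourier_transform_def
proof (intro allI impI conjI)
  fix \<phi> :: "'a \<Rightarrow> complex" assume \<phi>: "schwartz \<phi>"
  have [measurable]: "f \<in> borel_measurable borel" "\<phi> \<in> borel_measurable borel"
    using f schwartz_measurable[OF \<phi>] by auto
  note i = schwartz_integrable[OF \<phi>]
  show "integrable lborel (\<lambda>x. f x * fourier_integral \<phi> x)"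
    unfolding fourier_integral_osc by (rule integrable_mult_bounded[OF f _ norm_osc_le]) auto
  show "integrable lborel (\<lambda>\<xi>. fourier_integral f \<xi> * \<phi> \<xi>)"
    unfolding fourier_integral_osc by (rule integrable_mult_bounded[OF i _ norm_osc_le]) auto
  show "(\<integral>x. f x * fourier_integral \<phi> x \<partial>lborel) = (\<integral>\<xi>. fourier_integral f \<xi> * \<phi> \<xi> \<partial>lborel)"
    unfolding fourier_integral_osc by (rule osc_swap[OF f i, symmetric])
qed

text \<open>\<open>osc 1 v\<close> need not be integrable, so its transform is obtained by duality:
  the multiplication formula moves \<open>osc 1\<close> to the transformed test function, where
  Fourier inversion undoes it. Backprojected data have this form.\<close>

lemma is_fourier_transform_osc:
  fixes v :: "'a::euclidean_space \<Rightarrow> complex"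
  assumes v: "integrable lborel v"
  shows "is_fourier_transform (osc 1 v) (\<lambda>\<xi>. complex_of_real ((2 * pi) powr real DIM('a)) * v \<xi>)"
  unfolding is_fourier_transform_def
proof (intro allI impI conjI)
  fix \<phi> :: "'a \<Rightarrow> complex" assume \<phi>: "schwartz \<phi>"
  have [measurable]: "v \<in> borel_measurable borel" "\<phi> \<in> borel_measurable borel"
    using v schwartz_measurable[OF \<phi>] by auto
  note i = integrable_fourier_integral_schwartz[OF \<phi>]
  obtain B where B: "\<And>y. norm (\<phi> y) * (1 + (norm y)\<^sup>2) ^ 0 \<le> B" using schwartz_bound[OF \<phi>] by metis
  show "integrable lborel (\<lambda>x. osc 1 v x * fourier_integral \<phi> x)"
    by (rule integrable_mult_bounded[OF i _ norm_osc_le]) auto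
  show "integrable lborel (\<lambda>\<xi>. complex_of_real ((2 * pi) powr real DIM('a)) * v \<xi> * \<phi> \<xi>)"
    unfolding mult.assoc by (intro integrable_mult_right integrable_mult_bounded[OF v, of _ B]) (use B in auto)
  show "(\<integral>x. osc 1 v x * fourier_integral \<phi> x \<partial>lborel) = (\<integral>\<xi>. complex_of_real ((2 * pi) powr real DIM('a)) * v \<xi> * \<phi> \<xi> \<partial>lborel)"
    unfolding osc_swap[OF v i] fourier_inversion[OF \<phi>] by (simp add: ac_simps)
qed

section \<open>Uniqueness of Fourier transforms\<close>

lemma real_polynomial_function_bound:
  "real_polynomial_function p \<Longrightarrow> \<exists>C k. \<forall>x. \<bar>p x\<bar> \<le> C * (1 + norm x) ^ k"
proof (induction rule: real_polynomial_function.induct)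
  case (linear f)
  then obtain K where K: "\<And>x. norm (f x) \<le> norm x * K" "K > 0" using bounded_linear.pos_bounded by blast
  have "\<bar>f x\<bar> \<le> K * (1 + norm x) ^ 1" for x
    using K(1)[of x] K(2) by (simp add: algebra_simps)
  then show ?case by blast
next
  case (const c)
  have "\<bar>c\<bar> \<le> \<bar>c\<bar> * (1 + norm x) ^ 0" for x :: 'a by simp
  then show ?case by blast
next
  case (add f g)
  then obtain C k D l where *: "\<And>x. \<bar>f x\<bar> \<le> C * (1 + norm x) ^ k" "\<And>x. \<bar>g x\<bar> \<le> D * (1 + norm x) ^ l" by auto
  have "\<bar>f x + g x\<bar> \<le> (\<bar>C\<bar> + \<bar>D\<bar>) * (1 + norm x) ^ (k + l)" for x
  proof -
    have "\<bar>f x\<bar> \<le> \<bar>C\<bar> * (1 + norm x) ^ (k + l)"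
      by (intro order_trans[OF *(1)] mult_mono power_increasing) auto
    moreover have "\<bar>g x\<bar> \<le> \<bar>D\<bar> * (1 + norm x) ^ (k + l)"
      by (intro order_trans[OF *(2)] mult_mono power_increasing) auto
    ultimately show ?thesis by (simp add: algebra_simps)
  qed
  then show ?case by blast
next
  case (mult f g)
  then obtain C k D l where *: "\<And>x. \<bar>f x\<bar> \<le> C * (1 + norm x) ^ k" "\<And>x. \<bar>g x\<bar> \<le> D * (1 + norm x) ^ l" by auto
  have "\<bar>f x * g x\<bar> \<le> (C * D) * (1 + norm x) ^ (k + l)" for x
  proof -
    have "\<bar>f x * g x\<bar> \<le> (C * (1 + norm x) ^ k) * (D * (1 + norm x) ^ l)"
      unfolding abs_mult by (intro mult_mono * order_trans[OF abs_ge_zero *(1)]) auto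
    then show ?thesis by (simp add: power_add ac_simps)
  qed
  then show ?case by blast
qed

lemma real_polynomial_function_partial_deriv:
  fixes p :: "'a::euclidean_space \<Rightarrow> real"
  assumes "real_polynomial_function p"
  shows "real_polynomial_function (partial_deriv b p)"
  using assms
proof (induction rule: real_polynomial_function.induct)
  case (linear f)
  then have "partial_deriv b f = (\<lambda>x. f b)"
    by (intro ext partial_deriv_eq) (rule bounded_linear_imp_has_derivative)
  then show ?case by auto
next
  case (const c)
  have "partial_deriv b (\<lambda>x. c) = (\<lambda>x. 0)"
    by (intro ext) (simp add: partial_deriv_def)
  then show ?case by auto
next
  case (add f g)
  then have "f differentiable_on UNIV" "g differentiable_on UNIV"
    by (auto simp: differentiable_on_def intro: differentiable_at_real_polynomial_function)
  from partial_deriv_add[OF this, of b] show ?case using add by auto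
next
  case (mult f g)
  then have d: "f differentiable_on UNIV" "g differentiable_on UNIV"
    by (auto simp: differentiable_on_def intro: differentiable_at_real_polynomial_function)
  have "partial_deriv b (\<lambda>x. f x * g x) = (\<lambda>x. f x * partial_deriv b g x + partial_deriv b f x * g x)"
  proof
    fix x
    obtain D E where D: "(f has_derivative D) (at x)" and E: "(g has_derivative E) (at x)"
      using d differentiable_onD by metis
    show "partial_deriv b (\<lambda>x. f x * g x) x = f x * partial_deriv b g x + partial_deriv b f x * g x"
      using partial_deriv_eq[OF has_derivative_mult[OF D E]] partial_deriv_eq[OF D] partial_deriv_eq[OF E] by simp
  qed
  then show ?case using mult by auto
qed

lemma power_mult_gaussian_bounded:
  "\<exists>C. \<forall>r\<ge>0. (1 + r) ^ k * exp (- r\<^sup>2 / 2) \<le> (C :: real)"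
proof -
  have "(1 + r) ^ k * exp (- r\<^sup>2 / 2) \<le> real (Suc k) ^ Suc k * exp 2" if r: "r \<ge> 0" for r :: real
  proof -
    \<comment> \<open>Raising the exponent to \<open>Suc k\<close> keeps the divisor used next
      nonzero for \<open>k = 0\<close>. The power is then absorbed by
      \<open>y \<le> 1 + y \<le> exp y\<close>.\<close>
    have "(1 + r) ^ k \<le> (1 + r) ^ Suc k" using r by (intro power_increasing) auto
    also have "(1 + r) ^ Suc k = real (Suc k) ^ Suc k * ((1 + r) / real (Suc k)) ^ Suc k"
      by (simp add: power_divide del: power_Suc of_nat_Suc)
    also have "\<dots> \<le> real (Suc k) ^ Suc k * exp ((1 + r) / real (Suc k)) ^ Suc k"
      using r exp_ge_add_one_self[of "(1 + r) / real (Suc k)"]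
      by (intro mult_left_mono power_mono order_trans[OF _ exp_ge_add_one_self]) auto
    also have "exp ((1 + r) / real (Suc k)) ^ Suc k = exp (1 + r)"
      by (simp only: exp_of_nat_mult[symmetric]) simp
    finally have "(1 + r) ^ k * exp (- r\<^sup>2 / 2) \<le> real (Suc k) ^ Suc k * exp (1 + r) * exp (- r\<^sup>2 / 2)"
      by (rule mult_right_mono) auto
    also have "\<dots> = real (Suc k) ^ Suc k * exp (1 + r - r\<^sup>2 / 2)"
      by (simp add: exp_add[symmetric] mult.assoc)
    also have "\<dots> \<le> real (Suc k) ^ Suc k * exp 2"
    proof -
      have "1 + r - r\<^sup>2 / 2 \<le> 2" using zero_le_power2[of "r - 1"] by (simp add: power2_diff)
      then show ?thesis by (intro mult_left_mono) auto
    qed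
    finally show ?thesis .
  qed
  then show ?thesis by blast
qed

lemma schwartz_gaussian:
  fixes a :: "'a::euclidean_space"
  assumes "s \<ge> 0"
  shows "schwartz (\<lambda>x. exp (- (norm x)\<^sup>2 / 2) * exp (- s * (norm (x - a))\<^sup>2))"
proof (rule schwartz_coinduct[where P="\<lambda>f. \<exists>p. real_polynomial_function p \<and> f = (\<lambda>x. p x * (exp (- (norm x)\<^sup>2 / 2) * exp (- s * (norm (x - a))\<^sup>2)))"])
  let ?E = "\<lambda>x. exp (- (norm x)\<^sup>2 / 2) * exp (- s * (norm (x - a))\<^sup>2)"
  show "\<exists>p. real_polynomial_function p \<and> ?E = (\<lambda>x. p x * ?E x)"
    by (intro exI[of _ "\<lambda>x. 1"]) auto
  fix f :: "'a \<Rightarrow> real" and b :: 'a and k :: nat assume "\<exists>p. real_polynomial_function p \<and> f = (\<lambda>x. p x * ?E x)"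
  then obtain p where p: "real_polynomial_function p" and f: "f = (\<lambda>x. p x * ?E x)" by auto
  have dp: "p differentiable_on UNIV"
    using p by (auto simp: differentiable_on_def intro: differentiable_at_real_polynomial_function)
  have E: "(?E has_derivative (\<lambda>h. (- (x \<bullet> h) - 2 * s * ((x - a) \<bullet> h)) * ?E x)) (at x)" for x
    unfolding power2_norm_eq_inner
    by (auto intro!: derivative_eq_intros simp: inner_diff_left inner_diff_right inner_commute algebra_simps)
  show "f differentiable_on UNIV"
    unfolding f differentiable_on_def
  proof (rule ballI, rule differentiable_mult)
    fix x
    show "p differentiable (at x within UNIV)" using dp by (simp add: differentiable_on_def)
    show "?E differentiable (at x within UNIV)" using E unfolding differentiable_def by blast
  qed
  have pd: "partial_deriv b f = (\<lambda>x. (partial_deriv b p x + p x * (- (x \<bullet> b) - 2 * s * ((x - a) \<bullet> b))) * ?E x)"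
  proof
    fix x
    obtain D where D: "(p has_derivative D) (at x)" using dp differentiable_onD by metis
    show "partial_deriv b f x = (partial_deriv b p x + p x * (- (x \<bullet> b) - 2 * s * ((x - a) \<bullet> b))) * ?E x"
      unfolding f partial_deriv_eq[OF has_derivative_mult[OF D E]] partial_deriv_eq[OF D] by (simp add: algebra_simps)
  qed
  have poly: "real_polynomial_function (\<lambda>x. partial_deriv b p x + p x * (- (x \<bullet> b) - 2 * s * ((x - a) \<bullet> b)))"
  proof -
    have lin: "real_polynomial_function (\<lambda>x. x \<bullet> b)"
      by (rule real_polynomial_function.intros(1)[OF bounded_linear_inner_left])
    have lin2: "real_polynomial_function (\<lambda>x. (x - a) \<bullet> b)"
      unfolding inner_diff_left by (rule real_polynomial_function_diff[OF lin real_polynomial_function.intros(2)])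
    have "real_polynomial_function (\<lambda>x. - (x \<bullet> b) - 2 * s * ((x - a) \<bullet> b))"
      by (rule real_polynomial_function_diff[OF real_polynomial_function_minus[OF lin]
          real_polynomial_function.intros(4)[OF real_polynomial_function.intros(2)[of "2 * s"] lin2]])
    from real_polynomial_function.intros(3)[OF real_polynomial_function_partial_deriv[OF p]
        real_polynomial_function.intros(4)[OF p this]]
    show ?thesis .
  qed
  show "\<exists>p. real_polynomial_function p \<and> partial_deriv b f = (\<lambda>x. p x * ?E x)"
    by (rule exI, rule conjI, rule poly, rule pd)
  obtain C l where C: "\<And>x. \<bar>p x\<bar> \<le> C * (1 + norm x) ^ l" using real_polynomial_function_bound[OF p] by metis
  obtain D where D: "\<And>r::real. r \<ge> 0 \<Longrightarrow> (1 + r) ^ (k + l) * exp (- r\<^sup>2 / 2) \<le> D"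
    using power_mult_gaussian_bounded by metis
  have "0 \<le> C" using order_trans[OF abs_ge_zero C[of 0]] by simp
  have "norm x ^ k * norm (f x) \<le> C * D" for x
  proof -
    have "norm x ^ k * norm (f x) \<le> (1 + norm x) ^ k * ((C * (1 + norm x) ^ l) * (exp (- (norm x)\<^sup>2 / 2) * 1))"
      unfolding f real_norm_def abs_mult
      by (intro mult_mono power_mono C) (use assms \<open>0 \<le> C\<close> in auto)
    also have "\<dots> = C * ((1 + norm x) ^ (k + l) * exp (- (norm x)\<^sup>2 / 2))" by (simp add: power_add ac_simps)
    also have "\<dots> \<le> C * D" using \<open>0 \<le> C\<close> D by (intro mult_left_mono) auto
    finally show ?thesis .
  qed
  then show "\<exists>C. \<forall>x. norm x ^ k * norm (f x) \<le> C" by blast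
qed

text \<open>The positive and the negative part of \<open>w\<close> are densities of two measures
  that agree on open boxes, an intersection-stable generator of the Borel sets. Equal measures have
  almost everywhere equal densities, and the two parts of a real number are equal only if it is
  0.\<close>

lemma AE_eq_0_if_box_integrals_0:
  fixes w :: "'a::euclidean_space \<Rightarrow> real"
  assumes w: "integrable lborel w"
    and 0: "\<And>a b. (\<integral>x. indicator (box a b) x * w x \<partial>lborel) = 0"
  shows "AE x in lborel. w x = 0"
proof -
  have [measurable]: "w \<in> borel_measurable borel" using w by auto
  let ?p = "\<lambda>x. ennreal (w x)" and ?n = "\<lambda>x. ennreal (- w x)"
  have wp: "integrable lborel (\<lambda>x. indicator A x * max 0 (w x))" "integrable lborel (\<lambda>x. indicator A x * max 0 (- w x))"
    if "A \<in> sets borel" for A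
    using w that by (auto intro!: Bochner_Integration.integrable_bound[OF w] AE_I2 simp: indicator_def)
  have p: "emeasure (density lborel ?p) A = ennreal (\<integral>x. indicator A x * max 0 (w x) \<partial>lborel)"
    and n: "emeasure (density lborel ?n) A = ennreal (\<integral>x. indicator A x * max 0 (- w x) \<partial>lborel)"
    if "A \<in> sets borel" for A
    using that wp[OF that]
    by (auto simp: emeasure_density nn_integral_eq_integral[symmetric] indicator_def max_def ennreal_neg intro!: nn_integral_cong)
  have "density lborel ?p = density lborel ?n"
  proof (rule measure_eqI_generator_eq)
    let ?E = "range (\<lambda>(a, b). box a b::'a set)"
    show "Int_stable ?E" by (auto simp: Int_stable_def box_Int_box)
    show "?E \<subseteq> Pow UNIV" "sets (density lborel ?p) = sigma_sets UNIV ?E" "sets (density lborel ?n) = sigma_sets UNIV ?E"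
      by (simp_all add: borel_eq_box)
    let ?A = "\<lambda>n::nat. box (- (real n *\<^sub>R One)) (real n *\<^sub>R One) :: 'a set"
    show "range ?A \<subseteq> ?E" "(\<Union>i. ?A i) = UNIV" unfolding UN_box_eq_UNIV by auto
    show "emeasure (density lborel ?p) (?A i) \<noteq> \<infinity>" for i by (simp add: p)
    show "emeasure (density lborel ?p) X = emeasure (density lborel ?n) X" if X: "X \<in> ?E" for X
    proof -
      obtain a b where X: "X = box a b" using X by auto
      have Xb: "X \<in> sets borel" by (simp add: X)
      have "(\<integral>x. indicator X x * max 0 (w x) \<partial>lborel) - (\<integral>x. indicator X x * max 0 (- w x) \<partial>lborel)
          = (\<integral>x. indicator X x * max 0 (w x) - indicator X x * max 0 (- w x) \<partial>lborel)"
        by (rule Bochner_Integration.integral_diff[OF wp[OF Xb], symmetric])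
      also have "\<dots> = (\<integral>x. indicator X x * w x \<partial>lborel)"
        by (intro Bochner_Integration.integral_cong refl) (auto simp: max_def algebra_simps)
      finally have "(\<integral>x. indicator X x * max 0 (w x) \<partial>lborel) - (\<integral>x. indicator X x * max 0 (- w x) \<partial>lborel)
          = (\<integral>x. indicator X x * w x \<partial>lborel)" .
      then show ?thesis using 0[of a b] by (simp add: X p n)
    qed
  qed
  then have "AE x in lborel. ?p x = ?n x"
    by (intro sigma_finite_measure.density_unique[OF sigma_finite_lborel]) auto
  then show ?thesis
  proof eventually_elim
    case (elim x)
    then show ?case by (cases "w x" "0::real" rule: linorder_cases) (auto simp: ennreal_neg)
  qed
qed

text \<open>The indicator of a box, smoothed at scale \<open>e n\<close>, is a superposition over
  \<open>a\<close> in the box of the given Gaussians with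
  \<open>s = 1 / (2 * (e n)\<^sup>2)\<close>. By Fubini its integral against \<open>u\<close> is
  therefore 0, and letting the scale tend to 0 gives the integral of \<open>u\<close> over the
  box.\<close>

lemma AE_eq_0_if_gaussian_integrals_0:
  fixes u :: "'a::euclidean_space \<Rightarrow> real"
  assumes u: "integrable lborel u"
    and 0: "\<And>s a. s > 0 \<Longrightarrow> (\<integral>x. u x * exp (- s * (norm (x - a))\<^sup>2) \<partial>lborel) = 0"
  shows "AE x in lborel. u x = 0"
proof (rule AE_eq_0_if_box_integrals_0[OF u])
  fix l r :: 'a
  define e where "e n = 1 / real (Suc n)" for n
  have e: "e n > 0" for n by (simp add: e_def)
  have e0: "e \<longlonglongrightarrow> 0" unfolding e_def using LIMSEQ_inverse_real_of_nat by (simp add: inverse_eq_divide)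
  let ?K = "\<lambda>z::'a. exp (- (norm z)\<^sup>2 / 2)"
  let ?B = "indicator (box l r) :: 'a \<Rightarrow> real"
  define c where "c = (\<integral>z. ?K z \<partial>lborel)"
  have c: "c > 0" unfolding c_def integral_gaussian by simp
  have [measurable]: "u \<in> borel_measurable borel" using u by auto
  have B: "integrable lborel ?B" by (auto simp: emeasure_lborel_box_eq intro!: integrable_real_indicator)
  have smooth: "(\<integral>x. u x * (\<integral>z. ?K z * ?B (x + e n *\<^sub>R z) \<partial>lborel) \<partial>lborel) = 0" for n
  proof -
    let ?G = "\<lambda>x a. exp (- (1 / (2 * (e n)\<^sup>2)) * (norm (x - a))\<^sup>2)"
    have "(\<integral>z. ?K z * ?B (x + e n *\<^sub>R z) \<partial>lborel) = (1 / e n ^ DIM('a)) * (\<integral>a. ?G x a * ?B a \<partial>lborel)" for x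
    proof -
      have "(\<integral>a. ?G x a * ?B a \<partial>lborel) = e n ^ DIM('a) *\<^sub>R (\<integral>z. ?G x (x + e n *\<^sub>R z) * ?B (x + e n *\<^sub>R z) \<partial>lborel)"
        using e[of n] by (subst lborel_integral_affine[of _ "e n" x]) auto
      then show ?thesis using e[of n] by (simp add: power_mult_distrib)
    qed
    then have "(\<integral>x. u x * (\<integral>z. ?K z * ?B (x + e n *\<^sub>R z) \<partial>lborel) \<partial>lborel)
       = (1 / e n ^ DIM('a)) * (\<integral>x. (\<integral>a. u x * ?G x a * ?B a \<partial>lborel) \<partial>lborel)"
      by (simp add: mult.assoc)
    also have "(\<integral>x. (\<integral>a. u x * ?G x a * ?B a \<partial>lborel) \<partial>lborel) = (\<integral>a. (\<integral>x. u x * ?G x a * ?B a \<partial>lborel) \<partial>lborel)"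
    proof (rule lborel_pair.Fubini_integral[symmetric])
      have uB: "integrable (lborel \<Otimes>\<^sub>M lborel) (\<lambda>(x, a). u x * ?B a)"
      proof (rule lborel_pair.Fubini_integrable)
        show "integrable lborel (\<lambda>x. \<integral>a. norm (case (x, a) of (x, a) \<Rightarrow> u x * ?B a) \<partial>lborel)"
          using u by (simp add: abs_mult)
        show "AE x in lborel. integrable lborel (\<lambda>a. case (x, a) of (x, a) \<Rightarrow> u x * ?B a)"
          using B by simp
      qed measurable
      show "integrable (lborel \<Otimes>\<^sub>M lborel) (\<lambda>(x, a). u x * ?G x a * ?B a)"
      proof (rule Bochner_Integration.integrable_bound[OF uB])
        show "AE z in lborel \<Otimes>\<^sub>M lborel. norm (case z of (x, a) \<Rightarrow> u x * ?G x a * ?B a) \<le> norm (case z of (x, a) \<Rightarrow> u x * ?B a)"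
          using e[of n] by (intro AE_I2) (auto simp: abs_mult mult_left_le intro!: mult_right_mono mult_left_le)
      qed measurable
    qed
    also have "\<dots> = 0"
    proof -
      have "(\<integral>x. u x * ?G x a * ?B a \<partial>lborel) = 0" for a
        using 0[of "1 / (2 * (e n)\<^sup>2)" a] e[of n] by simp
      then show ?thesis by (simp only: integral_zero)
    qed
    finally show ?thesis by simp
  qed
  have "(\<lambda>n. \<integral>x. u x * (\<integral>z. ?K z * ?B (x + e n *\<^sub>R z) \<partial>lborel) \<partial>lborel) \<longlonglongrightarrow> (\<integral>x. u x * (c * ?B x) \<partial>lborel)"
  proof (rule integral_dominated_convergence[where w="\<lambda>x. norm (u x) * c"])
    \<comment> \<open>Smoothing converges where the indicator is continuous, that is, off the
      boundary of the box.\<close>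
    have "cbox l r - box l r \<in> null_sets lborel"
      using negligible_frontier_interval[of l r]
      by (simp add: negligible_iff_null_sets null_sets_completion_iff)
    then have "AE x in lborel. x \<notin> cbox l r - box l r" by (rule AE_not_in)
    then show "AE x in lborel. (\<lambda>n. u x * (\<integral>z. ?K z * ?B (x + e n *\<^sub>R z) \<partial>lborel)) \<longlonglongrightarrow> u x * (c * ?B x)"
    proof eventually_elim
      case (elim x)
      then have "x \<notin> frontier (box l r)"
        by (auto simp: frontier_def interior_open[OF open_box]) (meson closed_cbox box_subset_cbox closure_minimal subsetD)
      then have "isCont ?B x" by (simp add: isCont_indicator)
      then have "(\<lambda>n. \<integral>z. ?K z * ?B (x + e n *\<^sub>R z) \<partial>lborel) \<longlonglongrightarrow> c * ?B x"
        unfolding c_def by (intro approximate_identity[where B=1] integrable_gaussian e0) (simp_all split: split_indicator)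
      then show ?case by (rule tendsto_mult_left)
    qed
    show "AE x in lborel. norm (u x * (\<integral>z. ?K z * ?B (x + e n *\<^sub>R z) \<partial>lborel)) \<le> norm (u x) * c" for n
    proof (rule AE_I2)
      fix x
      have "norm (\<integral>z. ?K z * ?B (x + e n *\<^sub>R z) \<partial>lborel) \<le> (\<integral>z. norm (?K z * ?B (x + e n *\<^sub>R z)) \<partial>lborel)"
        by (rule integral_norm_bound)
      also have "\<dots> \<le> c"
        unfolding c_def by (rule integral_mono'[OF integrable_gaussian]) (auto simp: indicator_def)
      finally show "norm (u x * (\<integral>z. ?K z * ?B (x + e n *\<^sub>R z) \<partial>lborel)) \<le> norm (u x) * c"
        unfolding norm_mult by (intro mult_left_mono) auto
    qed
    show "integrable lborel (\<lambda>x. norm (u x) * c)" using u by simp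
  qed measurable
  then have "(\<lambda>n. 0 :: real) \<longlonglongrightarrow> (\<integral>x. u x * (c * ?B x) \<partial>lborel)" by (simp only: smooth)
  then have "(\<integral>x. u x * (c * ?B x) \<partial>lborel) = 0" by (simp add: LIMSEQ_const_iff)
  moreover have "(\<integral>x. u x * (c * ?B x) \<partial>lborel) = c * (\<integral>x. ?B x * u x \<partial>lborel)"
    by (subst integral_mult_right_zero[symmetric]) (simp add: ac_simps)
  ultimately show "(\<integral>x. ?B x * u x \<partial>lborel) = 0" using c by simp
qed

text \<open>Duality provides integrable products of \<open>h\<close> with test functions only.
  Dividing by a test function without zeros, the Gaussian at \<open>s = 0\<close>, recovers
  \<open>h\<close> itself.\<close>

lemma is_fourier_transform_measurable:
  fixes h :: "'a::euclidean_space \<Rightarrow> complex"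
  assumes "is_fourier_transform f h"
  shows "h \<in> borel_measurable borel"
proof -
  let ?g = "\<lambda>x::'a. complex_of_real (exp (- (norm x)\<^sup>2 / 2) * exp (- 0 * (norm (x - 0))\<^sup>2))"
  have "schwartz ?g"
    by (rule schwartz_bounded_linear[OF bounded_linear_of_real schwartz_gaussian]) simp
  then have "integrable lborel (\<lambda>x. h x * ?g x)"
    using assms unfolding is_fourier_transform_def by blast
  then have [measurable]: "(\<lambda>x. h x * ?g x) \<in> borel_measurable borel" by auto
  have "(\<lambda>x. (h x * ?g x) / ?g x) \<in> borel_measurable borel" by measurable
  then show ?thesis by simp
qed

lemma is_fourier_transform_unique:
  fixes h1 h2 :: "'a::euclidean_space \<Rightarrow> complex"
  assumes 1: "is_fourier_transform f h1" and 2: "is_fourier_transform f h2"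
  shows "AE x in lborel. h1 x = h2 x"
proof -
  let ?\<phi> = "\<lambda>s a x::'a. complex_of_real (exp (- (norm x)\<^sup>2 / 2) * exp (- s * (norm (x - a))\<^sup>2))"
  \<comment> \<open>\<open>h1\<close> and \<open>h2\<close> are integrable only against test
    functions; the Gaussian weight makes their difference integrable. What remains of the test
    function is exactly a Gaussian of the vanishing criterion.\<close>
  define u where "u x = (h1 x - h2 x) * complex_of_real (exp (- (norm x)\<^sup>2 / 2))" for x
  have \<phi>: "schwartz (?\<phi> s a)" if "s \<ge> 0" for s a
    by (rule schwartz_bounded_linear[OF bounded_linear_of_real schwartz_gaussian[OF that]])
  have int: "integrable lborel (\<lambda>x. h1 x * ?\<phi> s a x)" "integrable lborel (\<lambda>x. h2 x * ?\<phi> s a x)"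
    and eq: "(\<integral>x. h1 x * ?\<phi> s a x \<partial>lborel) = (\<integral>x. h2 x * ?\<phi> s a x \<partial>lborel)" if "s \<ge> 0" for s a
    using 1 2 \<phi>[OF that, of a] unfolding is_fourier_transform_def by auto
  have ueq: "u x * complex_of_real (exp (- s * (norm (x - a))\<^sup>2)) = h1 x * ?\<phi> s a x - h2 x * ?\<phi> s a x" for s a x
    unfolding u_def by (simp add: algebra_simps)
  have ui: "integrable lborel (\<lambda>x. u x * complex_of_real (exp (- s * (norm (x - a))\<^sup>2)))" if "s \<ge> 0" for s a
    unfolding ueq using int[OF that] by (rule Bochner_Integration.integrable_diff)
  have u0: "(\<integral>x. u x * complex_of_real (exp (- s * (norm (x - a))\<^sup>2)) \<partial>lborel) = 0" if "s \<ge> 0" for s a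
    unfolding ueq using int[OF that] eq[OF that] by simp
  have u: "integrable lborel u" using ui[of 0 0] by simp
  have re: "(\<integral>x. Re (u x) * exp (- s * (norm (x - a))\<^sup>2) \<partial>lborel) = 0" if "s > 0" for s a
    using arg_cong[OF u0[of s a], of Re] integral_Re[OF ui[of s a]] that by simp
  have im: "(\<integral>x. Im (u x) * exp (- s * (norm (x - a))\<^sup>2) \<partial>lborel) = 0" if "s > 0" for s a
    using arg_cong[OF u0[of s a], of Im] integral_Im[OF ui[of s a]] that by simp
  have "AE x in lborel. Re (u x) = 0"
    by (rule AE_eq_0_if_gaussian_integrals_0) (use u re in auto)
  moreover have "AE x in lborel. Im (u x) = 0"
    by (rule AE_eq_0_if_gaussian_integrals_0) (use u im in auto)
  ultimately show ?thesis
  proof eventually_elim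
    case (elim x)
    then have "u x = 0" by (simp add: complex_eq_iff)
    then show ?case by (simp add: u_def)
  qed
qed

text \<open>Eliminates the choice operator in \<open>fourier_transform\<close>: any transform known
  explicitly may replace the chosen one, since the integrand changes on a null set only. The
  multiplier is merely measurable, which admits the singular powers of Riesz potentials.\<close>

lemma inverse_fourier_fourier_transform:
  fixes f :: "'a::euclidean_space \<Rightarrow> complex"
  assumes h: "is_fourier_transform f h" and [measurable]: "m \<in> borel_measurable borel"
  shows "inverse_fourier (\<lambda>\<xi>. m \<xi> * fourier_transform f \<xi>) = inverse_fourier (\<lambda>\<xi>. m \<xi> * h \<xi>)"
proof
  fix x
  have ft: "is_fourier_transform f (fourier_transform f)"
    unfolding fourier_transform_def by (rule someI[where P="is_fourier_transform f", OF h])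
  note [measurable] = is_fourier_transform_measurable[OF h] is_fourier_transform_measurable[OF ft]
  show "inverse_fourier (\<lambda>\<xi>. m \<xi> * fourier_transform f \<xi>) x = inverse_fourier (\<lambda>\<xi>. m \<xi> * h \<xi>) x"
    unfolding inverse_fourier_def
    by (intro arg_cong2[where f="(*)"] refl integral_cong_AE)
       (use is_fourier_transform_unique[OF ft h] in \<open>auto intro: eventually_mono\<close>)
qed

section \<open>The Radon transform\<close>

definition hyperplane_coords :: "(nat \<Rightarrow> real ^ 'n) \<Rightarrow> real \<Rightarrow> (nat \<Rightarrow> real) \<Rightarrow> real ^ 'n" where
  "hyperplane_coords u p t = p *\<^sub>R u 0 + (\<Sum>k=1..CARD('n) - 1. t k *\<^sub>R u k)"

abbreviation lborel_PiM :: "nat \<Rightarrow> (nat \<Rightarrow> real) measure" where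
  "lborel_PiM m \<equiv> (\<Pi>\<^sub>M k\<in>{1..m}. lborel)"

declare One_nat_def [simp del]

lemma lessThan_CARD: "{..<CARD('n::finite)} = insert 0 {1..CARD('n) - 1}"
  using zero_less_card_finite[where 'a='n] by (auto simp: Suc_le_eq)

lemma real_CARD_minus_1: "real (CARD('n::finite) - 1) = real CARD('n) - 1"
  using zero_less_card_finite[where 'a='n] by (simp add: One_nat_def)

section \<open>Orthonormal coordinates on the hyperplanes orthogonal to \<omega>\<close>

context
  fixes \<omega> :: "real ^ 'n" and u :: "nat \<Rightarrow> real ^ 'n"
  assumes u: "orthonormal_basis_extending \<omega> u"
begin

lemma basis_0: "u 0 = \<omega>"
  using u by (simp add: orthonormal_basis_extending_def)

lemma basis_orthonormal: "i < CARD('n) \<Longrightarrow> j < CARD('n) \<Longrightarrow> u i \<bullet> u j = (if i = j then 1 else 0)"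
  using u by (simp add: orthonormal_basis_extending_def)

text \<open>The remainder \<open>w\<close> of the expansion is orthogonal to a spanning set, hence
  to itself.\<close>

lemma basis_representation: "x = (\<Sum>i<CARD('n). (x \<bullet> u i) *\<^sub>R u i)"
proof -
  define w where "w = x - (\<Sum>i<CARD('n). (x \<bullet> u i) *\<^sub>R u i)"
  have "orthogonal w y" if y: "y \<in> u ` {..<CARD('n)}" for y
  proof -
    obtain j where j: "j < CARD('n)" "y = u j" using y by auto
    have "(\<Sum>i<CARD('n). (x \<bullet> u i) * (u i \<bullet> u j)) = (\<Sum>i<CARD('n). if i = j then x \<bullet> u j else 0)"
      using j by (intro sum.cong refl) (auto simp: basis_orthonormal)
    then show ?thesis
      using j by (simp add: orthogonal_def w_def inner_diff_left inner_sum_left)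
  qed
  moreover have "w \<in> span (u ` {..<CARD('n)})"
    using u by (simp add: orthonormal_basis_extending_def)
  ultimately have "orthogonal w w" using orthogonal_to_span by blast
  then show ?thesis by (simp add: orthogonal_self w_def)
qed

lemma basis_representation_split: "x = (x \<bullet> \<omega>) *\<^sub>R \<omega> + (\<Sum>k=1..CARD('n) - 1. (x \<bullet> u k) *\<^sub>R u k)"
  using basis_representation[of x] unfolding lessThan_CARD by (simp add: basis_0)

lemma norm_basis: "norm \<omega> = 1"
  using basis_orthonormal[of 0 0] by (simp add: basis_0 norm_eq_1)

lemma basis_perp: "k \<in> {1..CARD('n) - 1} \<Longrightarrow> \<omega> \<bullet> u k = 0"
  using basis_orthonormal[of 0 k] by (auto simp: basis_0 split: if_splits)

lemma inner_hyperplane_coords: "\<omega> \<bullet> hyperplane_coords u p t = p"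
proof -
  have "\<omega> \<bullet> \<omega> = 1" using norm_basis by (simp add: norm_eq_1)
  then show ?thesis
    by (simp add: hyperplane_coords_def basis_0 inner_add_right inner_sum_right basis_perp)
qed

lemma norm_hyperplane_coords: "(norm (hyperplane_coords u p t))\<^sup>2 = p\<^sup>2 + (\<Sum>k=1..CARD('n) - 1. (t k)\<^sup>2)"
proof -
  have "hyperplane_coords u p t = (\<Sum>i<CARD('n). (t(0 := p)) i *\<^sub>R u i)"
    unfolding lessThan_CARD by (simp add: hyperplane_coords_def)
  moreover have "(norm (\<Sum>i<CARD('n). (t(0 := p)) i *\<^sub>R u i))\<^sup>2 = (\<Sum>i<CARD('n). ((t(0 := p)) i)\<^sup>2)"
    by (rule norm_sum_orthonormal) (auto simp: basis_orthonormal)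
  moreover have "\<dots> = p\<^sup>2 + (\<Sum>k=1..CARD('n) - 1. (t k)\<^sup>2)"
    unfolding lessThan_CARD by simp
  ultimately show ?thesis by simp
qed

lemma measurable_hyperplane_coords [measurable]:
  "hyperplane_coords u p \<in> borel_measurable (lborel_PiM (CARD('n) - 1))"
  unfolding hyperplane_coords_def[abs_def] by measurable

text \<open>The exponent is the dimension of the hyperplane, and the distance \<open>p\<close> from
  the origin can only shrink the integrand. The form with \<open>norm (1::real)\<close> matches the
  weight condition of \<open>schwartz_integral_shift\<close> for \<open>m = 1\<close>.\<close>

lemma integrable_hyperplane_weight:
  "integrable (lborel_PiM (CARD('n) - 1)) (\<lambda>t. norm (1::real) / (1 + (norm (hyperplane_coords u p t))\<^sup>2) ^ (CARD('n) - 1))"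
proof (rule integrableI_nonneg)
  have "(\<integral>\<^sup>+t. ennreal (norm (1::real) / (1 + (norm (hyperplane_coords u p t))\<^sup>2) ^ (CARD('n) - 1)) \<partial>(lborel_PiM (CARD('n) - 1)))
      \<le> (\<integral>\<^sup>+t. ennreal (1 / (1 + (\<Sum>k=1..CARD('n) - 1. (t k)\<^sup>2)) ^ card {1..CARD('n) - 1}) \<partial>(lborel_PiM (CARD('n) - 1)))"
  proof (intro nn_integral_mono ennreal_leI)
    fix t :: "nat \<Rightarrow> real"
    have pos: "1 + (\<Sum>k=1..CARD('n) - 1. (t k)\<^sup>2) > 0" by (intro add_pos_nonneg sum_nonneg) auto
    show "norm (1::real) / (1 + (norm (hyperplane_coords u p t))\<^sup>2) ^ (CARD('n) - 1)
        \<le> 1 / (1 + (\<Sum>k=1..CARD('n) - 1. (t k)\<^sup>2)) ^ card {1..CARD('n) - 1}"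
      unfolding norm_hyperplane_coords norm_one card_atLeastAtMost diff_Suc_1
      using pos zero_le_power2[of p] by (intro divide_left_mono power_mono mult_pos_pos zero_less_power) linarith+
  qed
  also have "\<dots> < \<infinity>" by (rule nn_integral_PiM_weight) simp
  finally show "(\<integral>\<^sup>+t. ennreal (norm (1::real) / (1 + (norm (hyperplane_coords u p t))\<^sup>2) ^ (CARD('n) - 1)) \<partial>(lborel_PiM (CARD('n) - 1))) < \<infinity>" .
qed (auto intro!: AE_I2 divide_nonneg_nonneg)

text \<open>These are orthonormal coordinates with the coordinate of index 0 split off, so that
  space is fibred into parallel hyperplanes. Fubini in this form is what the Fourier slice theorem
  rests on.\<close>

lemma distr_hyperplane_coords:
  "distr (lborel \<Otimes>\<^sub>M lborel_PiM (CARD('n) - 1)) borel (\<lambda>(p, t). hyperplane_coords u p t) = lborel"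
proof (rule measure_eqI)
  let ?I = "{1..CARD('n) - 1}"
  interpret product_sigma_finite "\<lambda>_. lborel :: real measure" by standard
  interpret I: finite_product_sigma_finite "\<lambda>_. lborel :: real measure" ?I by standard simp
  let ?S = "\<lambda>t. \<Sum>i<CARD('n). t i *\<^sub>R u i"
  have [measurable]: "(\<lambda>z. hyperplane_coords u (fst z) (snd z)) \<in> borel_measurable (lborel \<Otimes>\<^sub>M lborel_PiM (CARD('n) - 1))"
    unfolding hyperplane_coords_def[abs_def] by measurable
  have lb: "lborel = distr (\<Pi>\<^sub>M i\<in>{..<CARD('n)}. lborel) borel ?S"
    by (rule lborel_eq_orthonormal[symmetric]) (auto simp: basis_orthonormal intro: basis_representation)
  fix A :: "(real ^ 'n) set" assume "A \<in> sets (distr (lborel \<Otimes>\<^sub>M lborel_PiM (CARD('n) - 1)) borel (\<lambda>(p, t). hyperplane_coords u p t))"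
  then have A [measurable]: "A \<in> sets borel" by simp
  have "emeasure lborel A = (\<integral>\<^sup>+x. indicator A x \<partial>lborel)" by simp
  also have "\<dots> = (\<integral>\<^sup>+t. indicator A (?S t) \<partial>(\<Pi>\<^sub>M i\<in>insert 0 ?I. lborel))"
    by (subst lb, subst nn_integral_distr) (auto simp: lessThan_CARD)
  also have "\<dots> = (\<integral>\<^sup>+p. (\<integral>\<^sup>+t. indicator A (?S (t(0 := p))) \<partial>lborel_PiM (CARD('n) - 1)) \<partial>lborel)"
    by (rule product_nn_integral_insert_rev) (auto simp: lessThan_CARD)
  also have "\<dots> = (\<integral>\<^sup>+p. (\<integral>\<^sup>+t. indicator A (hyperplane_coords u p t) \<partial>lborel_PiM (CARD('n) - 1)) \<partial>lborel)"
    unfolding lessThan_CARD by (simp add: hyperplane_coords_def)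
  also have "\<dots> = (\<integral>\<^sup>+z. indicator A (hyperplane_coords u (fst z) (snd z)) \<partial>(lborel \<Otimes>\<^sub>M lborel_PiM (CARD('n) - 1)))"
    by (subst I.nn_integral_fst[symmetric]) auto
  also have "\<dots> = (\<integral>\<^sup>+x. indicator A x \<partial>distr (lborel \<Otimes>\<^sub>M lborel_PiM (CARD('n) - 1)) borel (\<lambda>(p, t). hyperplane_coords u p t))"
    by (subst nn_integral_distr) (auto simp: case_prod_unfold)
  finally show "emeasure (distr (lborel \<Otimes>\<^sub>M lborel_PiM (CARD('n) - 1)) borel (\<lambda>(p, t). hyperplane_coords u p t)) A = emeasure lborel A"
    by simp
qed simp

lemma hyperplane_coords_integral:
  fixes h :: "real ^ 'n \<Rightarrow> complex"
  assumes h: "integrable lborel h"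
  shows "integrable lborel (\<lambda>p. \<integral>t. h (hyperplane_coords u p t) \<partial>lborel_PiM (CARD('n) - 1))"
    and "(\<integral>p. (\<integral>t. h (hyperplane_coords u p t) \<partial>lborel_PiM (CARD('n) - 1)) \<partial>lborel) = (\<integral>x. h x \<partial>lborel)"
proof -
  interpret product_sigma_finite "\<lambda>_. lborel :: real measure" by standard
  interpret I: finite_product_sigma_finite "\<lambda>_. lborel :: real measure" "{1..CARD('n) - 1}" by standard simp
  interpret P: pair_sigma_finite "lborel :: real measure" "lborel_PiM (CARD('n) - 1)" ..
  have [measurable]: "(\<lambda>z. hyperplane_coords u (fst z) (snd z)) \<in> borel_measurable (lborel \<Otimes>\<^sub>M lborel_PiM (CARD('n) - 1))"
    unfolding hyperplane_coords_def[abs_def] by measurable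
  have [measurable]: "h \<in> borel_measurable borel" using h by auto
  have i: "integrable (lborel \<Otimes>\<^sub>M lborel_PiM (CARD('n) - 1)) (\<lambda>z. h (hyperplane_coords u (fst z) (snd z)))"
    using h unfolding distr_hyperplane_coords[symmetric]
    by (subst (asm) integrable_distr_eq) (auto simp: case_prod_unfold)
  show "integrable lborel (\<lambda>p. \<integral>t. h (hyperplane_coords u p t) \<partial>lborel_PiM (CARD('n) - 1))"
    using P.integrable_fst'[OF i] by simp
  have "(\<integral>p. (\<integral>t. h (hyperplane_coords u p t) \<partial>lborel_PiM (CARD('n) - 1)) \<partial>lborel)
      = (\<integral>z. h (hyperplane_coords u (fst z) (snd z)) \<partial>(lborel \<Otimes>\<^sub>M lborel_PiM (CARD('n) - 1)))"
    using P.integral_fst'[OF i] by simp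
  also have "\<dots> = (\<integral>x. h x \<partial>distr (lborel \<Otimes>\<^sub>M lborel_PiM (CARD('n) - 1)) borel (\<lambda>(p, t). hyperplane_coords u p t))"
    by (subst integral_distr) (auto simp: case_prod_unfold)
  finally show "(\<integral>p. (\<integral>t. h (hyperplane_coords u p t) \<partial>lborel_PiM (CARD('n) - 1)) \<partial>lborel) = (\<integral>x. h x \<partial>lborel)"
    by (simp add: distr_hyperplane_coords)
qed

end

text \<open>Gives access to the basis hidden in \<open>hyperplane_measure\<close>, with
  \<open>v\<close> witnessing that a basis exists. The obtained \<open>u\<close> is the same for all
  \<open>f\<close> and \<open>p\<close>, so integrals over parallel hyperplanes can be
  compared.\<close>

lemma radon_eq:
  fixes \<omega> :: "real ^ 'n"
  assumes "orthonormal_basis_extending \<omega> v"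
  obtains u where "orthonormal_basis_extending \<omega> u"
    "\<And>f p. f \<in> borel_measurable borel \<Longrightarrow>
      radon f \<omega> p = (\<integral>t. f (hyperplane_coords u p t) \<partial>lborel_PiM (CARD('n) - 1))"
proof -
  define u where "u = (SOME u. orthonormal_basis_extending \<omega> u)"
  have u: "orthonormal_basis_extending \<omega> u"
    unfolding u_def by (rule someI[where P="orthonormal_basis_extending \<omega>", OF assms])
  have "radon f \<omega> p = (\<integral>t. f (hyperplane_coords u p t) \<partial>lborel_PiM (CARD('n) - 1))"
    if [measurable]: "f \<in> borel_measurable borel" for f p
  proof -
    have eq: "hyperplane_measure \<omega> p = distr (lborel_PiM (CARD('n) - 1)) (restrict_space borel (hyperplane \<omega> p)) (hyperplane_coords u p)"
      unfolding hyperplane_measure_def u_def[symmetric] Let_def hyperplane_coords_def[abs_def] basis_0[OF u] ..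
    have "hyperplane_coords u p \<in> lborel_PiM (CARD('n) - 1) \<rightarrow>\<^sub>M restrict_space borel (hyperplane \<omega> p)"
      by (intro measurable_restrict_space2 measurable_hyperplane_coords[OF u])
         (auto simp: hyperplane_def inner_hyperplane_coords[OF u])
    then show ?thesis
      unfolding radon_def eq by (rule integral_distr) (auto intro: measurable_restrict_space1)
  qed
  with u that show ?thesis by blast
qed

section \<open>Linearity, translations, derivatives and slices of the Radon transform\<close>

context
  fixes \<omega> :: "real ^ 'n" and v0 :: "nat \<Rightarrow> real ^ 'n"
  assumes v0: "orthonormal_basis_extending \<omega> v0"
begin

lemma radon_sum:
  fixes f :: "'i \<Rightarrow> real ^ 'n \<Rightarrow> real"
  assumes "finite I" "\<And>i. i \<in> I \<Longrightarrow> schwartz (f i)"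
  shows "radon (\<lambda>x. \<Sum>i\<in>I. c i * f i x) \<omega> p = (\<Sum>i\<in>I. c i * radon (f i) \<omega> p)"
proof -
  obtain u where u: "orthonormal_basis_extending \<omega> u"
    and R: "\<And>f p. f \<in> borel_measurable borel \<Longrightarrow> radon f \<omega> p = (\<integral>t. f (hyperplane_coords u p t) \<partial>lborel_PiM (CARD('n) - 1))"
    using radon_eq[OF v0] by metis
  have [measurable]: "f i \<in> borel_measurable borel" if "i \<in> I" for i
    using assms(2)[OF that] by (rule schwartz_measurable)
  have int: "integrable (lborel_PiM (CARD('n) - 1)) (\<lambda>t. f i (hyperplane_coords u p t))" if "i \<in> I" for i
    using schwartz_integrable_shift[OF assms(2)[OF that] measurable_hyperplane_coords[OF u] _ integrable_hyperplane_weight[OF u]]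
    by simp
  have "radon (\<lambda>x. \<Sum>i\<in>I. c i * f i x) \<omega> p = (\<integral>t. (\<Sum>i\<in>I. c i * f i (hyperplane_coords u p t)) \<partial>lborel_PiM (CARD('n) - 1))"
    by (rule R) measurable
  also have "\<dots> = (\<Sum>i\<in>I. c i * radon (f i) \<omega> p)"
    by (subst Bochner_Integration.integral_sum) (auto intro: int simp: R)
  finally show ?thesis .
qed

lemma radon_add:
  assumes "schwartz f" "schwartz g"
  shows "radon (\<lambda>x. f x + g x) \<omega> p = radon f \<omega> p + radon g \<omega> p"
  using radon_sum[of "UNIV :: bool set" "\<lambda>b. if b then f else g" "\<lambda>_. 1" p] assms by (simp add: UNIV_bool add.commute)

lemma radon_mult: "schwartz f \<Longrightarrow> radon (\<lambda>x. c * f x) \<omega> p = c * radon f \<omega> p"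
  using radon_sum[of "{()}" "\<lambda>_. f" "\<lambda>_. c" p] by simp

text \<open>The component of \<open>v\<close> along \<omega> moves the hyperplane, whereas the
  tangential components shift its coordinates and are absorbed by translation invariance of the
  product measure.\<close>

lemma radon_translate:
  assumes f: "schwartz f"
  shows "radon (\<lambda>x. f (x + v)) \<omega> p = radon f \<omega> (p + \<omega> \<bullet> v)"
proof -
  let ?I = "{1..CARD('n) - 1}"
  let ?P = "lborel_PiM (CARD('n) - 1)"
  obtain u where u: "orthonormal_basis_extending \<omega> u"
    and R: "\<And>f p. f \<in> borel_measurable borel \<Longrightarrow> radon f \<omega> p = (\<integral>t. f (hyperplane_coords u p t) \<partial>?P)"
    using radon_eq[OF v0] by metis
  note [measurable] = schwartz_measurable[OF f] measurable_hyperplane_coords[OF u]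
  let ?T = "\<lambda>t. \<lambda>k\<in>?I. t k + v \<bullet> u k"
  have eq: "hyperplane_coords u p t + v = hyperplane_coords u (p + \<omega> \<bullet> v) (?T t)" for t
    using basis_representation_split[OF u, of v]
    by (simp add: hyperplane_coords_def basis_0[OF u] scaleR_add_left sum.distrib inner_commute)
  have "radon f \<omega> (p + \<omega> \<bullet> v) = (\<integral>t. f (hyperplane_coords u (p + \<omega> \<bullet> v) t) \<partial>?P)"
    by (rule R) measurable
  also have "\<dots> = (\<integral>t. f (hyperplane_coords u (p + \<omega> \<bullet> v) t) \<partial>distr ?P ?P ?T)"
    by (simp add: PiM_lborel_translation)
  also have "\<dots> = (\<integral>t. f (hyperplane_coords u p t + v) \<partial>?P)"
    unfolding eq by (rule integral_distr) measurable
  also have "\<dots> = radon (\<lambda>x. f (x + v)) \<omega> p"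
    by (rule R[symmetric]) measurable
  finally show ?thesis by simp
qed

lemma radon_translate_derivative:
  assumes f: "schwartz f"
  shows "((\<lambda>t. radon f \<omega> (p + t * (\<omega> \<bullet> v))) has_real_derivative radon (partial_deriv v f) \<omega> p) (at 0)"
proof -
  let ?P = "lborel_PiM (CARD('n) - 1)"
  obtain u where u: "orthonormal_basis_extending \<omega> u"
    and R: "\<And>f p. f \<in> borel_measurable borel \<Longrightarrow> radon f \<omega> p = (\<integral>t. f (hyperplane_coords u p t) \<partial>?P)"
    using radon_eq[OF v0] by metis
  note [measurable] = schwartz_measurable[OF f]
  have "((\<lambda>t. \<integral>y. 1 * f (hyperplane_coords u p y + t *\<^sub>R v) \<partial>?P) has_vector_derivative
      (\<integral>y. 1 * partial_deriv v f (hyperplane_coords u p y) \<partial>?P)) (at 0)"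
    by (rule schwartz_derivative_shift[OF f measurable_hyperplane_coords[OF u] _ integrable_hyperplane_weight[OF u]]) simp
  moreover have "(\<integral>y. f (hyperplane_coords u p y + t *\<^sub>R v) \<partial>?P) = radon f \<omega> (p + t * (\<omega> \<bullet> v))" for t
    using R[of "\<lambda>x. f (x + t *\<^sub>R v)" p] radon_translate[OF f, of "t *\<^sub>R v" p] by simp
  moreover have "(\<integral>y. partial_deriv v f (hyperplane_coords u p y) \<partial>?P) = radon (partial_deriv v f) \<omega> p"
    by (rule R[symmetric]) (rule schwartz_measurable[OF schwartz_partial_deriv[OF f]])
  ultimately show ?thesis by (simp add: has_real_derivative_iff_has_vector_derivative)
qed

lemma radon_has_derivative:
  assumes "schwartz f"
  shows "((\<lambda>q. radon f \<omega> q) has_real_derivative radon (partial_deriv \<omega> f) \<omega> p) (at p)"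
proof -
  have "((\<lambda>t. radon f \<omega> (t + p)) has_real_derivative radon (partial_deriv \<omega> f) \<omega> p) (at 0)"
    using radon_translate_derivative[OF assms, of p \<omega>] norm_basis[OF v0]
    by (simp add: norm_eq_1 add.commute)
  then show ?thesis by (subst (asm) DERIV_shift[symmetric]) simp
qed

text \<open>Replacing \<open>f\<close> by its translate along \<open>v\<close> shifts
  \<open>p\<close> at speed \<open>\<omega> \<bullet> v\<close>. Differentiating under the integral
  and by the chain rule in \<open>p\<close> must give the same value; in particular derivatives
  along the hyperplane integrate to 0.\<close>

lemma radon_partial_deriv:
  assumes f: "schwartz f"
  shows "radon (partial_deriv v f) \<omega> p = (\<omega> \<bullet> v) * radon (partial_deriv \<omega> f) \<omega> p"
proof -
  have "((\<lambda>t. radon f \<omega> (p + t * (\<omega> \<bullet> v))) has_real_derivative radon (partial_deriv \<omega> f) \<omega> p * (\<omega> \<bullet> v)) (at 0)"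
    by (rule DERIV_chain2[where f="radon f \<omega>"]) (auto intro!: derivative_eq_intros radon_has_derivative[OF f])
  from DERIV_unique[OF radon_translate_derivative[OF f] this] show ?thesis by (simp add: mult.commute)
qed

text \<open>At frequency \<open>\<sigma> *\<^sub>R \<omega>\<close> the phase is constant on each
  hyperplane orthogonal to \<omega>, so integrating over the hyperplanes one by one leaves a
  transform in \<open>p\<close>.\<close>

lemma fourier_slice:
  assumes f: "schwartz f"
  shows "integrable lborel (\<lambda>p. complex_of_real (radon f \<omega> p))"
    and "fourier_integral (\<lambda>p. complex_of_real (radon f \<omega> p)) \<sigma> = fourier_integral (\<lambda>x. complex_of_real (f x)) (\<sigma> *\<^sub>R \<omega>)"
proof -
  let ?P = "lborel_PiM (CARD('n) - 1)"
  let ?f = "\<lambda>x. complex_of_real (f x)"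
  obtain u where u: "orthonormal_basis_extending \<omega> u"
    and R: "\<And>f p. f \<in> borel_measurable borel \<Longrightarrow> radon f \<omega> p = (\<integral>t. f (hyperplane_coords u p t) \<partial>?P)"
    using radon_eq[OF v0] by metis
  have fc: "integrable lborel ?f"
    by (intro integrable_of_real schwartz_integrable f)
  have Rf: "(\<integral>t. ?f (hyperplane_coords u p t) \<partial>?P) = complex_of_real (radon f \<omega> p)" for p
    using R[OF schwartz_measurable[OF f], of p] by simp
  show "integrable lborel (\<lambda>p. complex_of_real (radon f \<omega> p))"
    using hyperplane_coords_integral(1)[OF u fc] by (simp only: Rf)
  have "fourier_integral ?f (\<sigma> *\<^sub>R \<omega>)
      = (\<integral>p. (\<integral>t. exp (\<i> * complex_of_real ((-1) * (hyperplane_coords u p t \<bullet> (\<sigma> *\<^sub>R \<omega>)))) * ?f (hyperplane_coords u p t) \<partial>?P) \<partial>lborel)"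
    unfolding fourier_integral_osc osc_def
    by (rule hyperplane_coords_integral(2)[OF u integrable_osc[OF fc], symmetric])
  also have "\<dots> = (\<integral>p. (\<integral>t. exp (\<i> * complex_of_real ((-1) * (p \<bullet> \<sigma>))) * ?f (hyperplane_coords u p t) \<partial>?P) \<partial>lborel)"
    using inner_hyperplane_coords[OF u] by (simp add: inner_commute mult.commute)
  also have "\<dots> = (\<integral>p. exp (\<i> * complex_of_real ((-1) * (p \<bullet> \<sigma>))) * complex_of_real (radon f \<omega> p) \<partial>lborel)"
    by (simp only: integral_mult_right_zero Rf)
  finally show "fourier_integral (\<lambda>p. complex_of_real (radon f \<omega> p)) \<sigma> = fourier_integral ?f (\<sigma> *\<^sub>R \<omega>)"
    unfolding fourier_integral_osc osc_def by simp
qed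

end

section \<open>Filtered backprojection\<close>

text \<open>\<open>e > -1\<close> makes the power integrable near 0, and the size of
  \<open>N\<close> makes \<open>1 / (1 + s\<^sup>2)\<close> a majorant for |s| > 1; the sum of the
  two bounds dominates everywhere.\<close>

lemma nn_integral_powr_weight:
  assumes e: "e > -1" and N: "2 * real N \<ge> e + 2"
  shows "(\<integral>\<^sup>+s. ennreal (\<bar>s\<bar> powr e / (1 + s\<^sup>2) ^ N) \<partial>lborel) < \<infinity>"
proof -
  have "(\<integral>\<^sup>+s. ennreal (\<bar>s\<bar> powr e / (1 + s\<^sup>2) ^ N) \<partial>lborel)
      \<le> (\<integral>\<^sup>+s. (ennreal (s powr e) * indicator {0..1} s + ennreal (\<bar>s\<bar> powr e) * indicator {-1..0} s) + ennreal (1 / (1 + s\<^sup>2)) \<partial>lborel)"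
  proof (rule nn_integral_mono)
    fix s :: real
    have pos: "1 + s\<^sup>2 > 0" by (intro add_pos_nonneg) auto
    show "ennreal (\<bar>s\<bar> powr e / (1 + s\<^sup>2) ^ N) \<le> (ennreal (s powr e) * indicator {0..1} s + ennreal (\<bar>s\<bar> powr e) * indicator {-1..0} s) + ennreal (1 / (1 + s\<^sup>2))"
    proof (cases "\<bar>s\<bar> \<le> 1")
      case True
      have "\<bar>s\<bar> powr e / (1 + s\<^sup>2) ^ N \<le> \<bar>s\<bar> powr e / 1"
        using pos by (intro divide_left_mono one_le_power) auto
      then have "ennreal (\<bar>s\<bar> powr e / (1 + s\<^sup>2) ^ N) \<le> ennreal (\<bar>s\<bar> powr e)" by (intro ennreal_leI) simp
      also have "\<dots> \<le> ennreal (s powr e) * indicator {0..1} s + ennreal (\<bar>s\<bar> powr e) * indicator {-1..0} s"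
        using True by (cases "s \<ge> 0") (auto simp: indicator_def)
      finally show ?thesis by (rule order_trans) simp
    next
      case False
      have "N \<noteq> 0" using N e by (intro notI) simp
      then obtain M where M: "N = Suc M" by (cases N) auto
      have "\<bar>s\<bar> powr e \<le> \<bar>s\<bar> powr (real (2 * M))"
        using False N M by (intro powr_mono) auto
      also have "\<dots> = (s\<^sup>2) ^ M" using False by (subst powr_realpow) (auto simp: power_mult)
      also have "\<dots> \<le> (1 + s\<^sup>2) ^ M" by (intro power_mono) auto
      finally have "\<bar>s\<bar> powr e / (1 + s\<^sup>2) ^ N \<le> (1 + s\<^sup>2) ^ M / (1 + s\<^sup>2) ^ N"
        using pos by (intro divide_right_mono) auto
      also have "\<dots> = 1 / (1 + s\<^sup>2)" using pos by (simp add: M)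
      finally show ?thesis by (intro add_increasing ennreal_leI) auto
    qed
  qed
  also have "\<dots> = (\<integral>\<^sup>+s. ennreal (s powr e) * indicator {0..1} s \<partial>lborel) + (\<integral>\<^sup>+s. ennreal (\<bar>s\<bar> powr e) * indicator {-1..0} s \<partial>lborel)
      + (\<integral>\<^sup>+s. ennreal (1 / (1 + s\<^sup>2)) \<partial>lborel)"
    by (subst nn_integral_add, simp, simp, subst nn_integral_add) auto
  also have "(\<integral>\<^sup>+s. ennreal (\<bar>s\<bar> powr e) * indicator {-1..0} s \<partial>lborel) = (\<integral>\<^sup>+s. ennreal (s powr e) * indicator {0..1} s \<partial>lborel)"
    by (subst nn_integral_real_affine[of _ "-1" 0]) (auto intro!: nn_integral_cong simp: indicator_def)
  also have "(\<integral>\<^sup>+s. ennreal (s powr e) * indicator {0..1} s \<partial>lborel) + (\<integral>\<^sup>+s. ennreal (s powr e) * indicator {0..1} s \<partial>lborel)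
      + (\<integral>\<^sup>+s. ennreal (1 / (1 + s\<^sup>2)) \<partial>lborel) < \<infinity>"
  proof -
    have "((\<lambda>s. s powr e) has_integral (integral {0..1} (\<lambda>s. s powr e))) {0..1}"
      using integrable_on_powr_from_0[OF e, of 1] by (simp add: has_integral_integral)
    from nn_integral_has_integral_lebesgue'[OF _ this]
    have "(\<integral>\<^sup>+s. ennreal (s powr e) * indicator {0..1} s \<partial>lborel) = ennreal (integral {0..1} (\<lambda>s. s powr e))" by simp
    then show ?thesis using nn_integral_inverse_1_plus_square by simp
  qed
  finally show ?thesis .
qed

text \<open>In polar coordinates the volume factor raises the exponent to \<open>d - 1 - a\<close>,
  which exceeds -1 exactly when \<open>a < d\<close>. Besides the Riesz potentials, the case
  \<open>a = d - 1\<close> serves the gradient of the fundamental solution.\<close>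

lemma integrable_powr_weight:
  assumes a: "a < real CARD('n)"
  obtains N where "integrable lborel (\<lambda>x::real^'n. norm x powr (- a) / (1 + (norm x)\<^sup>2) ^ N)"
proof -
  let ?e = "real CARD('n) - 1 - a"
  obtain N :: nat where N: "2 * real N \<ge> ?e + 2"
    using real_arch_simple[of "(?e + 2) / 2"] by (auto simp: field_simps)
  have powr: "\<bar>s\<bar> ^ (CARD('n) - 1) * (\<bar>s\<bar> powr (- a) / (1 + \<bar>s\<bar>\<^sup>2) ^ N) = \<bar>s\<bar> powr ?e / (1 + s\<^sup>2) ^ N" for s :: real
  proof (cases "s = 0")
    case False
    then have "\<bar>s\<bar> ^ (CARD('n) - 1) = \<bar>s\<bar> powr real (CARD('n) - 1)" by (simp add: powr_realpow)
    also note real_CARD_minus_1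
    finally show ?thesis by (simp add: powr_add[symmetric] diff_conv_add_uminus del: add_uminus_conv_diff)
  qed simp
  have "2 * integral\<^sup>N lborel (\<lambda>x::real^'n. ennreal (norm x powr (- a) / (1 + (norm x)\<^sup>2) ^ N))
    = ennreal (real CARD('n) * unit_ball_vol (real CARD('n))) * (\<integral>\<^sup>+s. ennreal (\<bar>s\<bar> ^ (CARD('n) - 1)) * ennreal (\<bar>s\<bar> powr (- a) / (1 + \<bar>s\<bar>\<^sup>2) ^ N) \<partial>lborel)"
    by (rule nn_integral_radial[of "\<lambda>r. ennreal (r powr (- a) / (1 + r\<^sup>2) ^ N)"]) measurable
  also have "\<dots> = ennreal (real CARD('n) * unit_ball_vol (real CARD('n))) * (\<integral>\<^sup>+s. ennreal (\<bar>s\<bar> powr ?e / (1 + s\<^sup>2) ^ N) \<partial>lborel)"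
    by (simp only: ennreal_mult'[symmetric] zero_le_power abs_ge_zero powr)
  also have "\<dots> < \<infinity>"
    using nn_integral_powr_weight[OF _ N] a by (simp add: ennreal_mult_less_top)
  finally have "integral\<^sup>N lborel (\<lambda>x::real^'n. ennreal (norm x powr (- a) / (1 + (norm x)\<^sup>2) ^ N)) < \<infinity>"
    by (auto simp: ennreal_mult_less_top)
  then have "integrable lborel (\<lambda>x::real^'n. norm x powr (- a) / (1 + (norm x)\<^sup>2) ^ N)"
    by (intro integrableI_nonneg) auto
  then show ?thesis by (rule that)
qed

text \<open>By the slice theorem the inner filter produces an integral over the line through
  \<omega> with weight \<open>\<bar>s\<bar>\<close> to the power \<open>d - 1 - \<alpha>\<close>.
  Backprojection collects these lines, and polar coordinates use up \<open>d - 1\<close> of the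
  power. What is left is the Fourier integral of \<open>norm \<xi> powr (- \<alpha>)\<close> times
  the transform of \<open>f\<close>, and the outer potential removes that last power. The condition
  on \<open>g\<close> concerns unit vectors only, since they carry the measure in
  \<open>dual_radon\<close>.\<close>

lemma radon_inverse_radon:
  fixes f :: "real ^ 'n \<Rightarrow> real" and b :: "real ^ 'n \<Rightarrow> nat \<Rightarrow> real ^ 'n"
  assumes f: "schwartz f" and \<alpha>: "\<alpha> < real CARD('n)"
    and b: "\<And>\<omega>. \<omega> \<in> sphere 0 1 \<Longrightarrow> orthonormal_basis_extending \<omega> (b \<omega>)"
    and g: "\<And>\<omega> p. \<omega> \<in> sphere 0 1 \<Longrightarrow> g \<omega> p = radon f \<omega> p"
  shows "radon_inverse \<alpha> g x = complex_of_real (f x)"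
proof -
  let ?d = "real CARD('n)"
  let ?f = "\<lambda>x. complex_of_real (f x)"
  have fc: "schwartz ?f" by (rule schwartz_bounded_linear[OF bounded_linear_of_real f])
  note [measurable] = schwartz_measurable[OF fc]
  have hm [measurable]: "fourier_integral ?f \<in> borel_measurable borel" by (simp add: fourier_integral_osc)
  \<comment> \<open>Near 0 this is integrable because \<alpha> < d; at infinity the rapid decay of
    the transform outweighs the growth that a negative \<alpha> causes.\<close>
  define v where "v \<xi> = complex_of_real (norm \<xi> powr (- \<alpha>)) * fourier_integral ?f \<xi>" for \<xi>
  have [measurable]: "v \<in> borel_measurable borel" unfolding v_def[abs_def] by measurable
  obtain N where N: "integrable lborel (\<lambda>x::real^'n. norm x powr (- \<alpha>) / (1 + (norm x)\<^sup>2) ^ N)"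
    using integrable_powr_weight[OF \<alpha>] by metis
  obtain C where C: "C > 0" "\<And>\<xi>. norm (fourier_integral ?f \<xi>) \<le> C / (1 + (norm \<xi>)\<^sup>2) ^ N"
    using fourier_integral_schwartz_bound[OF fc] by metis
  have v: "integrable lborel v"
  proof (rule Bochner_Integration.integrable_bound[OF integrable_mult_right[OF N, of C]])
    have vb: "norm (v \<xi>) \<le> C * (norm \<xi> powr (- \<alpha>) / (1 + (norm \<xi>)\<^sup>2) ^ N)" for \<xi>
      using mult_left_mono[OF C(2)[of \<xi>], of "norm \<xi> powr (- \<alpha>)"] by (simp add: v_def norm_mult mult.commute)
    show "AE \<xi> in lborel. norm (v \<xi>) \<le> norm (C * (norm \<xi> powr (- \<alpha>) / (1 + (norm \<xi>)\<^sup>2) ^ N))"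
      by (rule AE_I2, unfold real_norm_def, rule order_trans[OF vb abs_ge_self])
  qed simp
  define G where "G x \<xi> = exp (\<i> * complex_of_real (1 * (\<xi> \<bullet> x))) * v \<xi>" for x \<xi>
  have G: "integrable lborel (G x)" for x unfolding G_def by (rule integrable_osc[OF v])
  have inner: "riesz_potential (\<alpha> - ?d + 1) (\<lambda>p. complex_of_real (g \<omega> p)) (\<omega> \<bullet> x)
      = complex_of_real ((2 * pi) powr (- 1)) * (\<integral>s. \<bar>s\<bar> ^ (CARD('n) - 1) *\<^sub>R G x (s *\<^sub>R \<omega>) \<partial>lborel)"
    if \<omega>: "\<omega> \<in> sphere 0 1" for \<omega> x
  proof -
    have eq: "(\<lambda>p. complex_of_real (g \<omega> p)) = (\<lambda>p. complex_of_real (radon f \<omega> p))" using g[OF \<omega>] by simp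
    have "is_fourier_transform (\<lambda>p. complex_of_real (radon f \<omega> p)) (fourier_integral (\<lambda>p. complex_of_real (radon f \<omega> p)))"
      by (rule is_fourier_transform_integrable[OF fourier_slice(1)[OF b[OF \<omega>] f]])
    moreover have "fourier_integral (\<lambda>p. complex_of_real (radon f \<omega> p)) = (\<lambda>\<sigma>. fourier_integral ?f (\<sigma> *\<^sub>R \<omega>))"
      by (rule ext) (rule fourier_slice(2)[OF b[OF \<omega>] f])
    ultimately have ft: "is_fourier_transform (\<lambda>p. complex_of_real (radon f \<omega> p)) (\<lambda>\<sigma>. fourier_integral ?f (\<sigma> *\<^sub>R \<omega>))"
      by (simp only:)
    have "riesz_potential (\<alpha> - ?d + 1) (\<lambda>p. complex_of_real (g \<omega> p))
        = inverse_fourier (\<lambda>\<sigma>. complex_of_real (norm \<sigma> powr (- (\<alpha> - ?d + 1))) * fourier_integral ?f (\<sigma> *\<^sub>R \<omega>))"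
      unfolding riesz_potential_def eq by (rule inverse_fourier_fourier_transform[OF ft]) measurable
    moreover have "exp (\<i> * complex_of_real ((\<omega> \<bullet> x) \<bullet> s)) * (complex_of_real (norm s powr (- (\<alpha> - ?d + 1))) * fourier_integral ?f (s *\<^sub>R \<omega>))
        = \<bar>s\<bar> ^ (CARD('n) - 1) *\<^sub>R G x (s *\<^sub>R \<omega>)" for s
    proof (cases "s = 0")
      \<comment> \<open>\<open>0 powr y\<close> is 0 for every \<open>y\<close>, so both sides
        vanish, even if \<open>0 ^ (CARD('n) - 1)\<close> is 1.\<close>
      case True then show ?thesis by (simp add: G_def v_def)
    next
      case False
      have "norm s powr (- (\<alpha> - ?d + 1)) = \<bar>s\<bar> powr (?d - 1) * \<bar>s\<bar> powr (- \<alpha>)"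
        unfolding powr_add[symmetric] by (simp add: algebra_simps)
      also have "\<bar>s\<bar> powr (?d - 1) = \<bar>s\<bar> ^ (CARD('n) - 1)"
        using False by (simp add: powr_realpow[symmetric] real_CARD_minus_1)
      finally show ?thesis
        using \<omega> by (simp add: G_def v_def scaleR_conv_of_real[where 'a=complex] mult.commute mult.left_commute)
    qed
    ultimately show ?thesis by (simp only: inverse_fourier_def DIM_real of_nat_1)
  qed
  \<comment> \<open>The 2 comes from polar coordinates over the whole line, the inverse power from
    the inverse Fourier integral in one dimension.\<close>
  define c where "c = 2 * (2 * pi) powr (- 1)"
  have dual: "dual_radon (\<lambda>\<omega>. riesz_potential (\<alpha> - ?d + 1) (\<lambda>p. complex_of_real (g \<omega> p))) x
      = osc 1 (\<lambda>\<xi>. complex_of_real c * v \<xi>) x" for x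
  proof -
    have "dual_radon (\<lambda>\<omega>. riesz_potential (\<alpha> - ?d + 1) (\<lambda>p. complex_of_real (g \<omega> p))) x
        = (\<integral>\<omega>. complex_of_real ((2 * pi) powr (- 1)) * (\<integral>s. \<bar>s\<bar> ^ (CARD('n) - 1) *\<^sub>R G x (s *\<^sub>R \<omega>) \<partial>lborel) \<partial>sphere_measure)"
      unfolding dual_radon_def by (intro Bochner_Integration.integral_cong refl inner) simp
    also have "\<dots> = complex_of_real ((2 * pi) powr (- 1)) * (2 *\<^sub>R (\<integral>\<xi>. G x \<xi> \<partial>lborel))"
      by (subst integral_mult_right_zero, subst sphere_lborel_integral[OF G]) simp
    also have "\<dots> = osc 1 (\<lambda>\<xi>. complex_of_real c * v \<xi>) x"
      unfolding osc_def G_def c_def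
      by (simp add: scaleR_conv_of_real mult.left_commute[of _ "complex_of_real _"] mult.assoc flip: integral_mult_right_zero)
    finally show ?thesis .
  qed
  have ft: "is_fourier_transform (osc 1 (\<lambda>\<xi>. complex_of_real c * v \<xi>))
      (\<lambda>\<xi>. complex_of_real ((2 * pi) powr ?d) * (complex_of_real c * v \<xi>))"
    using is_fourier_transform_osc[OF integrable_mult_right[OF v, of "complex_of_real c"]] by simp
  have "riesz_potential (- \<alpha>) (osc 1 (\<lambda>\<xi>. complex_of_real c * v \<xi>)) x
      = inverse_fourier (\<lambda>\<xi>. complex_of_real (norm \<xi> powr \<alpha>) * (complex_of_real ((2 * pi) powr ?d) * (complex_of_real c * v \<xi>))) x"
    unfolding riesz_potential_def minus_minus
    by (rule fun_cong[OF inverse_fourier_fourier_transform[OF ft]]) measurable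
  also have "\<dots> = complex_of_real ((2 * pi) powr (- ?d)) *
      (\<integral>\<xi>. complex_of_real ((2 * pi) powr ?d * c) * (exp (\<i> * complex_of_real (1 * (\<xi> \<bullet> x))) * fourier_integral ?f \<xi>) \<partial>lborel)"
  proof -
    have "AE \<xi> in lborel. exp (\<i> * complex_of_real (x \<bullet> \<xi>)) * (complex_of_real (norm \<xi> powr \<alpha>) * (complex_of_real ((2 * pi) powr ?d) * (complex_of_real c * v \<xi>)))
        = complex_of_real ((2 * pi) powr ?d * c) * (exp (\<i> * complex_of_real (1 * (\<xi> \<bullet> x))) * fourier_integral ?f \<xi>)"
    \<comment> \<open>At \<xi> = 0 the opposite powers of the norm multiply to 0 instead of 1, so
      they cancel almost everywhere only.\<close>
    proof (rule eventually_mono[OF AE_lborel_singleton[of 0]])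
      fix \<xi> :: "real ^ 'n" assume "\<xi> \<noteq> 0"
      then have "complex_of_real (norm \<xi> powr \<alpha>) * v \<xi> = fourier_integral ?f \<xi>"
        by (simp add: v_def mult.assoc[symmetric] powr_add[symmetric] flip: of_real_mult)
      then show "exp (\<i> * complex_of_real (x \<bullet> \<xi>)) * (complex_of_real (norm \<xi> powr \<alpha>) * (complex_of_real ((2 * pi) powr ?d) * (complex_of_real c * v \<xi>)))
        = complex_of_real ((2 * pi) powr ?d * c) * (exp (\<i> * complex_of_real (1 * (\<xi> \<bullet> x))) * fourier_integral ?f \<xi>)"
        by (simp add: inner_commute mult.left_commute mult.commute)
    qed
    then show ?thesis
      unfolding inverse_fourier_def by (intro arg_cong2[where f="(*)"] integral_cong_AE) (simp_all, measurable)
  qed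
  also have "\<dots> = complex_of_real ((2 * pi) powr (- ?d) * ((2 * pi) powr ?d * c)) * osc 1 (fourier_integral ?f) x"
    by (simp add: osc_def mult.assoc)
  also have "\<dots> = complex_of_real ((2 * pi) powr (- ?d) * ((2 * pi) powr ?d * c) * (2 * pi) powr ?d) * ?f x"
    unfolding fourier_inversion[OF fc] by simp
  also have "(2 * pi) powr (- ?d) * ((2 * pi) powr ?d * c) * (2 * pi) powr ?d = 2 * (2 * pi) powr (?d - 1)"
    by (simp add: c_def powr_add[symmetric] powr_minus powr_diff field_simps)
  finally have "radon_inverse \<alpha> g x
      = complex_of_real (1 / 2 * (2 * pi) powr (1 - ?d) * (2 * (2 * pi) powr (?d - 1))) * ?f x"
    unfolding radon_inverse_def dual by (simp only: of_real_mult mult.assoc)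
  also have "1 / 2 * (2 * pi) powr (1 - ?d) * (2 * (2 * pi) powr (?d - 1)) = 1"
    by (simp add: powr_add[symmetric])
  finally show ?thesis by simp
qed

declare One_nat_def [simp]

section \<open>The fundamental solution\<close>

text \<open>The reciprocal of the area of the unit sphere. A radial field of strength
  \<open>fund_const d / r ^ (d - 1)\<close> has total flux 1 through every sphere around 0.\<close>

definition fund_const :: "nat \<Rightarrow> real" where
  "fund_const d = 1 / (real d * unit_ball_vol (real d))"

definition fund_profile :: "nat \<Rightarrow> real \<Rightarrow> real" where
  "fund_profile d r =
     (if d = 2 then ln r / (2 * pi)
      else - (Gamma (real d / 2 - 1) / (4 * pi powr (real d / 2))) * r powr (2 - real d))"

lemma fundamental_solution_eq: "fundamental_solution (y :: real ^ 'n) = fund_profile CARD('n) (norm y)"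
  by (simp add: fundamental_solution_def fund_profile_def)

lemma fund_const_pos: "d > 0 \<Longrightarrow> fund_const d > 0"
  by (simp add: fund_const_def)

text \<open>The logarithm and the power law have a common derivative, the field of unit flux, so
  everything after this point treats all dimensions at once. For \<open>d \<ge> 3\<close> the
  constants match by applying the functional equation of Gamma twice, from \<open>d / 2 + 1\<close>
  down to \<open>d / 2 - 1\<close>.\<close>

lemma DERIV_fund_profile:
  assumes d: "d \<ge> 2" and r: "r > 0"
  shows "(fund_profile d has_real_derivative fund_const d / r ^ (d - 1)) (at r)"
proof (cases "d = 2")
  case True
  have "fund_const 2 = 1 / (2 * pi)"
    by (simp add: fund_const_def unit_ball_vol_def Gamma_numeral)
  then show ?thesis
    using r unfolding fund_profile_def[abs_def] True by (auto intro!: derivative_eq_intros)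
next
  case False
  then have d3: "real d / 2 - 1 > 0" using d by simp
  have ni: "x \<notin> \<int>\<^sub>\<le>\<^sub>0" if "x > 0" for x :: real
    using that by (auto elim!: nonpos_Ints_cases)
  have G1: "Gamma (real d / 2) = (real d / 2 - 1) * Gamma (real d / 2 - 1)"
    using Gamma_plus1[of "real d / 2 - 1", OF ni[OF d3]] by simp
  have G2: "Gamma (real d / 2 + 1) = real d / 2 * Gamma (real d / 2)"
    using Gamma_plus1[of "real d / 2", OF ni] d by simp
  have pos: "Gamma (real d / 2 - 1) > 0" using d3 by (rule Gamma_real_pos)
  have c: "fund_const d = (real d - 2) * (Gamma (real d / 2 - 1) / (4 * pi powr (real d / 2)))"
    using d d3 pos unfolding fund_const_def unit_ball_vol_def G2 G1 by (simp add: field_simps)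
  have "r powr (2 - real d - 1) = 1 / r ^ (d - 1)"
  proof -
    have "2 - real d - 1 = - real (d - 1)" using d by simp
    then show ?thesis using r by (simp only: powr_minus powr_realpow) (simp add: divide_inverse)
  qed
  then have v: "- (Gamma (real d / 2 - 1) / (4 * pi powr (real d / 2))) * ((2 - real d) * r powr (2 - real d - 1)) = fund_const d / r ^ (d - 1)"
    unfolding c by (simp add: algebra_simps diff_divide_distrib)
  have "((\<lambda>r. - (Gamma (real d / 2 - 1) / (4 * pi powr (real d / 2))) * r powr (2 - real d)) has_real_derivative
      - (Gamma (real d / 2 - 1) / (4 * pi powr (real d / 2))) * ((2 - real d) * r powr (2 - real d - 1))) (at r)"
    using r by (auto intro!: derivative_eq_intros)
  from this[unfolded v] show ?thesis
    using False unfolding fund_profile_def[abs_def] by simp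
qed

text \<open>Replacing \<open>norm y\<close> by \<open>sqrt ((norm y)\<^sup>2 + e\<^sup>2)\<close> makes the fundamental solution smooth; its Laplacian
  becomes an approximate identity as \<open>e\<close> tends to \<open>0\<close>.\<close>

definition reg_norm :: "real \<Rightarrow> 'a::real_inner \<Rightarrow> real" where
  "reg_norm e y = sqrt ((norm y)\<^sup>2 + e\<^sup>2)"

definition fund_reg :: "real \<Rightarrow> real ^ 'n \<Rightarrow> real" where
  "fund_reg e y = fund_profile CARD('n) (reg_norm e y)"

definition fund_grad :: "real \<Rightarrow> real ^ 'n \<Rightarrow> real ^ 'n \<Rightarrow> real" where
  "fund_grad e v y = fund_const CARD('n) * (y \<bullet> v) / reg_norm e y ^ CARD('n)"

text \<open>The second derivative of \<open>fund_reg e\<close>, both times in the direction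
  \<open>v\<close>; a Laplacian requires these pure derivatives only.\<close>

definition fund_hess :: "real \<Rightarrow> real ^ 'n \<Rightarrow> real ^ 'n \<Rightarrow> real" where
  "fund_hess e v y = fund_const CARD('n) *
     ((v \<bullet> v) / reg_norm e y ^ CARD('n) - real CARD('n) * (y \<bullet> v)\<^sup>2 / reg_norm e y ^ (CARD('n) + 2))"

section \<open>Derivatives and bounds of the regularised kernel\<close>

lemma reg_norm_0 [simp]: "reg_norm 0 y = norm y"
  by (simp add: reg_norm_def)

lemma reg_norm_ge: "norm y \<le> reg_norm e y" "\<bar>e\<bar> \<le> reg_norm e y"
  unfolding reg_norm_def by (auto intro!: real_le_rsqrt)

lemma reg_norm_pos: "y \<noteq> 0 \<or> e \<noteq> 0 \<Longrightarrow> reg_norm e y > 0"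
proof -
  assume "y \<noteq> 0 \<or> e \<noteq> 0"
  then have "0 < norm y \<or> 0 < \<bar>e\<bar>" by auto
  then show ?thesis using reg_norm_ge(1)[of y e] reg_norm_ge(2)[of e y] by linarith
qed

lemma measurable_reg_norm [measurable]: "reg_norm e \<in> borel_measurable borel"
  unfolding reg_norm_def[abs_def] by measurable

lemma measurable_fund [measurable]:
  "fund_reg e \<in> borel_measurable borel" "fund_grad e v \<in> borel_measurable borel" "fund_hess e v \<in> borel_measurable borel"
  unfolding fund_reg_def[abs_def] fund_profile_def fund_grad_def[abs_def] fund_hess_def[abs_def] by measurable

lemma reg_norm_derivative:
  assumes "y \<noteq> 0 \<or> e \<noteq> 0"
  shows "((\<lambda>t. reg_norm e (y + t *\<^sub>R v)) has_real_derivative (y \<bullet> v) / reg_norm e y) (at 0)"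
proof -
  have "reg_norm e y > 0" using assms by (rule reg_norm_pos)
  then have pos: "y \<bullet> y + e\<^sup>2 > 0" by (simp add: reg_norm_def power2_norm_eq_inner)
  have "((\<lambda>t. y \<bullet> y + 2 * t * (y \<bullet> v) + t\<^sup>2 * (v \<bullet> v) + e\<^sup>2) has_real_derivative 2 * (y \<bullet> v)) (at 0)"
    by (auto intro!: derivative_eq_intros)
  then have D: "((\<lambda>t. sqrt (y \<bullet> y + 2 * t * (y \<bullet> v) + t\<^sup>2 * (v \<bullet> v) + e\<^sup>2)) has_real_derivative
      (inverse (sqrt (y \<bullet> y + 2 * 0 * (y \<bullet> v) + 0\<^sup>2 * (v \<bullet> v) + e\<^sup>2)) / 2) * (2 * (y \<bullet> v))) (at 0)"
    using pos by (intro DERIV_chain2[where f=sqrt] DERIV_real_sqrt) auto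
  have E: "y \<bullet> y + 2 * t * (y \<bullet> v) + t\<^sup>2 * (v \<bullet> v) + e\<^sup>2 = (norm (y + t *\<^sub>R v))\<^sup>2 + e\<^sup>2" for t
    unfolding power2_norm_eq_inner
    by (simp add: inner_add_left inner_add_right inner_commute power2_eq_square algebra_simps)
  have V: "(inverse (sqrt (y \<bullet> y + 2 * 0 * (y \<bullet> v) + 0\<^sup>2 * (v \<bullet> v) + e\<^sup>2)) / 2) * (2 * (y \<bullet> v)) = (y \<bullet> v) / reg_norm e y"
  proof -
    have "inverse r / 2 * (2 * a) = a / r" for a r :: real by (simp add: field_simps)
    moreover have "y \<bullet> y + 2 * 0 * (y \<bullet> v) + 0\<^sup>2 * (v \<bullet> v) + e\<^sup>2 = (norm y)\<^sup>2 + e\<^sup>2"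
      by (simp add: power2_norm_eq_inner)
    ultimately show ?thesis unfolding reg_norm_def by (simp only:)
  qed
  show ?thesis using D[unfolded V, unfolded E] unfolding reg_norm_def .
qed

lemma fund_reg_derivative:
  fixes y v :: "real ^ 'n"
  assumes d: "CARD('n) \<ge> 2" and y: "y \<noteq> 0 \<or> e \<noteq> 0"
  shows "((\<lambda>t. fund_reg e (y + t *\<^sub>R v)) has_real_derivative fund_grad e v y) (at 0)"
proof -
  have pos: "reg_norm e y > 0" using y by (rule reg_norm_pos)
  have "((\<lambda>t. fund_profile CARD('n) (reg_norm e (y + t *\<^sub>R v))) has_real_derivative
      fund_const CARD('n) / reg_norm e y ^ (CARD('n) - 1) * ((y \<bullet> v) / reg_norm e y)) (at 0)"
    by (rule DERIV_chain2[where f="fund_profile CARD('n)"])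
       (use DERIV_fund_profile[OF d pos] reg_norm_derivative[OF y] in auto)
  moreover have "reg_norm e y ^ CARD('n) = reg_norm e y ^ (CARD('n) - 1) * reg_norm e y"
    using d by (metis Suc_1 Suc_leD Suc_pred' less_eq_Suc_le One_nat_def power_Suc2)
  ultimately show ?thesis by (simp add: fund_reg_def fund_grad_def)
qed

lemma fund_grad_derivative:
  fixes y v :: "real ^ 'n"
  assumes y: "y \<noteq> 0 \<or> e \<noteq> 0"
  shows "((\<lambda>t. fund_grad e v (y + t *\<^sub>R v)) has_real_derivative fund_hess e v y) (at 0)"
proof -
  have pos: "reg_norm e y > 0" using y by (rule reg_norm_pos)
  obtain m where m: "CARD('n) = Suc m" by (metis Suc_pred' zero_less_card_finite)
  have "((\<lambda>t. fund_const CARD('n) * ((y + t *\<^sub>R v) \<bullet> v) / reg_norm e (y + t *\<^sub>R v) ^ CARD('n)) has_real_derivative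
      ((fund_const CARD('n) * (v \<bullet> v)) * reg_norm e y ^ CARD('n)
        - (fund_const CARD('n) * (y \<bullet> v)) * (real CARD('n) * reg_norm e y ^ (CARD('n) - 1) * ((y \<bullet> v) / reg_norm e y)))
      / (reg_norm e y ^ CARD('n) * reg_norm e y ^ CARD('n))) (at 0)"
  proof -
    have 1: "((\<lambda>t. fund_const CARD('n) * ((y + t *\<^sub>R v) \<bullet> v)) has_real_derivative fund_const CARD('n) * (v \<bullet> v)) (at 0)"
      by (auto intro!: derivative_eq_intros simp: inner_add_left)
    have 2: "((\<lambda>t. reg_norm e (y + t *\<^sub>R v) ^ CARD('n)) has_real_derivative
        real CARD('n) * reg_norm e y ^ (CARD('n) - 1) * ((y \<bullet> v) / reg_norm e y)) (at 0)"
      using DERIV_power[OF reg_norm_derivative[OF y, of v], of "CARD('n)"] by (simp add: mult.commute mult.left_commute)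
    show ?thesis using DERIV_divide[OF 1 2] pos by simp
  qed
  moreover have "((fund_const CARD('n) * (v \<bullet> v)) * reg_norm e y ^ CARD('n)
        - (fund_const CARD('n) * (y \<bullet> v)) * (real CARD('n) * reg_norm e y ^ (CARD('n) - 1) * ((y \<bullet> v) / reg_norm e y)))
      / (reg_norm e y ^ CARD('n) * reg_norm e y ^ CARD('n)) = fund_hess e v y"
    using pos unfolding fund_hess_def m by (simp add: divide_simps power2_eq_square) (simp add: algebra_simps)
  ultimately show ?thesis unfolding fund_grad_def by simp
qed

lemma abs_inner_le_reg_norm: "\<bar>y \<bullet> v\<bar> \<le> reg_norm e y * norm v"
  by (rule order_trans[OF Cauchy_Schwarz_ineq2]) (intro mult_right_mono reg_norm_ge norm_ge_zero)

text \<open>For fixed \<open>e > 0\<close> the denominator stays away from 0. The bound depends on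
  \<open>e\<close> and justifies differentiation under the integral before the limit; the limit
  itself relies on \<open>abs_fund_grad_le\<close>, which is uniform in \<open>e\<close>.\<close>

lemma fund_grad_bounded:
  fixes v :: "real ^ 'n"
  assumes e: "e > 0"
  shows "\<exists>B. \<forall>y. \<bar>fund_grad e v y\<bar> \<le> B"
proof -
  obtain m where m: "CARD('n) = Suc m" by (metis Suc_pred' zero_less_card_finite)
  have "\<bar>fund_grad e v y\<bar> \<le> fund_const CARD('n) * norm v / e ^ m" for y
  proof -
    have pos: "reg_norm e y > 0" using e by (intro reg_norm_pos) simp
    have "\<bar>fund_grad e v y\<bar> = fund_const CARD('n) * \<bar>y \<bullet> v\<bar> / reg_norm e y ^ CARD('n)"
      using pos by (simp add: fund_grad_def abs_mult abs_of_pos[OF fund_const_pos])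
    also have "\<dots> \<le> fund_const CARD('n) * (reg_norm e y * norm v) / reg_norm e y ^ CARD('n)"
      using pos fund_const_pos[of "CARD('n)"]
      by (intro divide_right_mono mult_left_mono abs_inner_le_reg_norm) auto
    also have "\<dots> = fund_const CARD('n) * norm v / reg_norm e y ^ m"
      using pos by (simp add: m)
    also have "\<dots> \<le> fund_const CARD('n) * norm v / e ^ m"
      using pos e reg_norm_ge(2)[of e y] fund_const_pos[of "CARD('n)"]
      by (intro divide_left_mono power_mono mult_nonneg_nonneg mult_pos_pos) auto
    finally show ?thesis .
  qed
  then show ?thesis by blast
qed

lemma fund_hess_bounded:
  fixes v :: "real ^ 'n"
  assumes e: "e > 0"
  shows "\<exists>B. \<forall>y. \<bar>fund_hess e v y\<bar> \<le> B"
proof -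
  let ?d = "CARD('n)"
  have "\<bar>fund_hess e v y\<bar> \<le> fund_const ?d * ((1 + real ?d) * (norm v)\<^sup>2 / e ^ ?d)" for y
  proof -
    have pos: "reg_norm e y > 0" using e by (intro reg_norm_pos) simp
    have "(y \<bullet> v)\<^sup>2 \<le> (reg_norm e y * norm v)\<^sup>2"
      using abs_inner_le_reg_norm[of y v e] by (metis abs_ge_zero power2_abs power_mono)
    then have "real ?d * (y \<bullet> v)\<^sup>2 / reg_norm e y ^ (?d + 2) \<le> real ?d * (reg_norm e y * norm v)\<^sup>2 / reg_norm e y ^ (?d + 2)"
      using pos by (intro divide_right_mono mult_left_mono) auto
    also have "\<dots> = real ?d * (norm v)\<^sup>2 / reg_norm e y ^ ?d"
      using pos by (simp add: power_add power_mult_distrib power2_eq_square field_simps)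
    finally have 1: "real ?d * (y \<bullet> v)\<^sup>2 / reg_norm e y ^ (?d + 2) \<le> real ?d * (norm v)\<^sup>2 / reg_norm e y ^ ?d" .
    have 2: "0 \<le> real ?d * (y \<bullet> v)\<^sup>2 / reg_norm e y ^ (?d + 2)" using pos by simp
    have 3: "0 \<le> (norm v)\<^sup>2 / reg_norm e y ^ ?d" using pos by simp
    have "\<bar>(v \<bullet> v) / reg_norm e y ^ ?d - real ?d * (y \<bullet> v)\<^sup>2 / reg_norm e y ^ (?d + 2)\<bar>
        \<le> (1 + real ?d) * (norm v)\<^sup>2 / reg_norm e y ^ ?d"
    proof -
      have "\<bar>A - Q\<bar> \<le> (1 + k) * A" if "0 \<le> Q" "Q \<le> k * A" "0 \<le> A" "0 \<le> k" for A Q k :: real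
        using that mult_nonneg_nonneg[of k A] unfolding abs_le_iff distrib_right by linarith
      from this[OF 2 _ 3] 1 show ?thesis unfolding power2_norm_eq_inner by simp
    qed
    also have "\<dots> \<le> (1 + real ?d) * (norm v)\<^sup>2 / e ^ ?d"
      using pos e reg_norm_ge(2)[of e y] by (intro divide_left_mono power_mono mult_pos_pos) auto
    finally have *: "\<bar>(v \<bullet> v) / reg_norm e y ^ ?d - real ?d * (y \<bullet> v)\<^sup>2 / reg_norm e y ^ (?d + 2)\<bar>
        \<le> (1 + real ?d) * (norm v)\<^sup>2 / e ^ ?d" .
    have c: "fund_const ?d > 0" by (intro fund_const_pos) simp
    show ?thesis
      unfolding fund_hess_def abs_mult abs_of_pos[OF c] using c by (intro mult_left_mono *) simp
  qed
  then show ?thesis by blast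
qed

text \<open>With \<rho> for \<open>reg_norm e y\<close>, the trace is proportional to \<rho> squared
  minus the square of \<open>norm y\<close>, and this difference is \<open>e\<^sup>2\<close>. Away
  from 0 the Laplacian thus vanishes as \<open>e\<close> tends to 0, and all its mass concentrates
  at the origin.\<close>

lemma sum_fund_hess:
  fixes y :: "real ^ 'n"
  assumes e: "e > 0"
  shows "(\<Sum>b\<in>Basis. fund_hess e b y) = fund_const CARD('n) * real CARD('n) * e\<^sup>2 / reg_norm e y ^ (CARD('n) + 2)"
proof -
  let ?d = "CARD('n)"
  have pos: "reg_norm e y > 0" using e by (intro reg_norm_pos) simp
  have sq: "(reg_norm e y)\<^sup>2 = (norm y)\<^sup>2 + e\<^sup>2" by (simp add: reg_norm_def)
  have ny: "(norm y)\<^sup>2 = (\<Sum>b\<in>Basis. (y \<bullet> b)\<^sup>2)"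
    unfolding power2_norm_eq_inner by (subst euclidean_inner) (simp add: power2_eq_square)
  have "(\<Sum>b\<in>Basis. fund_hess e b y) = fund_const ?d * (real ?d / reg_norm e y ^ ?d - real ?d * (norm y)\<^sup>2 / reg_norm e y ^ (?d + 2))"
    unfolding fund_hess_def ny sum_distrib_left[symmetric] sum_subtractf
    by (simp add: sum_distrib_left sum_divide_distrib)
  also have "real ?d / reg_norm e y ^ ?d - real ?d * (norm y)\<^sup>2 / reg_norm e y ^ (?d + 2)
      = real ?d * ((reg_norm e y)\<^sup>2 - (norm y)\<^sup>2) / reg_norm e y ^ (?d + 2)"
  proof -
    have "a / X - a * n / (X * R) = a * (R - n) / (X * R)" if "X > 0" "R > 0" for a X R n :: real
      using that by (simp add: field_simps)
    then show ?thesis unfolding power_add using pos by simp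
  qed
  finally show ?thesis unfolding sq by simp
qed

section \<open>Convolution with slowly growing kernels\<close>

text \<open>The power is the singularity of the gradient of the fundamental solution, the worst one
  that occurs. The polynomial factor makes room for the logarithm in the plane and for the slower
  decay of the kernel itself, so that a single weight dominates the kernel and its gradient.\<close>

definition slow_weight :: "real ^ 'n \<Rightarrow> real" where
  "slow_weight y = norm y powr (1 - real CARD('n)) * (1 + (norm y)\<^sup>2)\<^sup>2"

text \<open>The origin is left out of the bound since \<open>slow_weight 0\<close> is 0 by the
  convention for \<open>powr\<close>, while a regularised kernel need not vanish there.\<close>

definition slow :: "(real ^ 'n \<Rightarrow> real) \<Rightarrow> bool" where
  "slow m \<longleftrightarrow> m \<in> borel_measurable borel \<and> (\<exists>C. \<forall>y. y \<noteq> 0 \<longrightarrow> \<bar>m y\<bar> \<le> C * slow_weight y)"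

lemma slow_weight_ge:
  fixes y :: "real ^ 'n"
  assumes "y \<noteq> 0" "CARD('n) \<ge> 2"
  shows "norm y / norm y ^ CARD('n) \<le> slow_weight y" "norm y powr (2 - real CARD('n)) \<le> slow_weight y"
    and "CARD('n) = 2 \<Longrightarrow> 3 + (norm y)\<^sup>2 + 1 / norm y \<le> 4 * slow_weight y"
proof -
  let ?r = "norm y"
  have r: "?r > 0" using assms by simp
  have q: "1 \<le> (1 + ?r\<^sup>2)\<^sup>2" by (rule one_le_power) simp
  have "(?r - 1)\<^sup>2 \<ge> 0" by simp
  then have "2 * ?r \<le> 1 + ?r\<^sup>2" by (simp add: power2_diff)
  then have r1: "?r \<le> 1 + ?r\<^sup>2" using r by linarith
  have q2: "?r \<le> (1 + ?r\<^sup>2)\<^sup>2"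
    using mult_mono[OF r1, of 1 "1 + ?r\<^sup>2"] by (simp add: power2_eq_square)
  have p: "?r powr (1 - real CARD('n)) = ?r / ?r ^ CARD('n)"
    using r by (simp add: powr_diff powr_realpow)
  show "?r / ?r ^ CARD('n) \<le> slow_weight y"
    unfolding slow_weight_def p using mult_left_mono[OF q, of "?r / ?r ^ CARD('n)"] by simp
  have "?r powr (2 - real CARD('n)) = ?r powr (1 - real CARD('n)) * ?r"
    using r by (simp add: powr_diff power2_eq_square)
  also have "\<dots> \<le> slow_weight y" unfolding slow_weight_def by (intro mult_left_mono q2) auto
  finally show "?r powr (2 - real CARD('n)) \<le> slow_weight y" .
  assume 2: "CARD('n) = 2"
  have w: "slow_weight y = (1 + ?r\<^sup>2)\<^sup>2 / ?r"
    unfolding slow_weight_def 2 using r by (simp add: powr_minus_divide)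
  have "1 / ?r \<le> slow_weight y" unfolding w using q r by (intro divide_right_mono) auto
  moreover have "1 + ?r\<^sup>2 \<le> slow_weight y"
  proof -
    have "(1 + ?r\<^sup>2) * ?r \<le> (1 + ?r\<^sup>2) * (1 + ?r\<^sup>2)" by (intro mult_left_mono r1) auto
    then show ?thesis unfolding w using r by (simp add: pos_le_divide_eq power2_eq_square)
  qed
  ultimately show "3 + ?r\<^sup>2 + 1 / ?r \<le> 4 * slow_weight y"
    using zero_le_power2[of ?r] by linarith
qed

text \<open>The constant does not depend on \<open>e\<close>, so this is a majorant for the limit
  \<open>e\<close> to 0. In the plane \<open>ln \<rho> \<le> \<rho> - 1\<close> bounds the logarithm
  from above, and the same inequality at \<open>inverse \<rho>\<close> bounds it from below; in
  higher dimensions the kernel is monotone in the norm, and regularising only increases the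
  norm.\<close>

lemma abs_fund_reg_le:
  fixes y :: "real ^ 'n"
  assumes d: "CARD('n) \<ge> 2"
  shows "\<exists>C. \<forall>e y. \<bar>e\<bar> \<le> 1 \<longrightarrow> y \<noteq> 0 \<longrightarrow> \<bar>fund_reg e (y :: real ^ 'n)\<bar> \<le> C * slow_weight y"
proof (cases "CARD('n) = 2")
  case True
  have "\<bar>fund_reg e y\<bar> \<le> (4 / (2 * pi)) * slow_weight y" if e: "\<bar>e\<bar> \<le> 1" and y: "y \<noteq> 0" for e and y :: "real ^ 'n"
  proof -
    let ?\<rho> = "reg_norm e y"
    have \<rho>: "?\<rho> > 0" using y by (intro reg_norm_pos) simp
    have sq: "?\<rho>\<^sup>2 = (norm y)\<^sup>2 + e\<^sup>2" by (simp add: reg_norm_def)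
    have e2: "e\<^sup>2 \<le> 1" using e by (simp add: abs_square_le_1)
    have "ln ?\<rho> \<le> ?\<rho> - 1" using \<rho> by (rule ln_le_minus_one)
    moreover have "2 * ?\<rho> \<le> 1 + ?\<rho>\<^sup>2" using zero_le_power2[of "?\<rho> - 1"] by (simp add: power2_diff)
    ultimately have 1: "ln ?\<rho> \<le> 3 + (norm y)\<^sup>2" using sq e2 zero_le_power2[of "norm y"] by linarith
    have "ln (inverse ?\<rho>) \<le> inverse ?\<rho> - 1" using \<rho> by (intro ln_le_minus_one) simp
    moreover have "inverse ?\<rho> \<le> 1 / norm y"
      using y reg_norm_ge(1)[of y e] by (simp add: inverse_eq_divide frac_le)
    ultimately have 2: "- ln ?\<rho> \<le> 1 / norm y" using \<rho> by (simp add: ln_inverse)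
    have nn: "0 \<le> 1 / norm y" "0 \<le> 3 + (norm y)\<^sup>2" by auto
    have "\<bar>ln ?\<rho>\<bar> \<le> 3 + (norm y)\<^sup>2 + 1 / norm y" unfolding abs_le_iff using 1 2 nn by linarith
    also have "\<dots> \<le> 4 * slow_weight y" using slow_weight_ge(3)[OF y d True] .
    finally show ?thesis
      unfolding fund_reg_def fund_profile_def using True
      by (simp add: divide_right_mono field_simps)
  qed
  then show ?thesis by blast
next
  case False
  let ?c = "Gamma (real CARD('n) / 2 - 1) / (4 * pi powr (real CARD('n) / 2))"
  have c: "?c > 0" using d False by (intro divide_pos_pos Gamma_real_pos) auto
  have "\<bar>fund_reg e y\<bar> \<le> ?c * slow_weight y" if e: "\<bar>e\<bar> \<le> 1" and y: "y \<noteq> 0" for e and y :: "real ^ 'n"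
  proof -
    have "\<bar>fund_reg e y\<bar> = ?c * reg_norm e y powr (2 - real CARD('n))"
      unfolding fund_reg_def fund_profile_def using False c by (simp only: abs_mult abs_minus if_False abs_of_pos[OF c]) simp
    also have "\<dots> \<le> ?c * norm y powr (2 - real CARD('n))"
      using y d c reg_norm_ge(1)[of y e] by (intro mult_left_mono powr_mono2') auto
    also have "\<dots> \<le> ?c * slow_weight y"
      using c slow_weight_ge(2)[OF y d] by (intro mult_left_mono) auto
    finally show ?thesis .
  qed
  then show ?thesis by blast
qed

lemma abs_fund_grad_le:
  fixes y v :: "real ^ 'n"
  assumes d: "CARD('n) \<ge> 2" and y: "y \<noteq> 0"
  shows "\<bar>fund_grad e v y\<bar> \<le> fund_const CARD('n) * norm v * slow_weight y"
proof -
  have pos: "reg_norm e y > 0" using y by (intro reg_norm_pos) simp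
  have "\<bar>fund_grad e v y\<bar> = fund_const CARD('n) * \<bar>y \<bullet> v\<bar> / reg_norm e y ^ CARD('n)"
    using pos by (simp add: fund_grad_def abs_mult abs_of_pos[OF fund_const_pos])
  also have "\<dots> \<le> fund_const CARD('n) * (norm y * norm v) / norm y ^ CARD('n)"
    using pos fund_const_pos[of "CARD('n)"] y reg_norm_ge(1)[of y e]
    by (intro frac_le mult_left_mono power_mono Cauchy_Schwarz_ineq2) auto
  also have "\<dots> = fund_const CARD('n) * norm v * (norm y / norm y ^ CARD('n))" by simp
  also have "\<dots> \<le> fund_const CARD('n) * norm v * slow_weight y"
    using fund_const_pos[of "CARD('n)"] slow_weight_ge(1)[OF y d] by (intro mult_left_mono) auto
  finally show ?thesis .
qed

lemma slow_fund_reg: "CARD('n) \<ge> 2 \<Longrightarrow> \<bar>e\<bar> \<le> 1 \<Longrightarrow> slow (fund_reg e :: real ^ 'n \<Rightarrow> real)"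
  using abs_fund_reg_le[where 'n='n] unfolding slow_def by (meson measurable_fund(1))

lemma slow_fund_grad: "CARD('n) \<ge> 2 \<Longrightarrow> slow (fund_grad e (v :: real ^ 'n))"
  unfolding slow_def using abs_fund_grad_le by (intro conjI exI measurable_fund allI impI) blast+

text \<open>Peetre's inequality moves the decay from \<open>x - y\<close> to \<open>y\<close>. Of
  the exponent \<open>N0 + 2\<close>, the 2 cancels the polynomial factor of
  \<open>slow_weight\<close>, and \<open>N0\<close> makes the remaining power of the norm
  integrable. The exponent is the same for all \<open>x\<close>.\<close>

lemma slow_weight_integrable:
  "\<exists>N. \<forall>x. integrable lborel (\<lambda>y::real^'n. slow_weight y / (1 + (norm (x - y))\<^sup>2) ^ N)"
proof -
  obtain N0 where N0: "integrable lborel (\<lambda>x::real^'n. norm x powr (- (real CARD('n) - 1)) / (1 + (norm x)\<^sup>2) ^ N0)"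
    using integrable_powr_weight[of "real CARD('n) - 1", where 'n='n] by auto
  have "integrable lborel (\<lambda>y::real^'n. slow_weight y / (1 + (norm (x - y))\<^sup>2) ^ (N0 + 2))" for x
  proof (rule Bochner_Integration.integrable_bound[OF integrable_mult_right[OF N0, of "(2 * (1 + (norm x)\<^sup>2)) ^ (N0 + 2)"]])
    show "AE y in lborel. norm (slow_weight y / (1 + (norm (x - y))\<^sup>2) ^ (N0 + 2))
        \<le> norm ((2 * (1 + (norm x)\<^sup>2)) ^ (N0 + 2) * (norm y powr (- (real CARD('n) - 1)) / (1 + (norm y)\<^sup>2) ^ N0))"
    proof (rule AE_I2)
      fix y :: "real ^ 'n"
      let ?a = "1 + (norm (x - y))\<^sup>2" and ?b = "1 + (norm y)\<^sup>2" and ?c = "2 * (1 + (norm x)\<^sup>2)"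
      have "?b \<le> ?c * ?a" using one_plus_norm_shift[of "- y" x] by (simp add: add.commute)
      then have "?b ^ (N0 + 2) \<le> ?c ^ (N0 + 2) * ?a ^ (N0 + 2)"
        unfolding power_mult_distrib[symmetric] by (intro power_mono) (auto simp: less_imp_le)
      then have "1 / ?a ^ (N0 + 2) \<le> ?c ^ (N0 + 2) / ?b ^ (N0 + 2)"
        by (simp add: divide_simps mult.commute)
      then have "slow_weight y * (1 / ?a ^ (N0 + 2)) \<le> slow_weight y * (?c ^ (N0 + 2) / ?b ^ (N0 + 2))"
        by (intro mult_left_mono) (auto simp: slow_weight_def)
      also have "\<dots> = ?c ^ (N0 + 2) * (norm y powr (- (real CARD('n) - 1)) / ?b ^ N0)"
      proof -
        have "w * q * (k / (r * q)) = k * (w / r)" if "q \<noteq> 0" for w q k r :: real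
          using that by simp
        from this[of "?b\<^sup>2"] show ?thesis
          unfolding slow_weight_def power_add[of ?b] by (simp only: minus_diff_eq) (simp add: power_not_zero)
      qed
      finally show "norm (slow_weight y / ?a ^ (N0 + 2)) \<le> norm (?c ^ (N0 + 2) * (norm y powr (- (real CARD('n) - 1)) / ?b ^ N0))"
        by (simp add: slow_weight_def abs_mult)
    qed
  qed (simp add: slow_weight_def[abs_def])
  then show ?thesis by blast
qed

lemma slow_weight_schwartz_integrable:
  fixes f :: "real ^ 'n \<Rightarrow> real"
  assumes "schwartz f"
  shows "integrable lborel (\<lambda>y. slow_weight y * \<bar>f (x - y)\<bar>)"
proof -
  obtain N where N: "\<And>x. integrable lborel (\<lambda>y::real^'n. slow_weight y / (1 + (norm (x - y))\<^sup>2) ^ N)"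
    using slow_weight_integrable[where 'n='n] by blast
  have "integrable lborel (\<lambda>y. slow_weight y * f (x - y))"
    by (rule schwartz_integrable_shift[OF assms, where N=N])
       (use N[of x] in \<open>auto simp: slow_weight_def[abs_def]\<close>)
  then have "integrable lborel (\<lambda>y. \<bar>slow_weight y * f (x - y)\<bar>)" by (rule integrable_abs)
  then show ?thesis by (simp add: abs_mult slow_weight_def)
qed

lemma slow_integrable_weight:
  fixes m :: "real ^ 'n \<Rightarrow> real"
  assumes "slow m"
  shows "\<exists>N. \<forall>x. integrable lborel (\<lambda>y. norm (m y) / (1 + (norm (x - y))\<^sup>2) ^ N)"
proof -
  obtain N where N: "\<And>x. integrable lborel (\<lambda>y::real^'n. slow_weight y / (1 + (norm (x - y))\<^sup>2) ^ N)"
    using slow_weight_integrable[where 'n='n] by blast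
  obtain C where [measurable]: "m \<in> borel_measurable borel" and C: "\<And>y. y \<noteq> 0 \<Longrightarrow> \<bar>m y\<bar> \<le> C * slow_weight y"
    using assms unfolding slow_def by auto
  have "integrable lborel (\<lambda>y. norm (m y) / (1 + (norm (x - y))\<^sup>2) ^ N)" for x
  proof (rule Bochner_Integration.integrable_bound[OF integrable_mult_right[OF N[of x], of C]])
    show "AE y in lborel. norm (norm (m y) / (1 + (norm (x - y))\<^sup>2) ^ N) \<le> norm (C * (slow_weight y / (1 + (norm (x - y))\<^sup>2) ^ N))"
    proof (rule eventually_mono[OF AE_lborel_singleton[of 0]])
      fix y :: "real ^ 'n" assume "y \<noteq> 0"
      then have "\<bar>m y\<bar> / (1 + (norm (x - y))\<^sup>2) ^ N \<le> C * slow_weight y / (1 + (norm (x - y))\<^sup>2) ^ N"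
        by (intro divide_right_mono C) auto
      then have "\<bar>m y\<bar> / (1 + (norm (x - y))\<^sup>2) ^ N \<le> C * (slow_weight y / (1 + (norm (x - y))\<^sup>2) ^ N)" by simp
      moreover have "norm (norm (m y) / (1 + (norm (x - y))\<^sup>2) ^ N) = \<bar>m y\<bar> / (1 + (norm (x - y))\<^sup>2) ^ N" by simp
      ultimately show "norm (norm (m y) / (1 + (norm (x - y))\<^sup>2) ^ N) \<le> norm (C * (slow_weight y / (1 + (norm (x - y))\<^sup>2) ^ N))"
        by (metis abs_ge_self order_trans real_norm_def)
    qed
  qed measurable
  then show ?thesis by blast
qed

text \<open>With the kernel at \<open>y\<close> and the Schwartz function at \<open>x - y\<close>,
  derivatives in \<open>x\<close> act on the smooth factor and the singularity stays at the
  origin.\<close>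

lemma convolve_eq:
  fixes f m :: "real ^ 'n \<Rightarrow> real"
  assumes [measurable]: "f \<in> borel_measurable borel" "m \<in> borel_measurable borel"
  shows "convolve f m x = (\<integral>y. m y * f (x - y) \<partial>lborel)"
  unfolding convolve_def by (subst lborel_integral_affine[of _ "-1" x]) (auto simp: mult.commute)

lemma slow_schwartz_integrable:
  assumes m: "slow m" and f: "schwartz f"
  shows "integrable lborel (\<lambda>y. m y * f (x - y))"
proof -
  obtain N where N: "\<And>x. integrable lborel (\<lambda>y. norm (m y) / (1 + (norm (x - y))\<^sup>2) ^ N)"
    using slow_integrable_weight[OF m] by blast
  show ?thesis
    by (rule schwartz_integrable_shift[OF f _ _ N]) (use m in \<open>auto simp: slow_def\<close>)
qed

lemma convolve_derivative:
  assumes m: "slow m" and f: "schwartz f"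
  shows "((\<lambda>t. convolve f m (x + t *\<^sub>R v)) has_vector_derivative convolve (partial_deriv v f) m x) (at 0)"
proof -
  obtain N where N: "\<And>x. integrable lborel (\<lambda>y. norm (m y) / (1 + (norm (x - y))\<^sup>2) ^ N)"
    using slow_integrable_weight[OF m] by blast
  have [measurable]: "m \<in> borel_measurable borel" using m by (simp add: slow_def)
  note [measurable] = schwartz_measurable[OF f] schwartz_measurable[OF schwartz_partial_deriv[OF f]]
  have "((\<lambda>t. \<integral>y. m y * f (x - y + t *\<^sub>R v) \<partial>lborel) has_vector_derivative
      (\<integral>y. m y * partial_deriv v f (x - y) \<partial>lborel)) (at 0)"
    by (rule schwartz_derivative_shift[OF f _ _ N]) auto
  then show ?thesis by (simp add: convolve_eq algebra_simps)
qed

lemma partial_deriv_convolve: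
  "slow m \<Longrightarrow> schwartz f \<Longrightarrow> partial_deriv v (convolve f m) = convolve (partial_deriv v f) m"
  by (intro ext partial_derivI convolve_derivative)

text \<open>Integration by parts without boundary terms: translating \<open>f\<close> by
  \<open>t *\<^sub>R v\<close> amounts to translating \<open>m\<close>, and the integral is
  differentiated at \<open>t = 0\<close> in both forms. The reflection in \<open>x - y\<close>
  accounts for the equal signs.\<close>

lemma convolve_parts:
  fixes f m m' :: "real ^ 'n \<Rightarrow> real"
  assumes m: "slow m" and f: "schwartz f" and [measurable]: "m' \<in> borel_measurable borel"
    and deriv: "\<And>y. ((\<lambda>t. m (y + t *\<^sub>R v)) has_real_derivative m' y) (at 0)"
    and bound: "\<And>y. \<bar>m' y\<bar> \<le> B"
  shows "(\<integral>y. m' y * f (x - y) \<partial>lborel) = (\<integral>y. m y * partial_deriv v f (x - y) \<partial>lborel)"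
proof -
  have [measurable]: "m \<in> borel_measurable borel" using m by (simp add: slow_def)
  note [measurable] = schwartz_measurable[OF f] schwartz_measurable[OF schwartz_partial_deriv[OF f]]
  obtain N where N: "\<And>x. integrable lborel (\<lambda>y. norm (m y) / (1 + (norm (x - y))\<^sup>2) ^ N)"
    using slow_integrable_weight[OF m] by blast
  have shift: "(\<integral>y. m y * f (x - y + t *\<^sub>R v) \<partial>lborel) = (\<integral>y. m (y + t *\<^sub>R v) * f (x - y) \<partial>lborel)" for t
    by (subst lborel_integral_affine[of _ 1 "t *\<^sub>R v"]) (auto simp: algebra_simps)
  have 1: "((\<lambda>t. \<integral>y. m (y + t *\<^sub>R v) * f (x - y) \<partial>lborel) has_vector_derivative
      (\<integral>y. m y * partial_deriv v f (x - y) \<partial>lborel)) (at 0)"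
    unfolding shift[symmetric] by (rule schwartz_derivative_shift[OF f _ _ N]) auto
  have int: "integrable lborel (\<lambda>y. m (y + t *\<^sub>R v) * f (x - y))" for t
    using lborel_integrable_affine[OF slow_schwartz_integrable[OF m f, of "x + t *\<^sub>R v"], of 1 "t *\<^sub>R v"]
    by (simp add: algebra_simps)
  have 2: "((\<lambda>t. \<integral>y. m (y + t *\<^sub>R v) * f (x - y) \<partial>lborel) has_vector_derivative
      (\<integral>y. m' (y + 0 *\<^sub>R v) * f (x - y) \<partial>lborel)) (at 0)"
  proof (rule has_vector_derivative_integral(1)[where K="\<lambda>y. B * \<bar>f (x - y)\<bar>"])
    show "integrable lborel (\<lambda>y. B * \<bar>f (x - y)\<bar>)"
      using lborel_integrable_affine[OF schwartz_integrable[OF f], of "-1" x] by (intro integrable_mult_right integrable_abs) simp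
    show "((\<lambda>t. m (y + t *\<^sub>R v) * f (x - y)) has_vector_derivative m' (y + t *\<^sub>R v) * f (x - y)) (at t)" for t y
    proof -
      have "((\<lambda>s. m (y + (s + t) *\<^sub>R v)) has_real_derivative m' (y + t *\<^sub>R v)) (at 0)"
        using deriv[of "y + t *\<^sub>R v"] by (simp add: algebra_simps)
      then have "((\<lambda>s. m (y + s *\<^sub>R v)) has_real_derivative m' (y + t *\<^sub>R v)) (at t)"
        using DERIV_shift[of "\<lambda>s. m (y + s *\<^sub>R v)" "m' (y + t *\<^sub>R v)" 0 t] by simp
      then show ?thesis
        by (intro has_vector_derivative_mult_left) (simp add: has_real_derivative_iff_has_vector_derivative)
    qed
    show "norm (m' (y + t *\<^sub>R v) * f (x - y)) \<le> B * \<bar>f (x - y)\<bar>" for t y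
      by (simp add: abs_mult mult_right_mono bound)
  qed (use int in auto)
  from vector_derivative_unique_at[OF 1 2] show ?thesis by simp
qed

section \<open>The Newtonian potential of a Schwartz function\<close>

lemma tendsto_fund:
  fixes y v :: "real ^ 'n"
  assumes d: "CARD('n) \<ge> 2" and y: "y \<noteq> 0" and e: "e \<longlonglongrightarrow> 0"
  shows "(\<lambda>n. fund_reg (e n) y) \<longlonglongrightarrow> fund_reg 0 y" "(\<lambda>n. fund_grad (e n) v y) \<longlonglongrightarrow> fund_grad 0 v y"
proof -
  have "(\<lambda>n. sqrt ((norm y)\<^sup>2 + (e n)\<^sup>2)) \<longlonglongrightarrow> sqrt ((norm y)\<^sup>2 + 0\<^sup>2)"
    by (intro tendsto_intros e)
  then have \<rho>: "(\<lambda>n. reg_norm (e n) y) \<longlonglongrightarrow> norm y" by (simp add: reg_norm_def)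
  show "(\<lambda>n. fund_reg (e n) y) \<longlonglongrightarrow> fund_reg 0 y"
    unfolding fund_reg_def reg_norm_0
    by (rule isCont_tendsto_compose[OF DERIV_isCont[OF DERIV_fund_profile[OF d]] \<rho>]) (use y in simp)
  show "(\<lambda>n. fund_grad (e n) v y) \<longlonglongrightarrow> fund_grad 0 v y"
    unfolding fund_grad_def reg_norm_0 by (intro tendsto_intros \<rho>) (use y in simp)
qed

lemma dominated_convolution:
  fixes f :: "real ^ 'n \<Rightarrow> real"
  assumes f: "schwartz f" and m [measurable]: "\<And>n. m n \<in> borel_measurable borel" "m0 \<in> borel_measurable borel"
    and bound: "\<And>n y. y \<noteq> 0 \<Longrightarrow> \<bar>m n y\<bar> \<le> C * slow_weight y"
    and lim: "\<And>y. y \<noteq> 0 \<Longrightarrow> (\<lambda>n. m n y) \<longlonglongrightarrow> m0 y"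
  shows "(\<lambda>n. \<integral>y. m n y * f (x - y) \<partial>lborel) \<longlonglongrightarrow> (\<integral>y. m0 y * f (x - y) \<partial>lborel)"
proof (rule integral_dominated_convergence[where w="\<lambda>y. C * (slow_weight y * \<bar>f (x - y)\<bar>)"])
  note [measurable] = schwartz_measurable[OF f]
  show "(\<lambda>y. m0 y * f (x - y)) \<in> borel_measurable lborel" "(\<lambda>y. m n y * f (x - y)) \<in> borel_measurable lborel" for n
    by measurable
  show "integrable lborel (\<lambda>y. C * (slow_weight y * \<bar>f (x - y)\<bar>))"
    by (intro integrable_mult_right slow_weight_schwartz_integrable f)
  show "AE y in lborel. (\<lambda>n. m n y * f (x - y)) \<longlonglongrightarrow> m0 y * f (x - y)"
    by (rule eventually_mono[OF AE_lborel_singleton[of 0]]) (intro tendsto_mult_right lim)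
  show "AE y in lborel. norm (m n y * f (x - y)) \<le> C * (slow_weight y * \<bar>f (x - y)\<bar>)" for n
    by (rule eventually_mono[OF AE_lborel_singleton[of 0]])
       (simp add: abs_mult mult.assoc[symmetric] mult_right_mono bound)
qed

lemma inverse_Suc_LIMSEQ: "(\<lambda>n. 1 / real (Suc n)) \<longlonglongrightarrow> 0"
  using LIMSEQ_inverse_real_of_nat by (simp add: inverse_eq_divide)

text \<open>The gradient at \<open>e = 0\<close> is unbounded near the origin, which
  \<open>convolve_parts\<close> does not allow. The identity is therefore established for
  \<open>e > 0\<close> and both sides pass to the limit under majorants uniform in
  \<open>e\<close>.\<close>

lemma convolve_fund_grad:
  fixes f :: "real ^ 'n \<Rightarrow> real"
  assumes d: "CARD('n) \<ge> 2" and f: "schwartz f"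
  shows "(\<integral>y. fund_grad 0 v y * f (x - y) \<partial>lborel) = convolve (partial_deriv v f) fundamental_solution x"
proof -
  define e where "e n = 1 / real (Suc n)" for n
  have e: "0 < e n" "\<bar>e n\<bar> \<le> 1" for n by (auto simp: e_def)
  have e0: "e \<longlonglongrightarrow> 0" unfolding e_def by (rule inverse_Suc_LIMSEQ)
  note f' = schwartz_partial_deriv[OF f, of v]
  have G: "fundamental_solution = (fund_reg 0 :: real ^ 'n \<Rightarrow> real)"
    by (intro ext) (simp add: fundamental_solution_eq fund_reg_def)
  have eq: "(\<integral>y. fund_grad (e n) v y * f (x - y) \<partial>lborel) = (\<integral>y. fund_reg (e n) y * partial_deriv v f (x - y) \<partial>lborel)" for n
  proof -
    obtain B where B: "\<And>y. \<bar>fund_grad (e n) v y\<bar> \<le> B" using fund_grad_bounded[OF e(1)] by metis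
    show ?thesis
      by (rule convolve_parts[OF slow_fund_reg[OF d e(2)] f measurable_fund(2) fund_reg_derivative[OF d] B])
         (use e(1)[of n] in auto)
  qed
  have 1: "(\<lambda>n. \<integral>y. fund_grad (e n) v y * f (x - y) \<partial>lborel) \<longlonglongrightarrow> (\<integral>y. fund_grad 0 v y * f (x - y) \<partial>lborel)"
    by (rule dominated_convolution[OF f]) (auto intro: abs_fund_grad_le[OF d] tendsto_fund[OF d _ e0])
  obtain C where C: "\<And>e y. \<bar>e\<bar> \<le> 1 \<Longrightarrow> y \<noteq> 0 \<Longrightarrow> \<bar>fund_reg e (y :: real ^ 'n)\<bar> \<le> C * slow_weight y"
    using abs_fund_reg_le[OF d] by metis
  have 2: "(\<lambda>n. \<integral>y. fund_reg (e n) y * partial_deriv v f (x - y) \<partial>lborel) \<longlonglongrightarrow> (\<integral>y. fund_reg 0 y * partial_deriv v f (x - y) \<partial>lborel)"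
    by (rule dominated_convolution[OF f']) (auto intro: C e tendsto_fund[OF d _ e0])
  show ?thesis
    using LIMSEQ_unique[OF 1[unfolded eq] 2] unfolding G
    by (subst convolve_eq) (auto intro: schwartz_measurable[OF f'])
qed

text \<open>On the positive half-line \<open>(s / sqrt (1 + s\<^sup>2)) ^ d\<close> is an
  antiderivative, rising from 0 to 1; the negative half-line contributes the same.\<close>

lemma nn_integral_fund_kernel_radial:
  assumes d: "d > 0"
  shows "(\<integral>\<^sup>+s. ennreal (\<bar>s\<bar> ^ (d - 1) * real d / sqrt (1 + s\<^sup>2) ^ (d + 2)) \<partial>lborel) = 2"
proof -
  let ?h = "\<lambda>s::real. \<bar>s\<bar> ^ (d - 1) * real d / sqrt (1 + s\<^sup>2) ^ (d + 2)"
  have sq: "sqrt (1 + s\<^sup>2) > 0" "(sqrt (1 + s\<^sup>2))\<^sup>2 = 1 + s\<^sup>2" "1 + s\<^sup>2 > 0" for s :: real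
    using zero_le_power2[of s] by (auto simp: add_pos_nonneg)
  have half: "(\<integral>\<^sup>+s. ennreal (?h s) * indicator {0..} s \<partial>lborel) = ennreal (1 - (0 / sqrt (1 + 0\<^sup>2)) ^ d)"
  proof (rule nn_integral_FTC_atLeast[where F="\<lambda>s. (s / sqrt (1 + s\<^sup>2)) ^ d"])
    fix s :: real assume s: "0 \<le> s"
    let ?r = "sqrt (1 + s\<^sup>2)"
    have r2: "?r * ?r = 1 + s\<^sup>2" using sq(2)[of s] by (simp add: power2_eq_square)
    have "((\<lambda>s. sqrt (1 + s\<^sup>2)) has_real_derivative (inverse ?r / 2) * (2 * s)) (at s)"
      by (rule DERIV_chain2[where f=sqrt]) (auto intro!: derivative_eq_intros DERIV_real_sqrt sq)
    from DERIV_power[OF DERIV_divide[OF DERIV_ident this], of d]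
    have D: "((\<lambda>s. (s / sqrt (1 + s\<^sup>2)) ^ d) has_real_derivative
        real d * ((1 * ?r - s * (inverse ?r / 2 * (2 * s))) / (?r * ?r) * (s / ?r) ^ (d - Suc 0))) (at s)"
      using sq(1)[of s] by simp
    have Q: "(1 * ?r - s * (inverse ?r / 2 * (2 * s))) / (?r * ?r) = 1 / ?r ^ 3"
    proof -
      have "1 * ?r - s * (inverse ?r / 2 * (2 * s)) = (?r * ?r - s\<^sup>2) / ?r"
        using sq(1)[of s] by (simp add: field_simps power2_eq_square del: real_sqrt_mult_self)
      also have "\<dots> = 1 / ?r" unfolding r2 by simp
      finally show ?thesis by (simp add: power3_eq_cube)
    qed
    have H: "real d * (1 / ?r ^ 3 * (s / ?r) ^ (d - Suc 0)) = ?h s"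
    proof -
      obtain m where m: "d = Suc m" using d by (cases d) auto
      show ?thesis using s by (simp add: m power_divide power_add One_nat_def power2_eq_square power3_eq_cube ac_simps)
    qed
    show "((\<lambda>s. (s / sqrt (1 + s\<^sup>2)) ^ d) has_real_derivative ?h s) (at s)"
      using D unfolding Q H .
    show "0 \<le> ?h s" using sq(1)[of s] by simp
  next
    have "((\<lambda>s::real. s / sqrt (1 + s\<^sup>2)) \<longlongrightarrow> 1) at_top" by real_asymp
    from tendsto_power[OF this, of d] show "((\<lambda>s::real. (s / sqrt (1 + s\<^sup>2)) ^ d) \<longlongrightarrow> 1) at_top" by simp
  qed measurable
  have refl: "(\<integral>\<^sup>+s. ennreal (?h s) * indicator {..0} s \<partial>lborel) = (\<integral>\<^sup>+s. ennreal (?h s) * indicator {0..} s \<partial>lborel)"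
    by (subst nn_integral_real_affine[of _ "-1" 0]) (auto intro!: nn_integral_cong simp: indicator_def)
  have "(\<integral>\<^sup>+s. ennreal (?h s) \<partial>lborel) = (\<integral>\<^sup>+s. ennreal (?h s) * indicator {0..} s + ennreal (?h s) * indicator {..0} s \<partial>lborel)"
    by (rule nn_integral_cong_AE, rule eventually_mono[OF AE_lborel_singleton[of 0]]) (auto simp: indicator_def)
  also have "\<dots> = (\<integral>\<^sup>+s. ennreal (?h s) * indicator {0..} s \<partial>lborel) + (\<integral>\<^sup>+s. ennreal (?h s) * indicator {..0} s \<partial>lborel)"
    by (intro nn_integral_add) auto
  also have "\<dots> = 2" unfolding refl half using d by (simp add: zero_power one_add_one)
  finally show ?thesis .
qed

text \<open>Mass 1 is what \<open>fund_const\<close> is normalised for: it cancels the sphere area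
  in the radial formula, and the 2 of that formula cancels the value of the radial integral.\<close>

lemma integral_fund_kernel:
  shows "integrable lborel (\<lambda>z::real^'n. fund_const CARD('n) * real CARD('n) / sqrt (1 + (norm z)\<^sup>2) ^ (CARD('n) + 2))"
    and "integral\<^sup>L lborel (\<lambda>z::real^'n. fund_const CARD('n) * real CARD('n) / sqrt (1 + (norm z)\<^sup>2) ^ (CARD('n) + 2)) = 1"
proof -
  let ?d = "CARD('n)"
  let ?P = "\<lambda>z::real^'n. fund_const ?d * real ?d / sqrt (1 + (norm z)\<^sup>2) ^ (?d + 2)"
  have c: "fund_const ?d > 0" by (intro fund_const_pos) simp
  have cc: "real ?d * unit_ball_vol (real ?d) * fund_const ?d = 1"
    by (simp add: fund_const_def less_imp_neq[OF unit_ball_vol_pos, symmetric])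
  have "2 * integral\<^sup>N lborel (\<lambda>z. ennreal (?P z))
     = ennreal (real ?d * unit_ball_vol (real ?d)) * (\<integral>\<^sup>+s. ennreal (\<bar>s\<bar> ^ (?d - 1)) * ennreal (fund_const ?d * real ?d / sqrt (1 + \<bar>s\<bar>\<^sup>2) ^ (?d + 2)) \<partial>lborel)"
    by (rule nn_integral_radial[of "\<lambda>r. ennreal (fund_const ?d * real ?d / sqrt (1 + r\<^sup>2) ^ (?d + 2))"]) measurable
  also have "\<dots> = ennreal (real ?d * unit_ball_vol (real ?d)) * (\<integral>\<^sup>+s. ennreal (fund_const ?d) * ennreal (\<bar>s\<bar> ^ (?d - 1) * real ?d / sqrt (1 + s\<^sup>2) ^ (?d + 2)) \<partial>lborel)"
    using c by (simp add: ennreal_mult'[symmetric] ac_simps)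
  also have "\<dots> = ennreal (real ?d * unit_ball_vol (real ?d)) * (ennreal (fund_const ?d) * 2)"
    by (subst nn_integral_cmult, simp, subst nn_integral_fund_kernel_radial) simp_all
  also have "\<dots> = ennreal (real ?d * unit_ball_vol (real ?d) * fund_const ?d) * 2"
    using c by (simp add: ennreal_mult' mult.assoc)
  finally have "2 * integral\<^sup>N lborel (\<lambda>z. ennreal (?P z)) = 2 * 1" unfolding cc by simp
  then have nn: "integral\<^sup>N lborel (\<lambda>z. ennreal (?P z)) = ennreal 1"
    by (subst (asm) ennreal_mult_cancel_left) simp
  have pos: "0 \<le> ?P z" for z using c by (intro divide_nonneg_nonneg mult_nonneg_nonneg) auto
  show "integrable lborel ?P" by (rule integrableI_nonneg) (use nn pos in auto)
  show "integral\<^sup>L lborel ?P = 1" using nn pos by (subst integral_eq_nn_integral) auto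
qed

text \<open>Two integrations by parts put the Laplacian on the regularised kernel. The same
  integrals then have two limits: by domination the convolution with the true kernel, and, as an
  approximate identity of mass 1, the value \<open>f x\<close>.\<close>

lemma convolve_laplacian:
  fixes f :: "real ^ 'n \<Rightarrow> real"
  assumes d: "CARD('n) \<ge> 2" and f: "schwartz f"
  shows "convolve (\<lambda>x. \<Sum>b\<in>Basis. partial_deriv b (partial_deriv b f) x) fundamental_solution x = f x"
proof -
  define e where "e n = 1 / real (Suc n)" for n
  have e: "0 < e n" "\<bar>e n\<bar> \<le> 1" for n by (auto simp: e_def)
  have e0: "e \<longlonglongrightarrow> 0" unfolding e_def by (rule inverse_Suc_LIMSEQ)
  let ?L = "\<lambda>x. \<Sum>b\<in>Basis. partial_deriv b (partial_deriv b f) x"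
  have f1: "schwartz (partial_deriv b f)" and f2: "schwartz (partial_deriv b (partial_deriv b f))" for b
    by (intro schwartz_partial_deriv f)+
  have L: "schwartz ?L" by (intro schwartz_sum f2) auto
  note [measurable] = schwartz_measurable[OF f]
  have G: "fundamental_solution = (fund_reg 0 :: real ^ 'n \<Rightarrow> real)"
    by (intro ext) (simp add: fundamental_solution_eq fund_reg_def)
  let ?P = "\<lambda>z::real^'n. fund_const CARD('n) * real CARD('n) / sqrt (1 + (norm z)\<^sup>2) ^ (CARD('n) + 2)"
  have hess_int: "integrable lborel (\<lambda>y. fund_hess (e n) b y * f (x - y))" for n b
  proof -
    obtain B where B: "\<And>y. \<bar>fund_hess (e n) b y\<bar> \<le> B" using fund_hess_bounded[OF e(1)] by metis
    have "integrable lborel (\<lambda>y. B * \<bar>f (x - y)\<bar>)"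
      using lborel_integrable_affine[OF schwartz_integrable[OF f], of "-1" x] by (intro integrable_mult_right integrable_abs) simp
    then show ?thesis
    proof (rule Bochner_Integration.integrable_bound)
      show "AE y in lborel. norm (fund_hess (e n) b y * f (x - y)) \<le> norm (B * \<bar>f (x - y)\<bar>)"
        by (auto simp: abs_mult intro!: mult_right_mono order_trans[OF B abs_ge_self])
    qed measurable
  qed
  have eq: "(\<integral>y. fund_reg (e n) y * ?L (x - y) \<partial>lborel) = (\<integral>z. ?P z * f (x + (- e n) *\<^sub>R z) \<partial>lborel)" for n
  proof -
    have "(\<integral>y. fund_reg (e n) y * ?L (x - y) \<partial>lborel)
        = (\<Sum>b\<in>Basis. \<integral>y. fund_reg (e n) y * partial_deriv b (partial_deriv b f) (x - y) \<partial>lborel)"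
      unfolding sum_distrib_left
      by (rule Bochner_Integration.integral_sum) (rule slow_schwartz_integrable[OF slow_fund_reg[OF d e(2)] f2])
    also have "\<dots> = (\<Sum>b\<in>Basis. \<integral>y. fund_hess (e n) b y * f (x - y) \<partial>lborel)"
    proof (rule sum.cong[OF refl])
      fix b :: "real ^ 'n"
      obtain B1 where B1: "\<And>y. \<bar>fund_grad (e n) b y\<bar> \<le> B1" using fund_grad_bounded[OF e(1)] by metis
      obtain B2 where B2: "\<And>y. \<bar>fund_hess (e n) b y\<bar> \<le> B2" using fund_hess_bounded[OF e(1)] by metis
      have "(\<integral>y. fund_grad (e n) b y * partial_deriv b f (x - y) \<partial>lborel)
          = (\<integral>y. fund_reg (e n) y * partial_deriv b (partial_deriv b f) (x - y) \<partial>lborel)"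
        by (rule convolve_parts[OF slow_fund_reg[OF d e(2)] f1 measurable_fund(2) fund_reg_derivative[OF d] B1])
           (use e(1)[of n] in auto)
      moreover have "(\<integral>y. fund_hess (e n) b y * f (x - y) \<partial>lborel) = (\<integral>y. fund_grad (e n) b y * partial_deriv b f (x - y) \<partial>lborel)"
        by (rule convolve_parts[OF slow_fund_grad[OF d] f measurable_fund(3) fund_grad_derivative B2])
           (use e(1)[of n] in auto)
      ultimately show "(\<integral>y. fund_reg (e n) y * partial_deriv b (partial_deriv b f) (x - y) \<partial>lborel) = (\<integral>y. fund_hess (e n) b y * f (x - y) \<partial>lborel)"
        by simp
    qed
    also have "\<dots> = (\<integral>y. (\<Sum>b\<in>Basis. fund_hess (e n) b y) * f (x - y) \<partial>lborel)"
      unfolding sum_distrib_right by (rule Bochner_Integration.integral_sum[symmetric]) (rule hess_int)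
    also have "\<dots> = (\<integral>y. fund_const CARD('n) * real CARD('n) * (e n)\<^sup>2 / reg_norm (e n) y ^ (CARD('n) + 2) * f (x - y) \<partial>lborel)"
      by (simp only: sum_fund_hess[OF e(1)])
    \<comment> \<open>No power of \<open>e n\<close> survives the substitution: the volume element
      and \<open>(e n)\<^sup>2\<close> supply \<open>d + 2\<close> of them, and the denominator
      takes away as many. The reflection in \<open>x - y\<close> becomes the negative scale
      \<open>- e n\<close>.\<close>
    also have "\<dots> = e n ^ CARD('n) *\<^sub>R (\<integral>z. fund_const CARD('n) * real CARD('n) * (e n)\<^sup>2 / reg_norm (e n) (0 + e n *\<^sub>R z) ^ (CARD('n) + 2) * f (x - (0 + e n *\<^sub>R z)) \<partial>lborel)"
      using e(1)[of n] by (subst lborel_integral_affine[of _ "e n" 0]) auto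
    also have "\<dots> = (\<integral>z. ?P z * f (x + (- e n) *\<^sub>R z) \<partial>lborel)"
    proof -
      have "e n ^ CARD('n) * (fund_const CARD('n) * real CARD('n) * (e n)\<^sup>2 / reg_norm (e n) (0 + e n *\<^sub>R z) ^ (CARD('n) + 2) * f (x - (0 + e n *\<^sub>R z)))
          = ?P z * f (x + (- e n) *\<^sub>R z)" for z
      proof -
        have "(norm (e n *\<^sub>R z))\<^sup>2 + (e n)\<^sup>2 = (e n)\<^sup>2 * (1 + (norm z)\<^sup>2)"
          by (simp add: power_mult_distrib algebra_simps)
        then have "reg_norm (e n) (0 + e n *\<^sub>R z) = e n * sqrt (1 + (norm z)\<^sup>2)"
          using e(1)[of n] by (simp add: reg_norm_def real_sqrt_mult)
        then show ?thesis
          using e(1)[of n] by (simp add: power_mult_distrib power_add power2_eq_square)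
      qed
      then show ?thesis by (simp only: integral_scaleR_right[symmetric] real_scaleR_def integral_mult_right_zero[symmetric])
    qed
    finally show ?thesis .
  qed
  obtain C where C: "\<And>e y. \<bar>e\<bar> \<le> 1 \<Longrightarrow> y \<noteq> 0 \<Longrightarrow> \<bar>fund_reg e (y :: real ^ 'n)\<bar> \<le> C * slow_weight y"
    using abs_fund_reg_le[OF d] by metis
  have 1: "(\<lambda>n. \<integral>y. fund_reg (e n) y * ?L (x - y) \<partial>lborel) \<longlonglongrightarrow> (\<integral>y. fund_reg 0 y * ?L (x - y) \<partial>lborel)"
    by (rule dominated_convolution[OF L]) (auto intro: C e tendsto_fund[OF d _ e0])
  obtain B where B: "\<And>y. norm (f y) * (1 + (norm y)\<^sup>2) ^ 0 \<le> B" using schwartz_bound[OF f] by metis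
  have 2: "(\<lambda>n. \<integral>z. ?P z * f (x + (- e n) *\<^sub>R z) \<partial>lborel) \<longlonglongrightarrow> (\<integral>z. ?P z \<partial>lborel) * f x"
  proof (rule approximate_identity[OF integral_fund_kernel(1)])
    show "isCont f x" using schwartz_continuous_on[OF f, of UNIV] by (simp add: continuous_on_eq_continuous_at)
    show "norm (f y) \<le> B" for y using B[of y] by simp
    show "(\<lambda>n. - e n) \<longlonglongrightarrow> 0" using tendsto_minus[OF e0] by simp
  qed simp
  show ?thesis
    using LIMSEQ_unique[OF 1[unfolded eq] 2] unfolding G integral_fund_kernel(2)
    by (subst convolve_eq) (auto intro: schwartz_measurable[OF L])
qed

section \<open>Reconstruction of the field\<close>

lemma sum_Basis_axis: "(\<Sum>b\<in>(Basis :: (real ^ 'n) set). f b) = (\<Sum>j\<in>UNIV. f (axis j 1))"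
proof -
  have B: "Basis = range (\<lambda>j. axis j (1::real) :: real ^ 'n)"
    by (auto simp: Basis_vec_def)
  have inj: "inj (\<lambda>j. axis j (1::real) :: real ^ 'n)"
    by (auto simp: inj_on_def axis_eq_axis)
  show ?thesis unfolding B sum.reindex[OF inj] by simp
qed

lemma laplacian_Basis: "laplacian f x = (\<Sum>b\<in>Basis. partial_deriv b (partial_deriv b f) x)"
  by (simp add: laplacian_def sum_Basis_axis)

lemma schwartz_laplacian:
  fixes f :: "real ^ 'n \<Rightarrow> real"
  assumes "schwartz f"
  shows "schwartz (laplacian f)"
proof -
  have "schwartz (\<lambda>x. \<Sum>b\<in>Basis. partial_deriv b (partial_deriv b f) x)"
    by (intro schwartz_sum schwartz_partial_deriv assms) auto
  then show ?thesis unfolding laplacian_Basis[abs_def] .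
qed

lemma slow_fundamental_solution: "CARD('n) \<ge> 2 \<Longrightarrow> slow (fundamental_solution :: real ^ 'n \<Rightarrow> real)"
  using slow_fund_reg[of 0, where 'n='n]
  by (simp add: fundamental_solution_eq[abs_def] fund_reg_def[abs_def])

lemma partial_deriv_fundamental_solution:
  fixes y :: "real ^ 'n"
  assumes "CARD('n) \<ge> 2" "y \<noteq> 0"
  shows "partial_deriv v fundamental_solution y = fund_grad 0 v y"
  using fund_reg_derivative[OF assms(1), of y 0 v] assms(2)
  by (intro partial_derivI)
     (simp add: fundamental_solution_eq fund_reg_def has_real_derivative_iff_has_vector_derivative)

lemma fund_grad_0_axis: "fund_grad 0 (axis j 1) y = ((fund_const CARD('n) / norm y ^ CARD('n)) *\<^sub>R y) $ j"
  for y :: "real ^ 'n"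
  by (simp add: fund_grad_def inner_axis)

lemma convolve_gradient_fundamental_solution:
  fixes f :: "real ^ 'n \<Rightarrow> real"
  assumes d: "CARD('n) \<ge> 2" and f: "schwartz f"
  shows "convolve f (gradient fundamental_solution) x $ j = convolve (partial_deriv (axis j 1) f) fundamental_solution x"
proof -
  let ?K = "\<lambda>y::real^'n. (fund_const CARD('n) / norm y ^ CARD('n)) *\<^sub>R y"
  \<comment> \<open>The formal gradient at the singularity has some unspecified value; naming it
    suffices for measurability, and a single point does not affect the integral.\<close>
  define g0 where "g0 = gradient (fundamental_solution :: real ^ 'n \<Rightarrow> real) 0"
  have eq: "gradient fundamental_solution = (\<lambda>y. if y = 0 then g0 else ?K y)"
  proof
    fix y :: "real ^ 'n"
    show "gradient fundamental_solution y = (if y = 0 then g0 else ?K y)"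
    proof (cases "y = 0")
      case False
      then have "gradient fundamental_solution y $ i = ?K y $ i" for i
        unfolding fund_grad_0_axis[symmetric] using partial_deriv_fundamental_solution[OF d]
        by (simp add: gradient_def)
      then show ?thesis using False by (simp only: vec_eq_iff if_False) simp
    qed (simp add: g0_def)
  qed
  have [measurable]: "(gradient fundamental_solution :: real ^ 'n \<Rightarrow> real ^ 'n) \<in> borel_measurable borel"
    unfolding eq by measurable
  note [measurable] = schwartz_measurable[OF f]
  have "convolve f (gradient fundamental_solution) x = (\<integral>y. f y *\<^sub>R ?K (x - y) \<partial>lborel)"
    unfolding convolve_def
  proof (rule integral_cong_AE)
    show "AE y in lborel. f y *\<^sub>R gradient fundamental_solution (x - y) = f y *\<^sub>R ?K (x - y)"
      by (rule eventually_mono[OF AE_lborel_singleton[of x]]) (subst eq, simp)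
  qed measurable
  also have "\<dots> = (\<integral>y. f (x - y) *\<^sub>R ?K y \<partial>lborel)"
    by (subst lborel_integral_affine[of _ "-1" x]) auto
  finally have conv: "convolve f (gradient fundamental_solution) x = (\<integral>y. f (x - y) *\<^sub>R ?K y \<partial>lborel)" .
  have int: "integrable lborel (\<lambda>y. f (x - y) *\<^sub>R ?K y)"
  proof (rule Bochner_Integration.integrable_bound[OF integrable_mult_right[OF slow_weight_schwartz_integrable[OF f], of "fund_const CARD('n)"]])
    show "AE y in lborel. norm (f (x - y) *\<^sub>R ?K y) \<le> norm (fund_const CARD('n) * (slow_weight y * \<bar>f (x - y)\<bar>))"
    proof (rule eventually_mono[OF AE_lborel_singleton[of 0]])
      fix y :: "real ^ 'n" assume y: "y \<noteq> 0"
      have c: "fund_const CARD('n) > 0" by (intro fund_const_pos) simp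
      have "norm (f (x - y) *\<^sub>R ?K y) = fund_const CARD('n) * ((norm y / norm y ^ CARD('n)) * \<bar>f (x - y)\<bar>)"
        using c by (simp add: abs_mult)
      also have "\<dots> \<le> fund_const CARD('n) * (slow_weight y * \<bar>f (x - y)\<bar>)"
        using c slow_weight_ge(1)[OF y d] by (intro mult_left_mono mult_right_mono) auto
      finally show "norm (f (x - y) *\<^sub>R ?K y) \<le> norm (fund_const CARD('n) * (slow_weight y * \<bar>f (x - y)\<bar>))"
        by (rule order_trans) simp
    qed
  qed measurable
  have "convolve f (gradient fundamental_solution) x $ j = (\<integral>y. (f (x - y) *\<^sub>R ?K y) $ j \<partial>lborel)"
    unfolding conv by (rule integral_bounded_linear[OF bounded_linear_vec_nth int, symmetric])
  also have "\<dots> = (\<integral>y. fund_grad 0 (axis j 1) y * f (x - y) \<partial>lborel)"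
    by (simp only: fund_grad_0_axis vector_scaleR_component) (simp add: mult.commute)
  also have "\<dots> = convolve (partial_deriv (axis j 1) f) fundamental_solution x"
    by (rule convolve_fund_grad[OF d f])
  finally show ?thesis .
qed

lemma laplacian_convolve:
  fixes f :: "real ^ 'n \<Rightarrow> real"
  assumes d: "CARD('n) \<ge> 2" and f: "schwartz f"
  shows "laplacian (convolve f fundamental_solution) x = f x"
proof -
  note slow = slow_fundamental_solution[OF d]
  have "laplacian (convolve f fundamental_solution) x
      = (\<Sum>b\<in>Basis. convolve (partial_deriv b (partial_deriv b f)) fundamental_solution x)"
    unfolding laplacian_Basis
    by (simp add: partial_deriv_convolve[OF slow] f schwartz_partial_deriv)
  also have "\<dots> = convolve (\<lambda>x. \<Sum>b\<in>Basis. partial_deriv b (partial_deriv b f) x) fundamental_solution x"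
  proof -
    have m: "fundamental_solution \<in> borel_measurable (borel :: (real ^ 'n) measure)" using slow by (simp add: slow_def)
    have f2: "schwartz (partial_deriv b (partial_deriv b f))" for b by (intro schwartz_partial_deriv f)
    have L: "schwartz (\<lambda>x. \<Sum>b\<in>Basis. partial_deriv b (partial_deriv b f) x)" by (intro schwartz_sum f2) auto
    show ?thesis
      unfolding convolve_eq[OF schwartz_measurable[OF L] m] convolve_eq[OF schwartz_measurable[OF f2] m] sum_distrib_left
      by (rule Bochner_Integration.integral_sum[symmetric]) (rule slow_schwartz_integrable[OF slow f2])
  qed
  also have "\<dots> = f x" by (rule convolve_laplacian[OF d f])
  finally show ?thesis .
qed

lemma convolve_diff:
  fixes f g m :: "real ^ 'n \<Rightarrow> real"
  assumes m: "slow m" and f: "schwartz f" and g: "schwartz g"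
  shows "convolve (\<lambda>y. f y - g y) m x = convolve f m x - convolve g m x"
proof -
  have mm: "m \<in> borel_measurable borel" using m by (simp add: slow_def)
  show ?thesis
    unfolding convolve_eq[OF schwartz_measurable[OF schwartz_diff[OF f g]] mm]
      convolve_eq[OF schwartz_measurable[OF f] mm] convolve_eq[OF schwartz_measurable[OF g] mm] right_diff_distrib
    by (rule Bochner_Integration.integral_diff[OF slow_schwartz_integrable[OF m f] slow_schwartz_integrable[OF m g]])
qed

text \<open>The convolution is known here to have directional derivatives but not to be Schwartz, so
  linearity is verified along each direction. The convolution is differentiated through
  \<open>g\<close>, so the step can be repeated for the second derivative.\<close>

lemma laplacian_diff_convolve:
  fixes f g :: "real ^ 'n \<Rightarrow> real"
  assumes d: "CARD('n) \<ge> 2" and f: "schwartz f" and g: "schwartz g"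
  shows "laplacian (\<lambda>y. f y - convolve g fundamental_solution y) x = laplacian f x - g x"
proof -
  note slow = slow_fundamental_solution[OF d]
  have pd: "partial_deriv v (\<lambda>y. f y - convolve g fundamental_solution y)
      = (\<lambda>y. partial_deriv v f y - convolve (partial_deriv v g) fundamental_solution y)"
    if "schwartz f" "schwartz g" for f g :: "real ^ 'n \<Rightarrow> real" and v
  proof
    fix x
    have "((\<lambda>t. f (x + t *\<^sub>R v)) has_vector_derivative partial_deriv v f (x + 0 *\<^sub>R v)) (at 0)"
      by (rule has_vector_derivative_along[OF schwartz_differentiable[OF that(1)]])
    from has_vector_derivative_diff[OF this convolve_derivative[OF slow that(2)]]
    show "partial_deriv v (\<lambda>y. f y - convolve g fundamental_solution y) x
      = partial_deriv v f x - convolve (partial_deriv v g) fundamental_solution x"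
      by (intro partial_derivI) simp
  qed
  have "laplacian (\<lambda>y. f y - convolve g fundamental_solution y) x
      = laplacian f x - (\<Sum>b\<in>Basis. convolve (partial_deriv b (partial_deriv b g)) fundamental_solution x)"
    unfolding laplacian_Basis by (simp add: pd f g schwartz_partial_deriv sum_subtractf)
  also have "(\<Sum>b\<in>Basis. convolve (partial_deriv b (partial_deriv b g)) fundamental_solution x)
      = laplacian (convolve g fundamental_solution) x"
    unfolding laplacian_Basis by (simp add: partial_deriv_convolve[OF slow] g schwartz_partial_deriv)
  also have "\<dots> = g x" by (rule laplacian_convolve[OF d g])
  finally show ?thesis .
qed

lemma schwartz_divergence:
  fixes F :: "real ^ 'n \<Rightarrow> real ^ 'n"
  assumes "\<And>j. schwartz (\<lambda>x. F x $ j)"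
  shows "schwartz (divergence F)"
  unfolding divergence_def[abs_def] by (intro schwartz_sum schwartz_partial_deriv assms) auto

text \<open>The components of the potential part are \<open>convolve (partial_deriv (axis j 1)
  (divergence F)) fundamental_solution\<close>, and the Laplacian strips off the kernel. The
  right-hand side is local in \<open>F\<close>, hence Schwartz, although the solenoidal part itself
  need not be.\<close>

lemma vector_laplacian_solenoidal_part:
  fixes F :: "real ^ 'n \<Rightarrow> real ^ 'n"
  assumes d: "CARD('n) \<ge> 2" and F: "\<And>j. schwartz (\<lambda>x. F x $ j)"
  shows "vector_laplacian (solenoidal_part F) x $ j
    = laplacian (\<lambda>x. F x $ j) x - partial_deriv (axis j 1) (divergence F) x"
proof -
  note \<Phi> = schwartz_divergence[OF F]
  have "solenoidal_part F y $ j = F y $ j - convolve (partial_deriv (axis j 1) (divergence F)) fundamental_solution y" for y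
    by (simp add: solenoidal_part_def potential_part_def gradient_def
        partial_deriv_convolve[OF slow_fundamental_solution[OF d] \<Phi>])
  then show ?thesis
    by (simp add: vector_laplacian_def laplacian_diff_convolve[OF d F schwartz_partial_deriv[OF \<Phi>]])
qed

text \<open>Derivatives along a hyperplane integrate to \<open>0\<close>, so only the \<open>\<omega>\<close>-derivatives of the Laplacian survive.\<close>

lemma radon_laplacian:
  fixes \<omega> :: "real ^ 'n"
  assumes v0: "orthonormal_basis_extending \<omega> v0" and f: "schwartz f"
  shows "radon (laplacian f) \<omega> p = radon (partial_deriv \<omega> (partial_deriv \<omega> f)) \<omega> p"
proof -
  have f1: "schwartz (partial_deriv v f)" and f2: "schwartz (partial_deriv w (partial_deriv v f))" for v w
    by (intro schwartz_partial_deriv f)+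
  have one: "(\<Sum>b\<in>Basis. (\<omega> \<bullet> b)\<^sup>2) = 1"
    using norm_basis[OF v0] euclidean_inner[of \<omega> \<omega>] by (simp add: norm_eq_1 power2_eq_square)
  have comm: "radon (partial_deriv \<omega> (partial_deriv b f)) \<omega> p = (\<omega> \<bullet> b) * radon (partial_deriv \<omega> (partial_deriv \<omega> f)) \<omega> p" for b
  proof -
    have "(\<lambda>q. radon (partial_deriv b f) \<omega> q) = (\<lambda>q. (\<omega> \<bullet> b) * radon (partial_deriv \<omega> f) \<omega> q)"
      by (intro ext radon_partial_deriv[OF v0 f])
    then have "((\<lambda>q. radon (partial_deriv b f) \<omega> q) has_real_derivative (\<omega> \<bullet> b) * radon (partial_deriv \<omega> (partial_deriv \<omega> f)) \<omega> p) (at p)"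
      using DERIV_cmult[OF radon_has_derivative[OF v0 f1]] by simp
    from DERIV_unique[OF radon_has_derivative[OF v0 f1] this] show ?thesis .
  qed
  have "radon (laplacian f) \<omega> p = radon (\<lambda>x. \<Sum>b\<in>Basis. 1 * partial_deriv b (partial_deriv b f) x) \<omega> p"
    by (simp add: laplacian_Basis[abs_def])
  also have "\<dots> = (\<Sum>b\<in>Basis. 1 * radon (partial_deriv b (partial_deriv b f)) \<omega> p)"
    by (rule radon_sum[OF v0 _ f2]) simp
  also have "\<dots> = (\<Sum>b\<in>Basis. (\<omega> \<bullet> b)\<^sup>2 * radon (partial_deriv \<omega> (partial_deriv \<omega> f)) \<omega> p)"
    by (intro sum.cong refl) (subst radon_partial_deriv[OF v0 f1], subst comm, simp add: power2_eq_square)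
  also have "\<dots> = radon (partial_deriv \<omega> (partial_deriv \<omega> f)) \<omega> p"
    by (simp add: sum_distrib_right[symmetric] one)
  finally show ?thesis .
qed

lemma radon_twice_differentiable:
  fixes \<omega> :: "real ^ 'n"
  assumes v0: "orthonormal_basis_extending \<omega> v0" and f: "schwartz f"
  shows "twice_differentiable (radon f \<omega>)" "second_deriv (radon f \<omega>) p = radon (partial_deriv \<omega> (partial_deriv \<omega> f)) \<omega> p"
proof -
  note f1 = schwartz_partial_deriv[OF f, of \<omega>]
  have d1: "(radon g \<omega> has_vector_derivative radon (partial_deriv \<omega> g) \<omega> p) (at p)" if "schwartz g" for g p
    using radon_has_derivative[OF v0 that] by (simp add: has_real_derivative_iff_has_vector_derivative)
  have "(\<lambda>q. vector_derivative (radon f \<omega>) (at q)) = radon (partial_deriv \<omega> f) \<omega>"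
    by (intro ext vector_derivative_at d1 f)
  then show "twice_differentiable (radon f \<omega>)" "second_deriv (radon f \<omega>) p = radon (partial_deriv \<omega> (partial_deriv \<omega> f)) \<omega> p"
    unfolding twice_differentiable_def second_deriv_def
    using d1[OF f] d1[OF f1] by (auto intro: differentiableI_vector vector_derivative_at)
qed

text \<open>\<open>second_deriv\<close> of a vector-valued function is a limit in the vector space,
  whereas Radon transforms are differentiated componentwise; expansion in the axis vectors
  reconciles the two.\<close>

lemma twice_differentiable_vec:
  fixes h :: "real \<Rightarrow> real ^ 'n"
  assumes "\<And>j. twice_differentiable (\<lambda>q. h q $ j)"
  shows "twice_differentiable h" "second_deriv h p $ j = second_deriv (\<lambda>q. h q $ j) p"
proof -
  have vec: "((\<lambda>q. g q) has_vector_derivative (\<chi> j. vector_derivative (\<lambda>q. g q $ j) (at p))) (at p)"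
    if "\<And>j. (\<lambda>q. g q $ j) differentiable (at p)" for g :: "real \<Rightarrow> real ^ 'n" and p
  proof -
    have "((\<lambda>q. \<Sum>j\<in>UNIV. (g q $ j) *\<^sub>R axis j 1) has_vector_derivative
        (\<Sum>j\<in>UNIV. vector_derivative (\<lambda>q. g q $ j) (at p) *\<^sub>R axis j (1::real))) (at p)"
      using that by (intro has_vector_derivative_sum bounded_linear.has_vector_derivative[OF bounded_linear_scaleR_left])
        (simp add: vector_derivative_works)
    moreover have "(\<Sum>j\<in>UNIV. (w $ j) *\<^sub>R axis j (1::real)) = w" for w :: "real ^ 'n"
      using basis_expansion[of w] by (simp add: scalar_mult_eq_scaleR)
    moreover from this[of "\<chi> j. vector_derivative (\<lambda>q. g q $ j) (at p)"]
    have "(\<Sum>j\<in>UNIV. vector_derivative (\<lambda>q. g q $ j) (at p) *\<^sub>R axis j (1::real)) = (\<chi> j. vector_derivative (\<lambda>q. g q $ j) (at p))"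
      by simp
    ultimately show ?thesis by simp
  qed
  have h1: "(h has_vector_derivative (\<chi> j. vector_derivative (\<lambda>q. h q $ j) (at p))) (at p)" for p
    using vec[of h p] assms by (simp add: twice_differentiable_def)
  have D: "(\<lambda>q. vector_derivative h (at q)) = (\<lambda>q. \<chi> j. vector_derivative (\<lambda>q. h q $ j) (at q))"
    by (intro ext vector_derivative_at h1)
  have h2: "((\<lambda>q. \<chi> j. vector_derivative (\<lambda>q. h q $ j) (at q)) has_vector_derivative
      (\<chi> j. second_deriv (\<lambda>q. h q $ j) p)) (at p)" for p
    using vec[of "\<lambda>q. \<chi> j. vector_derivative (\<lambda>q. h q $ j) (at q)" p] assms
    by (simp add: twice_differentiable_def second_deriv_def)
  show "twice_differentiable h"
    unfolding twice_differentiable_def D using h1 h2 by (blast intro: differentiableI_vector)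
  show "second_deriv h p $ j = second_deriv (\<lambda>q. h q $ j) p"
    unfolding second_deriv_def[of h] D by (simp add: vector_derivative_at[OF h2])
qed

lemma schwartz_inner:
  fixes F :: "real ^ 'n \<Rightarrow> real ^ 'n"
  assumes F: "\<And>j. schwartz (\<lambda>x. F x $ j)"
  shows "schwartz (\<lambda>x. v \<bullet> F x)"
proof -
  have "schwartz (\<lambda>x. \<Sum>j\<in>UNIV. (v $ j) *\<^sub>R (F x $ j))"
    by (intro schwartz_sum schwartz_scaleR F) auto
  then show ?thesis by (simp add: inner_vec_def)
qed

lemma schwartz_vector_laplacian_solenoidal_part:
  fixes F :: "real ^ 'n \<Rightarrow> real ^ 'n"
  assumes d: "CARD('n) \<ge> 2" and F: "\<And>j. schwartz (\<lambda>x. F x $ j)"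
  shows "schwartz (\<lambda>x. vector_laplacian (solenoidal_part F) x $ j)"
  unfolding vector_laplacian_solenoidal_part[OF d F]
  by (intro schwartz_diff schwartz_laplacian F schwartz_partial_deriv schwartz_divergence)

section \<open>Radon transforms of the field in one fixed direction\<close>

context
  fixes F :: "real ^ 'n \<Rightarrow> real ^ 'n" and \<omega> :: "real ^ 'n" and u :: "nat \<Rightarrow> real ^ 'n"
  assumes d: "CARD('n) \<ge> 2" and F: "\<And>j. schwartz (\<lambda>x. F x $ j)"
    and u: "orthonormal_basis_extending \<omega> u"
begin

abbreviation (input) Psi :: "real ^ 'n \<Rightarrow> real ^ 'n" where
  "Psi \<equiv> vector_laplacian (solenoidal_part F)"

lemma radon_inner: "radon (\<lambda>x. v \<bullet> F x) \<omega> p = (\<Sum>j\<in>UNIV. v $ j * radon (\<lambda>x. F x $ j) \<omega> p)"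
  unfolding inner_vec_def inner_real_def by (rule radon_sum[OF u _ F]) simp

text \<open>The longitudinal transforms are the coordinates, along the basis vectors tangential to
  the hyperplane, of the vector \<open>w\<close> of componentwise Radon transforms. Summing them
  leaves \<open>w\<close> without its \<omega>-component, whichever basis was chosen.\<close>

lemma longitudinal_sum:
  "(\<Sum>k=1..CARD('n) - 1. radon (\<lambda>x. u k \<bullet> F x) \<omega> q *\<^sub>R u k) $ j
    = radon (\<lambda>x. F x $ j - \<omega> $ j * (\<omega> \<bullet> F x)) \<omega> q"
proof -
  define w where "w = (\<chi> j. radon (\<lambda>x. F x $ j) \<omega> q)"
  have rv: "radon (\<lambda>x. v \<bullet> F x) \<omega> q = w \<bullet> v" for v
    unfolding radon_inner by (simp add: w_def inner_vec_def mult.commute)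
  have "(\<Sum>k=1..CARD('n) - 1. (w \<bullet> u k) *\<^sub>R u k) = w - (w \<bullet> \<omega>) *\<^sub>R \<omega>"
    using basis_representation_split[OF u, of w] by (simp add: algebra_simps)
  then have "(\<Sum>k=1..CARD('n) - 1. radon (\<lambda>x. u k \<bullet> F x) \<omega> q *\<^sub>R u k) $ j = w $ j - (w \<bullet> \<omega>) * \<omega> $ j"
    by (simp add: rv)
  also have "\<dots> = radon (\<lambda>x. F x $ j) \<omega> q + - (\<omega> $ j) * radon (\<lambda>x. \<omega> \<bullet> F x) \<omega> q"
    by (simp add: rv w_def)
  also have "\<dots> = radon (\<lambda>x. F x $ j + - (\<omega> $ j) * (\<omega> \<bullet> F x)) \<omega> q"
    using radon_add[OF u F[of j] schwartz_scaleR[OF schwartz_inner[OF F, of \<omega>], of "- (\<omega> $ j)"], of q]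
      radon_mult[OF u schwartz_inner[OF F, of \<omega>], of "- (\<omega> $ j)" q] by simp
  finally show ?thesis by simp
qed

lemma radon_diff:
  assumes "schwartz f" "schwartz g"
  shows "radon (\<lambda>x. f x - g x) \<omega> p = radon f \<omega> p - radon g \<omega> p"
  using radon_add[OF u assms(1) schwartz_scaleR[OF assms(2), of "-1"], of p] radon_mult[OF u assms(2), of "-1" p] by simp

text \<open>Each \<open>axis j 1\<close> derivative turns into the factor
  \<open>\<omega> $ j\<close> times the \<omega>-derivative, so only the normal component of the
  field contributes.\<close>

lemma radon_divergence: "radon (divergence F) \<omega> p = radon (partial_deriv \<omega> (\<lambda>x. \<omega> \<bullet> F x)) \<omega> p"
proof -
  have "radon (divergence F) \<omega> p = (\<Sum>j\<in>UNIV. 1 * radon (partial_deriv (axis j 1) (\<lambda>y. F y $ j)) \<omega> p)"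
    using radon_sum[OF u, of UNIV "\<lambda>j. partial_deriv (axis j 1) (\<lambda>y. F y $ j)" "\<lambda>_. 1" p]
      schwartz_partial_deriv[OF F] by (simp add: divergence_def[abs_def])
  also have "\<dots> = (\<Sum>j\<in>UNIV. \<omega> $ j * radon (partial_deriv \<omega> (\<lambda>y. F y $ j)) \<omega> p)"
    by (intro sum.cong refl) (subst radon_partial_deriv[OF u F], simp add: inner_axis)
  also have "\<dots> = radon (\<lambda>x. \<Sum>j\<in>UNIV. \<omega> $ j * partial_deriv \<omega> (\<lambda>y. F y $ j) x) \<omega> p"
    by (rule radon_sum[OF u _ schwartz_partial_deriv[OF F], symmetric]) simp
  also have "(\<lambda>x. \<Sum>j\<in>UNIV. \<omega> $ j * partial_deriv \<omega> (\<lambda>y. F y $ j) x) = partial_deriv \<omega> (\<lambda>x. \<omega> \<bullet> F x)"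
  proof -
    have "partial_deriv \<omega> (\<lambda>x. \<Sum>j\<in>UNIV. \<omega> $ j *\<^sub>R (F x $ j)) = (\<lambda>x. \<Sum>j\<in>UNIV. partial_deriv \<omega> (\<lambda>x. \<omega> $ j *\<^sub>R (F x $ j)) x)"
      by (rule partial_deriv_sum[OF finite]) (intro schwartz_differentiable schwartz_scaleR F)
    then show ?thesis
      using partial_deriv_linear[OF bounded_linear_scaleR_right schwartz_differentiable[OF F]] by (simp add: inner_vec_def)
  qed
  finally show ?thesis .
qed

lemma longitudinal_reconstruction:
  defines "D \<equiv> \<lambda>q. \<Sum>k=1..CARD('n) - 1. radon (\<lambda>x. u k \<bullet> F x) \<omega> q *\<^sub>R u k"
  shows "twice_differentiable D" "componentwise_radon Psi \<omega> p = second_deriv D p"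
proof -
  let ?h = "\<lambda>j x. F x $ j - \<omega> $ j * (\<omega> \<bullet> F x)"
  have h: "schwartz (?h j)" for j
    using schwartz_diff[OF F schwartz_scaleR[OF schwartz_inner[OF F, of \<omega>], of "\<omega> $ j"]] by simp
  have Dj: "(\<lambda>q. D q $ j) = radon (?h j) \<omega>" for j
    unfolding D_def by (intro ext longitudinal_sum)
  have tw: "twice_differentiable (\<lambda>q. D q $ j)" for j
    unfolding Dj by (rule radon_twice_differentiable[OF u h])
  then show "twice_differentiable D" by (rule twice_differentiable_vec)
  have "componentwise_radon Psi \<omega> p $ j = second_deriv D p $ j" for j
  proof -
    note \<Phi> = schwartz_divergence[OF F]
    \<comment> \<open>\<open>radon_divergence\<close> is an identity in \<open>p\<close>, so its two
      sides have the same derivative in \<open>p\<close>; that derivative is taken inside each Radon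
      transform as an \<omega>-derivative.\<close>
    have \<Phi>1: "radon (partial_deriv \<omega> (divergence F)) \<omega> p = radon (partial_deriv \<omega> (partial_deriv \<omega> (\<lambda>x. \<omega> \<bullet> F x))) \<omega> p"
    proof -
      have "radon (divergence F) \<omega> = radon (partial_deriv \<omega> (\<lambda>x. \<omega> \<bullet> F x)) \<omega>"
        by (intro ext radon_divergence)
      then show ?thesis
        using DERIV_unique[OF radon_has_derivative[OF u \<Phi>, of p]]
          radon_has_derivative[OF u schwartz_partial_deriv[OF schwartz_inner[OF F, of \<omega>], of \<omega>], of p] by simp
    qed
    have "componentwise_radon Psi \<omega> p $ j
        = radon (laplacian (\<lambda>x. F x $ j)) \<omega> p - radon (partial_deriv (axis j 1) (divergence F)) \<omega> p"
      unfolding componentwise_radon_def vector_laplacian_solenoidal_part[OF d F]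
      by (simp add: radon_diff schwartz_laplacian F schwartz_partial_deriv \<Phi>)
    also have "\<dots> = second_deriv (radon (\<lambda>x. F x $ j) \<omega>) p - \<omega> $ j * second_deriv (radon (\<lambda>x. \<omega> \<bullet> F x) \<omega>) p"
      by (simp add: radon_laplacian[OF u F] radon_partial_deriv[OF u \<Phi>, of "axis j 1"] \<Phi>1 inner_axis
          radon_twice_differentiable(2)[OF u] F schwartz_inner[OF F])
    also have "\<dots> = second_deriv (radon (?h j) \<omega>) p"
    proof -
      let ?DD = "\<lambda>f. partial_deriv \<omega> (partial_deriv \<omega> f)"
      have r: "radon (?h j) \<omega> q = radon (\<lambda>x. F x $ j) \<omega> q - \<omega> $ j * radon (\<lambda>x. \<omega> \<bullet> F x) \<omega> q" for q
        using radon_diff[OF F[of j] schwartz_scaleR[OF schwartz_inner[OF F, of \<omega>], of "\<omega> $ j"], of q]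
          radon_mult[OF u schwartz_inner[OF F, of \<omega>], of "\<omega> $ j" q] by simp
      note g = schwartz_inner[OF F, of \<omega>]
      have "(radon (?h j) \<omega> has_real_derivative radon (partial_deriv \<omega> (\<lambda>x. F x $ j)) \<omega> q - \<omega> $ j * radon (partial_deriv \<omega> (\<lambda>x. \<omega> \<bullet> F x)) \<omega> q) (at q)" for q
        unfolding r[abs_def] by (intro DERIV_diff DERIV_cmult radon_has_derivative[OF u] F g)
      then have v: "(\<lambda>q. vector_derivative (radon (?h j) \<omega>) (at q))
          = (\<lambda>q. radon (partial_deriv \<omega> (\<lambda>x. F x $ j)) \<omega> q - \<omega> $ j * radon (partial_deriv \<omega> (\<lambda>x. \<omega> \<bullet> F x)) \<omega> q)"
        by (intro ext vector_derivative_at) (simp add: has_real_derivative_iff_has_vector_derivative)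
      have "((\<lambda>q. radon (partial_deriv \<omega> (\<lambda>x. F x $ j)) \<omega> q - \<omega> $ j * radon (partial_deriv \<omega> (\<lambda>x. \<omega> \<bullet> F x)) \<omega> q)
          has_real_derivative radon (?DD (\<lambda>x. F x $ j)) \<omega> p - \<omega> $ j * radon (?DD (\<lambda>x. \<omega> \<bullet> F x)) \<omega> p) (at p)"
        by (intro DERIV_diff DERIV_cmult radon_has_derivative[OF u] schwartz_partial_deriv F g)
      then have "second_deriv (radon (?h j) \<omega>) p = radon (?DD (\<lambda>x. F x $ j)) \<omega> p - \<omega> $ j * radon (?DD (\<lambda>x. \<omega> \<bullet> F x)) \<omega> p"
        unfolding second_deriv_def v by (intro vector_derivative_at) (simp add: has_real_derivative_iff_has_vector_derivative)
      then show ?thesis by (simp add: radon_twice_differentiable(2)[OF u] F g)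
    qed
    also have "\<dots> = second_deriv D p $ j"
      unfolding Dj[symmetric] using tw by (rule twice_differentiable_vec(2)[symmetric])
    finally show ?thesis .
  qed
  then show "componentwise_radon Psi \<omega> p = second_deriv D p" by (simp add: vec_eq_iff)
qed

text \<open>The weight is there to make the divergence visible. Without it, the divergence enters
  \<open>w \<bullet> Psi y\<close> through a derivative along \<open>w\<close>, which integrates to
  0 over the hyperplane. With the weight \<open>y \<bullet> w\<close>, the product rule leaves the
  divergence itself as a remainder, and every other first-order term is a derivative along
  \<open>w\<close>.\<close>

lemma weighted_reconstruction:
  defines "W \<equiv> \<lambda>q. radon (\<lambda>x. (u 1 \<bullet> x) * (F x \<bullet> u 1)) \<omega> q"
  shows "twice_differentiable W"
    and "radon (\<lambda>y. (y \<bullet> u 1) * (u 1 \<bullet> Psi y)) \<omega> p - second_deriv W p = radon (divergence F) \<omega> p"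
proof -
  define w where "w = u 1"
  define h where "h x = w \<bullet> F x" for x
  define k where "k x = (x \<bullet> w) *\<^sub>R h x" for x
  \<comment> \<open>Index 1 belongs to the basis because the dimension is at least 2. Orthogonality
    makes \<open>w\<close> a direction inside the hyperplane, and its length 1 fixes the coefficient
    of the divergence below.\<close>
  have w: "w \<bullet> w = 1" "\<omega> \<bullet> w = 0"
    using basis_orthonormal[OF u, of 1 1] basis_perp[OF u, of 1] d by (auto simp: w_def)
  have h: "schwartz h" unfolding h_def by (rule schwartz_inner[OF F])
  have k: "schwartz k" unfolding k_def by (rule schwartz_coord_mult[OF h])
  note \<Phi> = schwartz_divergence[OF F]
  have W: "W = radon k \<omega>"
    unfolding W_def k_def[abs_def] h_def w_def by (simp add: inner_commute)
  show "twice_differentiable W" unfolding W by (rule radon_twice_differentiable[OF u k])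
  have Psi_w: "w \<bullet> Psi y = laplacian h y - partial_deriv w (divergence F) y" for y
  proof -
    have "laplacian h y = (\<Sum>j\<in>UNIV. w $ j * laplacian (\<lambda>x. F x $ j) y)"
    proof -
      have lin: "partial_deriv v (\<lambda>x. \<Sum>j\<in>UNIV. w $ j *\<^sub>R f j x) = (\<lambda>x. \<Sum>j\<in>UNIV. w $ j *\<^sub>R partial_deriv v (f j) x)"
        if "\<And>j. schwartz (f j)" for f :: "'n \<Rightarrow> real ^ 'n \<Rightarrow> real" and v
      proof -
        have "partial_deriv v (\<lambda>x. \<Sum>j\<in>UNIV. w $ j *\<^sub>R f j x) = (\<lambda>x. \<Sum>j\<in>UNIV. partial_deriv v (\<lambda>x. w $ j *\<^sub>R f j x) x)"
          by (rule partial_deriv_sum[OF finite]) (intro schwartz_differentiable schwartz_scaleR that)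
        then show ?thesis
          using partial_deriv_linear[OF bounded_linear_scaleR_right schwartz_differentiable[OF that]] by simp
      qed
      have sum: "h = (\<lambda>x. \<Sum>j\<in>UNIV. w $ j *\<^sub>R (F x $ j))" by (simp add: h_def[abs_def] inner_vec_def)
      have "laplacian h y = (\<Sum>b\<in>Basis. \<Sum>j\<in>UNIV. w $ j * partial_deriv b (partial_deriv b (\<lambda>x. F x $ j)) y)"
        unfolding laplacian_Basis sum lin[OF F] lin[OF schwartz_partial_deriv[OF F]] by simp
      also have "\<dots> = (\<Sum>j\<in>UNIV. w $ j * laplacian (\<lambda>x. F x $ j) y)"
        unfolding laplacian_Basis sum_distrib_left by (rule sum.swap)
      finally show ?thesis .
    qed
    moreover have "partial_deriv w (divergence F) y = (\<Sum>j\<in>UNIV. w $ j * partial_deriv (axis j 1) (divergence F) y)"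
      using partial_deriv_euclidean[OF schwartz_differentiable[OF \<Phi>], of w]
      by (simp add: sum_Basis_axis inner_axis)
    ultimately show ?thesis
      by (simp add: inner_vec_def vector_laplacian_solenoidal_part[OF d F] right_diff_distrib sum_subtractf)
  qed
  have lap_k: "laplacian k x = (x \<bullet> w) * laplacian h x + 2 * partial_deriv w h x" for x
  proof -
    have p1: "partial_deriv b k = (\<lambda>x. (x \<bullet> w) *\<^sub>R partial_deriv b h x + (b \<bullet> w) *\<^sub>R h x)" for b
      unfolding k_def[abs_def] by (rule partial_deriv_coord_mult[OF schwartz_differentiable[OF h]])
    have p2: "partial_deriv b (partial_deriv b k) x = (x \<bullet> w) * partial_deriv b (partial_deriv b h) x + 2 * ((b \<bullet> w) * partial_deriv b h x)" for b
      unfolding p1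
      by (subst partial_deriv_add)
         (auto intro!: schwartz_differentiable schwartz_coord_mult schwartz_scaleR schwartz_partial_deriv h
           simp: partial_deriv_coord_mult[OF schwartz_differentiable[OF schwartz_partial_deriv[OF h]]]
             partial_deriv_linear[OF bounded_linear_scaleR_right schwartz_differentiable[OF h]] simp del: real_scaleR_def,
          simp)
    have "partial_deriv w h x = (\<Sum>b\<in>Basis. (b \<bullet> w) * partial_deriv b h x)"
      using partial_deriv_euclidean[OF schwartz_differentiable[OF h], of w] by (simp add: inner_commute)
    then show ?thesis
      unfolding laplacian_Basis p2 by (simp add: sum.distrib sum_distrib_left)
  qed
  have pd_w: "partial_deriv w (\<lambda>x. (x \<bullet> w) *\<^sub>R divergence F x) = (\<lambda>x. (x \<bullet> w) *\<^sub>R partial_deriv w (divergence F) x + divergence F x)"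
    unfolding partial_deriv_coord_mult[OF schwartz_differentiable[OF \<Phi>]] w(1) by simp
  let ?c = "\<lambda>x. (x \<bullet> w) *\<^sub>R divergence F x"
  have c: "schwartz ?c" by (rule schwartz_coord_mult[OF \<Phi>])
  have perp: "radon (partial_deriv w f) \<omega> p = 0" if "schwartz f" for f
    using radon_partial_deriv[OF u that, of w p] w(2) by simp
  \<comment> \<open>Weight times Laplacian of \<open>h\<close> is the Laplacian of \<open>k\<close>
    minus a \<open>w\<close>-derivative; weight times \<open>w\<close>-derivative of the divergence
    is the \<open>w\<close>-derivative of \<open>?c\<close> minus the divergence. Both
    \<open>w\<close>-derivatives vanish under the Radon transform.\<close>
  have "(\<lambda>y. (y \<bullet> u 1) * (u 1 \<bullet> Psi y)) = (\<lambda>y. (laplacian k y - 2 *\<^sub>R partial_deriv w h y) - (partial_deriv w ?c y - divergence F y))"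
    unfolding pd_w lap_k Psi_w w_def[symmetric] by (simp add: algebra_simps)
  then have "radon (\<lambda>y. (y \<bullet> u 1) * (u 1 \<bullet> Psi y)) \<omega> p
     = (radon (laplacian k) \<omega> p - radon (\<lambda>y. 2 *\<^sub>R partial_deriv w h y) \<omega> p) - (radon (partial_deriv w ?c) \<omega> p - radon (divergence F) \<omega> p)"
    by (simp only: radon_diff schwartz_diff schwartz_laplacian k schwartz_scaleR schwartz_partial_deriv h c \<Phi>)
  also have "\<dots> = radon (partial_deriv \<omega> (partial_deriv \<omega> k)) \<omega> p + radon (divergence F) \<omega> p"
    using radon_mult[OF u schwartz_partial_deriv[OF h], of 2 w p] perp[OF c] perp[OF h] by (simp add: radon_laplacian[OF u k])
  finally show "radon (\<lambda>y. (y \<bullet> u 1) * (u 1 \<bullet> Psi y)) \<omega> p - second_deriv W p = radon (divergence F) \<omega> p"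
    by (simp add: W radon_twice_differentiable(2)[OF u k])
qed

end

text \<open>Convolving \<open>vector_laplacian (solenoidal_part F)\<close> with the kernel returns
  \<open>F\<close> minus its potential part, and the potential part is the first summand, since the
  derivative may sit on the divergence or on the kernel.\<close>

lemma helmholtz_reconstruction:
  fixes F :: "real ^ 'n \<Rightarrow> real ^ 'n"
  assumes d: "CARD('n) \<ge> 2" and F: "\<And>j. schwartz (\<lambda>x. F x $ j)"
  shows "F x = convolve (divergence F) (gradient fundamental_solution) x
    + (\<Sum>j\<in>UNIV. convolve (\<lambda>y. vector_laplacian (solenoidal_part F) y $ j) fundamental_solution x *\<^sub>R axis j 1)"
proof -
  note \<Phi> = schwartz_divergence[OF F] and slow = slow_fundamental_solution[OF d]
  have "convolve (\<lambda>y. vector_laplacian (solenoidal_part F) y $ j) fundamental_solution x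
      = F x $ j - convolve (partial_deriv (axis j 1) (divergence F)) fundamental_solution x" for j
    unfolding vector_laplacian_solenoidal_part[OF d F]
    using convolve_diff[OF slow schwartz_laplacian[OF F] schwartz_partial_deriv[OF \<Phi>]] convolve_laplacian[OF d F]
    by (simp add: laplacian_Basis[abs_def])
  moreover have "(\<Sum>i\<in>UNIV. c i *\<^sub>R axis i (1::real)) $ j = c j" for c and j :: 'n
    by (simp add: axis_def if_distrib cong: if_cong)
  ultimately show ?thesis
    by (simp add: vec_eq_iff convolve_gradient_fundamental_solution[OF d \<Phi>] del: sum_component)
qed

text \<open>The clauses on \<open>twice_differentiable\<close> give content to
  \<open>second_deriv\<close>, which has some value even where a derivative fails to exist. The
  inversion formulas are stated in the complex numbers because \<open>radon_inverse\<close> is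
  complex-valued. The choice of \<open>b\<close> may vary arbitrarily with \<omega>: the
  backprojected data equal Radon transforms of Schwartz functions, in which the basis no longer
  appears.\<close>

theorem theorem3:
  fixes F \<Psi> :: "real ^ 'n \<Rightarrow> real ^ 'n" and \<Phi> :: "real ^ 'n \<Rightarrow> real"
    and b :: "real ^ 'n \<Rightarrow> nat \<Rightarrow> real ^ 'n" and \<alpha> :: real
  assumes "CARD('n) \<ge> 2"
    and "smooth F"
    and "\<And>j. schwartz (\<lambda>x. F x $ j)"
    and "\<And>\<omega>. \<omega> \<in> sphere 0 1 \<Longrightarrow> orthonormal_basis_extending \<omega> (b \<omega>)"
    and "\<Phi> = divergence F"
    and "\<Psi> = vector_laplacian (solenoidal_part F)"
    and "\<alpha> < real CARD('n)"
  shows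
    "(\<forall>\<omega> \<in> sphere 0 1.
        twice_differentiable (\<lambda>q. \<Sum>j=1..CARD('n) - 1. longitudinal_radon b j F \<omega> q *\<^sub>R b \<omega> j) \<and>
        (\<forall>p. componentwise_radon \<Psi> \<omega> p =
          second_deriv (\<lambda>q. \<Sum>j=1..CARD('n) - 1. longitudinal_radon b j F \<omega> q *\<^sub>R b \<omega> j) p))
     \<and> (\<forall>j x. complex_of_real (\<Psi> x $ j) =
          radon_inverse \<alpha> (\<lambda>\<omega> p. axis j 1 \<bullet> componentwise_radon \<Psi> \<omega> p) x)
     \<and> (\<forall>\<omega> \<in> sphere 0 1. twice_differentiable (weighted_longitudinal_radon b 1 F \<omega>))
     \<and> (\<forall>x. complex_of_real (\<Phi> x) =
          radon_inverse \<alpha> (\<lambda>\<omega> p. radon (\<lambda>y. (y \<bullet> b \<omega> 1) * (b \<omega> 1 \<bullet> \<Psi> y)) \<omega> p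
            - second_deriv (weighted_longitudinal_radon b 1 F \<omega>) p) x)
     \<and> (\<forall>x. F x = convolve \<Phi> (gradient fundamental_solution) x
          + (\<Sum>j\<in>UNIV. convolve (\<lambda>y. \<Psi> y $ j) fundamental_solution x *\<^sub>R axis j 1))"
proof (intro conjI ballI allI)
  note d = assms(1) and F = assms(3) and b = assms(4)
  have W: "weighted_longitudinal_radon b 1 F \<omega> = (\<lambda>q. radon (\<lambda>x. (b \<omega> 1 \<bullet> x) * (F x \<bullet> b \<omega> 1)) \<omega> q)" for \<omega>
    by (intro ext) (simp add: weighted_longitudinal_radon_def)
  {
    fix \<omega> :: "real ^ 'n" assume \<omega>: "\<omega> \<in> sphere 0 1"
    show "twice_differentiable (\<lambda>q. \<Sum>j=1..CARD('n) - 1. longitudinal_radon b j F \<omega> q *\<^sub>R b \<omega> j)"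
      unfolding longitudinal_radon_def by (rule longitudinal_reconstruction(1)[OF d F b[OF \<omega>]])
    show "componentwise_radon \<Psi> \<omega> p = second_deriv (\<lambda>q. \<Sum>j=1..CARD('n) - 1. longitudinal_radon b j F \<omega> q *\<^sub>R b \<omega> j) p" for p
      unfolding longitudinal_radon_def assms(6) by (rule longitudinal_reconstruction(2)[OF d F b[OF \<omega>]])
    show "twice_differentiable (weighted_longitudinal_radon b 1 F \<omega>)"
      unfolding W by (rule weighted_reconstruction(1)[OF d F b[OF \<omega>]])
  }
  show "complex_of_real (\<Psi> x $ j) = radon_inverse \<alpha> (\<lambda>\<omega> p. axis j 1 \<bullet> componentwise_radon \<Psi> \<omega> p) x" for j x
    unfolding assms(6)
    by (rule radon_inverse_radon[OF schwartz_vector_laplacian_solenoidal_part[OF d F] assms(7) b, symmetric])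
       (auto simp: componentwise_radon_def inner_axis')
  show "complex_of_real (\<Phi> x) = radon_inverse \<alpha> (\<lambda>\<omega> p. radon (\<lambda>y. (y \<bullet> b \<omega> 1) * (b \<omega> 1 \<bullet> \<Psi> y)) \<omega> p
      - second_deriv (weighted_longitudinal_radon b 1 F \<omega>) p) x" for x
    unfolding assms(5,6) W
  proof (rule radon_inverse_radon[OF schwartz_divergence[OF F] assms(7) b, symmetric])
    fix \<omega> :: "real ^ 'n" and p assume \<omega>: "\<omega> \<in> sphere 0 1"
    show "radon (\<lambda>y. (y \<bullet> b \<omega> 1) * (b \<omega> 1 \<bullet> vector_laplacian (solenoidal_part F) y)) \<omega> p
        - second_deriv (\<lambda>q. radon (\<lambda>x. (b \<omega> 1 \<bullet> x) * (F x \<bullet> b \<omega> 1)) \<omega> q) p = radon (divergence F) \<omega> p"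
      by (rule weighted_reconstruction(2)[OF d F b[OF \<omega>]])
  qed
  show "F x = convolve \<Phi> (gradient fundamental_solution) x
      + (\<Sum>j\<in>UNIV. convolve (\<lambda>y. \<Psi> y $ j) fundamental_solution x *\<^sub>R axis j 1)" for x
    unfolding assms(5,6) by (rule helmholtz_reconstruction[OF d F])
qed

end
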